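(* Consider the telegraph process driven by Pólya urn trials with parameters $b,r,A>0$ and velocities $c>0$, $-v<0$ described in the context. Let $\lambda,\mu>0$, let $U_1$ and $D_1$ be gamma distributed with parameters $\left(\frac bA+1,\lambda\right)$ and $\left(\frac rA+1,\mu\right)$, respectively, and let $U_k$ and $D_k$, for $k\ge2$, be exponentially distributed with parameters $\lambda$ and $\mu$, respectively. For $t>0$ and $-vt<x<ct$ put $\tau_*=\frac{vt+x}{c+v}$. Then for all $t>0$ and $-vt<x<ct$ the probability density of $S_t$ is $$p(x,t)=\frac{b}{b+r}\,p(x,t\,|\,c)+\frac{r}{b+r}\,p(x,t\,|\,-v),$$ where $$p(x,t\,|\,c)=\frac{r\lambda(\lambda\tau_* )^{b/A-1}e^{-\lambda\tau_*}}{(c+v)A\,\Gamma\left(\frac{b+A}{A}\right)}\overline{F}_{D_1}(t-\tau_* )\left[{}_1F_1\left(1,\tfrac{b+A+r}{A};\lambda\tau_*\right)-1\right]+\frac{\xi(\tau_*,t)\,\eta(\tau_*,t)\,t}{\tau_*(t-\tau_* )},$$ $$p(x,t\,|\,-v)=\frac{b\mu[\mu(t-\tau_* )]^{r/A-1}e^{-\mu(t-\tau_* )}}{(c+v)A\,\Gamma\left(\frac{r+A}{A}\right)}\overline{F}_{U_1}(\tau_* )\left[{}_1F_1\left(1,\tfrac{b+A+r}{A};\mu(t-\tau_* )\right)-1\right]+\frac{\widetilde\xi(\tau_*,t)\,\widetilde\eta(\tau_*,t)\,t}{\tau_*(t-\tau_* )},$$ with $$\xi(\tau_*,t)=e^{-\lambda\tau_*-\mu(t-\tau_*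 )}\frac{(\lambda\tau_* )^{b/A+1}[\mu(t-\tau_* )]^{r/A}}{(c+v)\Gamma\left(\frac{b+A}{A}\right)\Gamma\left(\frac rA\right)},\qquad \widetilde\xi(\tau_*,t)=e^{-\lambda\tau_*-\mu(t-\tau_* )}\frac{(\lambda\tau_* )^{b/A}[\mu(t-\tau_* )]^{r/A+1}}{(c+v)\Gamma\left(\frac{r+A}{A}\right)\Gamma\left(\frac bA\right)},$$ $$\eta(\tau_*,t)=[\lambda\tau_*+\mu(t-\tau_* )]^{-1}\left[{}_1F_1\left(1,\tfrac{b+A+r}{A};\lambda\tau_*+\mu(t-\tau_* )\right)-1-\frac{A[\lambda\tau_*+\mu(t-\tau_* )]}{b+A+r}\right]$$ $$\qquad-(\lambda\tau_* )^{-1}\left[{}_1F_1\left(1,\tfrac{b+A+r}{A};\lambda\tau_*\right)-1-\frac{A\lambda\tau_*}{b+A+r}\right],$$ $$\widetilde\eta(\tau_*,t)=[\lambda\tau_*+\mu(t-\tau_* )]^{-1}\left[{}_1F_1\left(1,\tfrac{b+A+r}{A};\lambda\tau_*+\mu(t-\tau_* )\right)-1-\frac{A[\lambda\tau_*+\mu(t-\tau_* )]}{b+A+r}\right]$$ $$\qquad-[\mu(t-\tau_* )]^{-1}\left[{}_1F_1\left(1,\tfrac{b+A+r}{A};\mu(t-\tau_* )\right)-1-\frac{A\mu(t-\tau_* )}{b+A+r}\right].$$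
   Context: Model (Pólya scheme, $A>0$). Fix $c,v>0$ and real $b,r,A>0$. Let $\{X_n;n\ge1\}$ be $\{0,1\}$-valued random variables with $\mathbb{P}\{X_1=1\}=\frac{b}{b+r}$ and, for $n\ge1$, $\mathbb{P}\{X_{n+1}=1\mid \sigma(X_1,\dots,X_n)\}=\frac{b+A\sum_{k=1}^nX_k}{b+r+An}$. Put $Z_n=c$ if $X_{n+1}=1$ and $Z_n=-v$ if $X_{n+1}=0$, $n\ge0$. Let $\{U_k;k\ge1\}$ and $\{D_k;k\ge1\}$ be mutually independent sequences of independent non-negative random variables, the collection $\{U_k,D_k;k\ge1\}$ being independent of $\{X_n;n\ge1\}$. $U_k$ (resp. $D_k$) is the duration of the $k$-th period during which the particle has velocity $c$ (resp. $-v$): $T_0=0$ and, for $n\ge0$, with $j_n=X_1+\cdots+X_{n+1}$, $T_{n+1}=T_n+U_{j_n}$ if $X_{n+1}=1$ and $T_{n+1}=T_n+D_{n+1-j_n}$ if $X_{n+1}=0$. Let $M_t=\max\{i\ge1:T_i\le t\}$ (with $M_t=0$ if $T_1>t$). The velocity and position at time $t$ are $V_t=Z_{M_t}$ and $S_t=\int_0^tV_s\,ds$, so $S_0=0$ and $V_0=Z_0$. Notation. The gamma distribution with parameters $(\alpha,\lambda)$ has density $\lambda^\alpha t^{\alpha-1}e^{-\lambda t}/\Gamma(\alpha)$, $t>0$. $\overline F_{U_1}(t)=\mathbb{P}\{U_1>t\}$ and $\overline F_{D_1}(t)=\mathbb{P}\{D_1>t\}$, i.e. $\overline{F}_{U_1}(t)=1-\frac{(\lambda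 t)^{b/A+1}e^{-\lambda t}}{\Gamma(b/A+2)}\,{}_1F_1(1,\frac bA+2;\lambda t)$ and $\overline{F}_{D_1}(t)=1-\frac{(\mu t)^{r/A+1}e^{-\mu t}}{\Gamma(r/A+2)}\,{}_1F_1(1,\frac rA+2;\mu t)$. ${}_1F_1(u,w;z)=\sum_{k\ge0}\frac{(u)_k}{(w)_k}\frac{z^k}{k!}$ is Kummer's confluent hypergeometric function, with $(\alpha)_0=1$, $(\alpha)_k=\alpha(\alpha+1)\cdots(\alpha+k-1)$. For $y\in\{-v,c\}$, $t>0$, $x\in(-vt,ct)$: $p(x,t\,|\,y)=\frac{\partial}{\partial x}\mathbb{P}\{S_t\le x\mid V_0=y\}$ and $p(x,t)=\frac{\partial}{\partial x}\mathbb{P}\{S_t\le x\}$ (densities of the absolutely continuous component of the law of $S_t$ over $(-vt,ct)$). *)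

theory Defs
  imports "HOL-Probability.Probability"
begin

text \<open>
  All processes are families \<open>nat \<Rightarrow> 'a \<Rightarrow> _\<close>; \<open>X n\<close>, \<open>U n\<close>, \<open>D n\<close> are meaningful only for
  \<open>n \<ge> 1\<close>, their values at index \<open>0\<close> are never used.
\<close>

definition urn_history :: "'a measure \<Rightarrow> (nat \<Rightarrow> 'a \<Rightarrow> nat) \<Rightarrow> nat \<Rightarrow> 'a measure" where
  "urn_history M X n =
     vimage_algebra (space M) (\<lambda>\<omega>. \<lambda>k\<in>{1..n}. X k \<omega>) (PiM {1..n} (\<lambda>_. count_space UNIV))"

text \<open>
  In the locale below the durations form one family indexed by a disjoint sum: \<open>Inl k\<close> stands for
  \<open>U k\<close> and \<open>Inr k\<close> for \<open>D k\<close>.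
\<close>

locale polya_telegraph = prob_space M
  for M :: "'a measure" +
  fixes b r A c v :: real
    and X :: "nat \<Rightarrow> 'a \<Rightarrow> nat"
    and U D :: "nat \<Rightarrow> 'a \<Rightarrow> real"
  assumes pos: "b > 0" "r > 0" "A > 0" "c > 0" "v > 0"
    and X_rv: "\<And>n. n \<ge> 1 \<Longrightarrow> random_variable (count_space UNIV) (X n)"
    and X_01: "\<And>n \<omega>. n \<ge> 1 \<Longrightarrow> \<omega> \<in> space M \<Longrightarrow> X n \<omega> \<in> {0, 1}"
    and X_first: "\<P>(\<omega> in M. X 1 \<omega> = 1) = b / (b + r)"
    and X_next: "\<And>n. n \<ge> 1 \<Longrightarrow>
      AE \<omega> in M. real_cond_exp M (urn_history M X n) (indicator {\<omega> \<in> space M. X (n + 1) \<omega> = 1}) \<omega>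
                 = (b + A * (\<Sum>k=1..n. real (X k \<omega>))) / (b + r + A * real n)"
    and durations_nonneg: "\<And>k \<omega>. k \<ge> 1 \<Longrightarrow> \<omega> \<in> space M \<Longrightarrow> U k \<omega> \<ge> 0 \<and> D k \<omega> \<ge> 0"
    and durations_indep: "indep_vars (\<lambda>_. borel) (case_sum U D) ({1..} <+> {1..})"
    and durations_indep_X:
      "indep_set
         (sets (vimage_algebra (space M) (\<lambda>\<omega>. \<lambda>i\<in>{1..} <+> {1..}. case_sum U D i \<omega>)
                  (PiM ({1..} <+> {1..}) (\<lambda>_. borel))))
         (sets (vimage_algebra (space M) (\<lambda>\<omega>. \<lambda>n\<in>{1..}. X n \<omega>)
                  (PiM {1..} (\<lambda>_. count_space UNIV))))"

definition ups :: "(nat \<Rightarrow> 'a \<Rightarrow> nat) \<Rightarrow> nat \<Rightarrow> 'a \<Rightarrow> nat" where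
  "ups X n \<omega> = (\<Sum>k=1..n + 1. X k \<omega>)"

primrec epoch :: "(nat \<Rightarrow> 'a \<Rightarrow> nat) \<Rightarrow> (nat \<Rightarrow> 'a \<Rightarrow> real) \<Rightarrow> (nat \<Rightarrow> 'a \<Rightarrow> real) \<Rightarrow> nat \<Rightarrow> 'a \<Rightarrow> real" where
  "epoch X U D 0 \<omega> = 0"
| "epoch X U D (Suc n) \<omega> = epoch X U D n \<omega> +
     (if X (n + 1) \<omega> = 1 then U (ups X n \<omega>) \<omega> else D (n + 1 - ups X n \<omega>) \<omega>)"

text \<open>
  The maximum below is over an infinite set (and then an arbitrary number) only if infinitely many
  epochs are at most \<open>t\<close>, a null event for the durations considered here.
\<close>

definition epoch_count ::
  "(nat \<Rightarrow> 'a \<Rightarrow> nat) \<Rightarrow> (nat \<Rightarrow> 'a \<Rightarrow> real) \<Rightarrow> (nat \<Rightarrow> 'a \<Rightarrow> real) \<Rightarrow> real \<Rightarrow> 'a \<Rightarrow> nat" where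
  "epoch_count X U D t \<omega> =
     (if epoch X U D 1 \<omega> > t then 0 else Max {i. i \<ge> 1 \<and> epoch X U D i \<omega> \<le> t})"

definition step_velocity :: "real \<Rightarrow> real \<Rightarrow> (nat \<Rightarrow> 'a \<Rightarrow> nat) \<Rightarrow> nat \<Rightarrow> 'a \<Rightarrow> real" where
  "step_velocity c v X n \<omega> = (if X (n + 1) \<omega> = 1 then c else - v)"

definition velocity ::
  "real \<Rightarrow> real \<Rightarrow> (nat \<Rightarrow> 'a \<Rightarrow> nat) \<Rightarrow> (nat \<Rightarrow> 'a \<Rightarrow> real) \<Rightarrow> (nat \<Rightarrow> 'a \<Rightarrow> real) \<Rightarrow> real \<Rightarrow> 'a \<Rightarrow> real" where
  "velocity c v X U D t \<omega> = step_velocity c v X (epoch_count X U D t \<omega>) \<omega>"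

definition position ::
  "real \<Rightarrow> real \<Rightarrow> (nat \<Rightarrow> 'a \<Rightarrow> nat) \<Rightarrow> (nat \<Rightarrow> 'a \<Rightarrow> real) \<Rightarrow> (nat \<Rightarrow> 'a \<Rightarrow> real) \<Rightarrow> real \<Rightarrow> 'a \<Rightarrow> real" where
  "position c v X U D t \<omega> = (LINT s:{0..t}|lborel. velocity c v X U D s \<omega>)"

definition position_cdf ::
  "'a measure \<Rightarrow> real \<Rightarrow> real \<Rightarrow> (nat \<Rightarrow> 'a \<Rightarrow> nat) \<Rightarrow> (nat \<Rightarrow> 'a \<Rightarrow> real) \<Rightarrow> (nat \<Rightarrow> 'a \<Rightarrow> real)
    \<Rightarrow> real \<Rightarrow> real \<Rightarrow> real" where
  "position_cdf M c v X U D t x = \<P>(\<omega> in M. position c v X U D t \<omega> \<le> x)"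

definition position_cdf_given ::
  "'a measure \<Rightarrow> real \<Rightarrow> real \<Rightarrow> (nat \<Rightarrow> 'a \<Rightarrow> nat) \<Rightarrow> (nat \<Rightarrow> 'a \<Rightarrow> real) \<Rightarrow> (nat \<Rightarrow> 'a \<Rightarrow> real)
    \<Rightarrow> real \<Rightarrow> real \<Rightarrow> real \<Rightarrow> real" where
  "position_cdf_given M c v X U D y t x =
     \<P>(\<omega> in M. position c v X U D t \<omega> \<le> x \<bar> velocity c v X U D 0 \<omega> = y)"

text \<open>Partial derivatives in \<open>x\<close>; \<open>deriv\<close> is informative only where the derivative exists.\<close>

definition position_density ::
  "'a measure \<Rightarrow> real \<Rightarrow> real \<Rightarrow> (nat \<Rightarrow> 'a \<Rightarrow> nat) \<Rightarrow> (nat \<Rightarrow> 'a \<Rightarrow> real) \<Rightarrow> (nat \<Rightarrow> 'a \<Rightarrow> real)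
    \<Rightarrow> real \<Rightarrow> real \<Rightarrow> real" where
  "position_density M c v X U D x t = deriv (position_cdf M c v X U D t) x"

definition position_density_given ::
  "'a measure \<Rightarrow> real \<Rightarrow> real \<Rightarrow> (nat \<Rightarrow> 'a \<Rightarrow> nat) \<Rightarrow> (nat \<Rightarrow> 'a \<Rightarrow> real) \<Rightarrow> (nat \<Rightarrow> 'a \<Rightarrow> real)
    \<Rightarrow> real \<Rightarrow> real \<Rightarrow> real \<Rightarrow> real" where
  "position_density_given M c v X U D x t y = deriv (position_cdf_given M c v X U D y t) x"

definition tail :: "'a measure \<Rightarrow> ('a \<Rightarrow> real) \<Rightarrow> real \<Rightarrow> real" where
  "tail M Y t = \<P>(\<omega> in M. Y \<omega> > t)"

definition gamma_density :: "real \<Rightarrow> real \<Rightarrow> real \<Rightarrow> real" where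
  "gamma_density \<alpha> l t =
     (if t > 0 then l powr \<alpha> * t powr (\<alpha> - 1) * exp (- l * t) / Gamma \<alpha> else 0)"

definition kummer_1F1 :: "real \<Rightarrow> real \<Rightarrow> real \<Rightarrow> real" where
  "kummer_1F1 u w z = (\<Sum>k. pochhammer u k / pochhammer w k * (z ^ k / fact k))"

definition xi :: "real \<Rightarrow> real \<Rightarrow> real \<Rightarrow> real \<Rightarrow> real \<Rightarrow> real \<Rightarrow> real \<Rightarrow> real \<Rightarrow> real \<Rightarrow> real" where
  "xi b r A c v l \<mu> \<tau> t =
     exp (- l * \<tau> - \<mu> * (t - \<tau>)) *
     ((l * \<tau>) powr (b / A + 1) * (\<mu> * (t - \<tau>)) powr (r / A)) /
     ((c + v) * Gamma ((b + A) / A) * Gamma (r / A))"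

definition xi_tilde :: "real \<Rightarrow> real \<Rightarrow> real \<Rightarrow> real \<Rightarrow> real \<Rightarrow> real \<Rightarrow> real \<Rightarrow> real \<Rightarrow> real \<Rightarrow> real" where
  "xi_tilde b r A c v l \<mu> \<tau> t =
     exp (- l * \<tau> - \<mu> * (t - \<tau>)) *
     ((l * \<tau>) powr (b / A) * (\<mu> * (t - \<tau>)) powr (r / A + 1)) /
     ((c + v) * Gamma ((r + A) / A) * Gamma (b / A))"

definition eta :: "real \<Rightarrow> real \<Rightarrow> real \<Rightarrow> real \<Rightarrow> real \<Rightarrow> real \<Rightarrow> real \<Rightarrow> real" where
  "eta b r A l \<mu> \<tau> t =
     inverse (l * \<tau> + \<mu> * (t - \<tau>)) *
       (kummer_1F1 1 ((b + A + r) / A) (l * \<tau> + \<mu> * (t - \<tau>)) - 1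
         - A * (l * \<tau> + \<mu> * (t - \<tau>)) / (b + A + r))
     - inverse (l * \<tau>) *
       (kummer_1F1 1 ((b + A + r) / A) (l * \<tau>) - 1 - A * l * \<tau> / (b + A + r))"

definition eta_tilde :: "real \<Rightarrow> real \<Rightarrow> real \<Rightarrow> real \<Rightarrow> real \<Rightarrow> real \<Rightarrow> real \<Rightarrow> real" where
  "eta_tilde b r A l \<mu> \<tau> t =
     inverse (l * \<tau> + \<mu> * (t - \<tau>)) *
       (kummer_1F1 1 ((b + A + r) / A) (l * \<tau> + \<mu> * (t - \<tau>)) - 1
         - A * (l * \<tau> + \<mu> * (t - \<tau>)) / (b + A + r))
     - inverse (\<mu> * (t - \<tau>)) *
       (kummer_1F1 1 ((b + A + r) / A) (\<mu> * (t - \<tau>)) - 1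
         - A * \<mu> * (t - \<tau>) / (b + A + r))"

end

theory Submission
  imports Defs
begin

text \<open>
  Let \<open>\<tau> = (v * t + x) / (c + v)\<close>. The particle is at or below \<open>x\<close> at time \<open>t\<close> if and only if it has spent
  at most time \<open>\<tau>\<close> going up, and hence at least time \<open>t - \<tau>\<close> going down. Follow the accumulated up time
  and the accumulated down time as a staircase in the plane. Suppose that exactly \<open>n\<close> of the up durations
  fit into \<open>\<tau>\<close> and exactly \<open>k\<close> of the down durations fit into \<open>t - \<tau>\<close>. The staircase leaves the
  rectangle with sides \<open>\<tau>\<close> and \<open>t - \<tau>\<close> by its up step number \<open>n + 1\<close> or by its down step number \<open>k + 1\<close>,
  whichever the urn draws first, and the particle is at or below \<open>x\<close> in the second case. This is
  decided after \<open>n + k + 1\<close> draws: the criterion is that at most \<open>n\<close> of them are up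
  (\<open>position_le_iff\<close>). Therefore, with \<open>q n\<close> and \<open>w k\<close> for the probabilities of the two counts, the joint
  probability of \<open>position \<le> x\<close> and an initial up step is the double series of \<open>q n * w k * H n k\<close>, where
  \<open>H n k\<close> is the probability that the first draw and at most \<open>n\<close> of the first \<open>n + k + 1\<close> draws are up
  (\<open>prob_position_le_up\<close>).

  The sum of the first \<open>n\<close> up durations has a gamma law of shape \<open>b / A + n\<close>, so the derivative of
  \<open>q n\<close> is the difference of two consecutive gamma densities, and likewise for \<open>w k\<close>. The series is
  dominated on \<open>(0, t)\<close> and may be differentiated term by term; summation by parts then replaces \<open>H\<close> by its
  increments (\<open>crossing_series_deriv\<close>). An increment of \<open>H\<close> is the probability of a fixed number of up
  draws followed by a draw of prescribed colour, that is a binomial coefficient times rising factorials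
  (\<open>low_count_diff1\<close>, \<open>low_count_diff2\<close>). The rising factorials in its numerator cancel the gamma
  functions in the densities; what remains are the powers \<open>(l * \<tau>) ^ n * (\<mu> * (t - \<tau>)) ^ k\<close> with a
  denominator that depends only on \<open>n + k\<close>. Along the diagonals the binomial theorem applies, and the
  outer sum is a Kummer series (\<open>crossing_density_closed_form\<close>). The terms in which no down duration is
  completed are exceptional, because their probability is the tail of the first duration and not a
  power; they give the first summand of the density.

  For an initial down step the complementary event is described by the same series with up and down
  exchanged (\<open>prob_position_gt_down\<close>), so that no second computation is required.
\<close>

section \<open>Gamma distribution functions\<close>

lemma pos_not_nonpos_Int: "0 < (x::real) \<Longrightarrow> x \<notin> \<int>\<^sub>\<le>\<^sub>0"
  by (auto elim!: nonpos_Ints_cases)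

lemma Gamma_pos_neq_0: "0 < (x::real) \<Longrightarrow> Gamma x \<noteq> 0"
  using Gamma_real_pos[of x] by (metis less_irrefl)

lemma gamma_density_pos: "0 < x \<Longrightarrow> 0 < l \<Longrightarrow> 0 < \<alpha> \<Longrightarrow>
   gamma_density \<alpha> l x = l * (l * x) powr (\<alpha> - 1) * exp (- l * x) / Gamma \<alpha>"
  by (simp add: gamma_density_def powr_mult powr_diff)

lemma gamma_density_nonneg: "0 < \<alpha> \<Longrightarrow> 0 \<le> gamma_density \<alpha> l x"
  by (auto simp: gamma_density_def Gamma_real_nonneg intro!: divide_nonneg_nonneg mult_nonneg_nonneg)

lemma gamma_density_measurable [measurable]: "gamma_density \<alpha> l \<in> borel_measurable borel"
  unfolding gamma_density_def by measurable

lemma gamma_density_le: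
  assumes "1 \<le> \<alpha>" "0 < l" "x \<le> y" "0 < y"
  shows "gamma_density \<alpha> l x \<le> l * (l * y) powr (\<alpha> - 1) / Gamma \<alpha>"
proof (cases "x > 0")
  case True
  have "(l * x) powr (\<alpha> - 1) * exp (- l * x) \<le> (l * y) powr (\<alpha> - 1) * 1"
    using assms True by (intro mult_mono powr_mono2) auto
  then have "l * ((l * x) powr (\<alpha> - 1) * exp (- l * x)) / Gamma \<alpha> \<le> l * ((l * y) powr (\<alpha> - 1)) / Gamma \<alpha>"
    using assms by (intro divide_right_mono mult_left_mono) (auto simp: Gamma_real_nonneg)
  then show ?thesis using True assms by (simp add: gamma_density_pos mult.assoc)
next
  case False
  then show ?thesis using assms by (simp add: gamma_density_def Gamma_real_nonneg)
qed

text \<open>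
  Defined as a measure, this is at once the distribution function of every random variable that is
  distributed with the gamma density, and the integral is computed only where it is needed.
\<close>
definition gamma_cdf :: "real \<Rightarrow> real \<Rightarrow> real \<Rightarrow> real" where
  "gamma_cdf \<alpha> l x = measure (density lborel (gamma_density \<alpha> l)) {..x}"

lemma (in prob_space) prob_le_gamma:
  assumes "distributed M lborel Y (gamma_density \<alpha> l)"
  shows "\<P>(\<omega> in M. Y \<omega> \<le> x) = gamma_cdf \<alpha> l x"
proof -
  have [measurable]: "random_variable borel Y"
    using distributed_measurable[OF assms] by simp
  have "measure (distr M lborel Y) {..x} = prob (Y -` {..x} \<inter> space M)"
    by (subst measure_distr) auto
  also have "Y -` {..x} \<inter> space M = {\<omega>\<in>space M. Y \<omega> \<le> x}" by auto
  finally show ?thesis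
    unfolding gamma_cdf_def distributed_distr_eq_density[OF assms] by simp
qed

lemma emeasure_gamma_atMost:
  "emeasure (density lborel (gamma_density \<alpha> l)) {..x} = (\<integral>\<^sup>+y\<in>{0..x}. ennreal (gamma_density \<alpha> l y) \<partial>lborel)"
  by (subst emeasure_density) (auto intro!: nn_integral_cong simp: gamma_density_def indicator_def)

text \<open>
  For shape at least \<open>1\<close> the density is bounded by its power factor at the right end point. The
  \<open>Gamma \<alpha>\<close> in the denominator makes the bound tend to \<open>0\<close> as the shape grows; this is why infinitely
  many durations do not fit into a bounded time.
\<close>
lemma gamma_cdf_le:
  assumes "1 \<le> \<alpha>" "0 < l" "0 < x"
  shows "gamma_cdf \<alpha> l x \<le> x * (l * (l * x) powr (\<alpha> - 1) / Gamma \<alpha>)"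
proof -
  define C where "C = l * (l * x) powr (\<alpha> - 1) / Gamma \<alpha>"
  have C: "0 \<le> C" using assms by (simp add: C_def Gamma_real_nonneg)
  have "emeasure (density lborel (gamma_density \<alpha> l)) {..x} \<le> (\<integral>\<^sup>+y\<in>{0..x}. ennreal C \<partial>lborel)"
    unfolding emeasure_gamma_atMost C_def using assms
    by (intro nn_integral_mono) (auto intro!: gamma_density_le ennreal_leI simp: indicator_def)
  also have "\<dots> = ennreal (x * C)"
    using assms C by (subst nn_integral_cmult_indicator) (auto simp: ennreal_mult' mult.commute)
  finally show ?thesis
    unfolding gamma_cdf_def measure_def C_def[symmetric]
    using C assms by (simp add: enn2real_leI)
qed

lemma gamma_cdf_nonneg: "0 \<le> gamma_cdf \<alpha> l x" by (simp add: gamma_cdf_def)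

lemma gamma_density_continuous_on:
  assumes "0 < l" shows "continuous_on {0<..} (gamma_density \<alpha> l)"
proof -
  have "continuous_on {0<..} (\<lambda>t. l powr \<alpha> * t powr (\<alpha> - 1) * exp (- l * t) / Gamma \<alpha>)"
    unfolding divide_inverse by (auto intro!: continuous_intros)
  then show ?thesis
    by (rule continuous_on_cong[THEN iffD1, rotated -1]) (auto simp: gamma_density_def)
qed

text \<open>
  The fundamental theorem of calculus is applied on an interval around \<open>x\<close> that stays away from \<open>0\<close>,
  because the density of shape \<open>1\<close> jumps there.
\<close>
lemma gamma_cdf_deriv:
  assumes "1 \<le> \<alpha>" "0 < l" "0 < x"
  shows "(gamma_cdf \<alpha> l has_real_derivative gamma_density \<alpha> l x) (at x)"
proof -
  let ?f = "gamma_density \<alpha> l" and ?N = "density lborel (\<lambda>x. ennreal (gamma_density \<alpha> l x))"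
  \<comment> \<open>The antiderivative starts at a/2, so that it is differentiable at a as well.\<close>
  define a b where "a = x / 2" and "b = 2 * x"
  have ab: "0 < a" "a < x" "x < b" using assms by (auto simp: a_def b_def)
  have cont: "continuous_on {a/2..b} ?f"
    by (rule continuous_on_subset[OF gamma_density_continuous_on]) (use ab assms in auto)
  define K where "K y = integral {a/2..y} ?f" for y
  have K: "(K has_real_derivative ?f y) (at y)" if "y \<in> {a..b}" "y < b" for y
  proof -
    have "(K has_real_derivative ?f y) (at y within {a/2..b})"
      unfolding K_def by (rule integral_has_real_derivative[OF cont]) (use that ab in auto)
    moreover have "y \<in> interior {a/2..b}" using that ab by auto
    ultimately show ?thesis by (metis at_within_interior)
  qed
  have fin: "emeasure ?N {..y} < \<infinity>" for y
  proof (cases "y > 0")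
    case True
    have "emeasure ?N {..y} \<le> (\<integral>\<^sup>+z\<in>{0..y}. ennreal (l * (l * y) powr (\<alpha> - 1) / Gamma \<alpha>) \<partial>lborel)"
      unfolding emeasure_gamma_atMost using assms True
      by (intro nn_integral_mono) (auto intro!: gamma_density_le ennreal_leI simp: indicator_def)
    also have "\<dots> < \<infinity>"
      using True by (subst nn_integral_cmult_indicator) (auto simp: ennreal_mult_less_top)
    finally show ?thesis .
  next
    case False
    have "emeasure ?N {..y} = (\<integral>\<^sup>+z. 0 \<partial>(lborel :: real measure))"
      unfolding emeasure_gamma_atMost using False
      by (intro nn_integral_cong) (auto simp: indicator_def gamma_density_def)
    then show ?thesis by simp
  qed
  have eq: "gamma_cdf \<alpha> l y = gamma_cdf \<alpha> l a + (K y - K a)" if "y \<in> {a..<b}" for y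
  proof -
    have "emeasure ?N {a<..y} = (\<integral>\<^sup>+z. ennreal (?f z) * indicator {a..y} z \<partial>lborel)"
      by (subst emeasure_density)
         (auto intro!: nn_integral_cong_AE eventually_mono[OF AE_lborel_singleton[of a]] simp: indicator_def)
    also have "\<dots> = ennreal (K y - K a)"
      by (rule nn_integral_FTC_Icc)
         (use that K ab assms in \<open>auto intro!: gamma_density_nonneg\<close>)
    finally have 1: "emeasure ?N {a<..y} = ennreal (K y - K a)" .
    have "\<exists>d. (K has_real_derivative d) (at z) \<and> 0 \<le> d" if "a \<le> z" "z \<le> y" for z
    proof -
      have "0 \<le> ?f z" by (rule gamma_density_nonneg) (use assms in linarith)
      moreover have "(K has_real_derivative ?f z) (at z)"
        by (rule K) (use that \<open>y \<in> {a..<b}\<close> in auto)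
      ultimately show ?thesis by blast
    qed
    then have "K a \<le> K y"
      using that by (intro DERIV_nonneg_imp_nondecreasing[of a y K]) auto
    then have 2: "measure ?N {a<..y} = K y - K a" using 1 by (simp add: measure_def)
    have "measure ?N ({..a} \<union> {a<..y}) = measure ?N {..a} + measure ?N {a<..y}"
      by (rule measure_Union) (use fin[of a] 1 in \<open>auto simp: less_top\<close>)
    moreover have "{..a} \<union> {a<..y} = {..y}" using that by auto
    ultimately show ?thesis using 2 by (simp add: gamma_cdf_def)
  qed
  have "((\<lambda>y. gamma_cdf \<alpha> l a + (K y - K a)) has_real_derivative ?f x) (at x)"
    using K[of x] ab by (auto intro!: derivative_eq_intros)
  then show ?thesis
    by (rule has_field_derivative_transform_within_open[where S = "{a<..<b}"])
       (use ab in \<open>auto intro!: eq[symmetric]\<close>)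
qed

lemma gamma_density_deriv:
  assumes "0 < l" "1 < \<alpha>" "0 < x"
  shows "(gamma_density \<alpha> l has_real_derivative l * (gamma_density (\<alpha> - 1) l x - gamma_density \<alpha> l x)) (at x)"
proof -
  have G: "Gamma \<alpha> = (\<alpha> - 1) * Gamma (\<alpha> - 1)" "Gamma (\<alpha> - 1) > 0"
    using Gamma_plus1[of "\<alpha> - 1"] pos_not_nonpos_Int[of "\<alpha> - 1"] assms by (auto simp: Gamma_real_pos)
  have "((\<lambda>x. l powr \<alpha> / Gamma \<alpha> * (x powr (\<alpha> - 1) * exp (- l * x))) has_real_derivative
      l powr \<alpha> / Gamma \<alpha> * (((\<alpha> - 1) * x powr (\<alpha> - 1 - 1)) * exp (- l * x)
         + (exp (- l * x) * (- l)) * x powr (\<alpha> - 1))) (at x)"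
    using assms by (intro DERIV_cmult DERIV_mult has_real_derivative_powr) (auto intro!: derivative_eq_intros)
  also have "l powr \<alpha> / Gamma \<alpha> * (((\<alpha> - 1) * x powr (\<alpha> - 1 - 1)) * exp (- l * x)
         + (exp (- l * x) * (- l)) * x powr (\<alpha> - 1)) = l * (gamma_density (\<alpha> - 1) l x - gamma_density \<alpha> l x)"
  proof -
    define c where "c = Gamma (\<alpha> - 1)"
    have c: "c \<noteq> 0" "Gamma \<alpha> = (\<alpha> - 1) * c" using G by (auto simp: c_def)
    have e: "x powr (\<alpha> - 1) = x * x powr (\<alpha> - 1 - 1)" "l powr \<alpha> = l * l powr (\<alpha> - 1)"
      using assms by (simp_all add: powr_diff power2_eq_square)
    show ?thesis
      unfolding gamma_density_def c_def[symmetric] c(2) e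
      using assms c(1) by (simp add: divide_simps) (simp add: algebra_simps)
  qed
  finally have "((\<lambda>x. l powr \<alpha> / Gamma \<alpha> * (x powr (\<alpha> - 1) * exp (- l * x))) has_real_derivative
      l * (gamma_density (\<alpha> - 1) l x - gamma_density \<alpha> l x)) (at x)" .
  then show ?thesis
    by (rule has_field_derivative_transform_within_open[where S = "{0<..}"])
       (use assms in \<open>auto simp: gamma_density_def\<close>)
qed

text \<open>
  Both sides have derivative \<open>gamma_density \<alpha> l - gamma_density (\<alpha> + 1) l\<close> and tend to \<open>0\<close> at the
  origin. When a duration of shape \<open>\<alpha>\<close> is followed by an exponential one, the left side is the
  probability that time \<open>x\<close> lies in the exponential one.
\<close>
lemma gamma_cdf_diff:
  assumes "0 < l" "1 \<le> \<alpha>" "0 < x"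
  shows "gamma_cdf \<alpha> l x - gamma_cdf (\<alpha> + 1) l x = gamma_density (\<alpha> + 1) l x / l"
proof -
  define h where "h x = gamma_cdf \<alpha> l x - gamma_cdf (\<alpha> + 1) l x - gamma_density (\<alpha> + 1) l x / l" for x
  have h0: "(h has_real_derivative 0) (at y)" if "y > 0" for y
    unfolding h_def using assms that gamma_density_deriv[of l "\<alpha> + 1" y]
    by (auto intro!: derivative_eq_intros gamma_cdf_deriv)
  have const: "h y = h x" if "y > 0" for y
  proof -
    have "\<exists>c. \<forall>y\<in>{0<..}. h y = c"
      by (rule has_field_derivative_zero_constant)
         (use h0 in \<open>auto intro: has_field_derivative_at_within\<close>)
    then show ?thesis using that assms by auto
  qed
  have lim0: "((\<lambda>y. y * (l * (l * y) powr (a - 1) / Gamma a)) \<longlongrightarrow> 0) (at_right 0)" if "1 \<le> a" for a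
  proof (rule Lim_null_comparison)
    show "\<forall>\<^sub>F y in at_right 0. norm (y * (l * (l * y) powr (a - 1) / Gamma a)) \<le> y * (l * l powr (a - 1) / Gamma a)"
      unfolding eventually_at_right_field
    proof (intro exI[of _ 1] conjI allI impI)
      fix y :: real assume y: "0 < y" "y < 1"
      have "(l * y) powr (a - 1) \<le> l powr (a - 1)"
        using y assms that by (intro powr_mono2) (auto simp: mult_le_cancel_left1)
      then show "norm (y * (l * (l * y) powr (a - 1) / Gamma a)) \<le> y * (l * l powr (a - 1) / Gamma a)"
        using y assms that Gamma_pos_neq_0[of a, OF less_le_trans[OF zero_less_one that]] by (auto simp: abs_mult intro!: mult_left_mono divide_right_mono)
    qed simp
    show "((\<lambda>y. y * (l * l powr (a - 1) / Gamma a)) \<longlongrightarrow> 0) (at_right 0)"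
      by (intro tendsto_mult_left_zero tendsto_ident_at)
  qed
  have l1: "(gamma_cdf a l \<longlongrightarrow> 0) (at_right 0)" if "1 \<le> a" for a
    by (rule tendsto_sandwich[OF _ _ tendsto_const lim0[OF that]])
       (use gamma_cdf_le[OF that \<open>0 < l\<close>] in \<open>auto simp: eventually_at_right_field gamma_cdf_nonneg intro!: exI[of _ 1]\<close>)
  have l2: "((\<lambda>y. gamma_density (\<alpha> + 1) l y / l) \<longlongrightarrow> 0) (at_right 0)"
  proof (rule tendsto_sandwich[OF _ _ tendsto_const])
    show "\<forall>\<^sub>F y in at_right 0. gamma_density (\<alpha> + 1) l y / l \<le> (l * y) powr \<alpha> / Gamma (\<alpha> + 1)"
      unfolding eventually_at_right_field
      using gamma_density_le[of "\<alpha> + 1" l _ _, OF _ _ order.refl] assms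
      by (auto intro!: exI[of _ 1] simp: field_simps)
    show "\<forall>\<^sub>F y in at_right 0. 0 \<le> gamma_density (\<alpha> + 1) l y / l"
      using assms by (intro always_eventually) (auto intro!: divide_nonneg_pos gamma_density_nonneg)
    have "((\<lambda>y. (l * y) powr \<alpha>) \<longlongrightarrow> 0 powr \<alpha>) (at_right 0)"
      using assms by (intro tendsto_powr') (auto intro!: tendsto_eq_intros simp: eventually_at_right_field intro!: exI[of _ 1])
    then have "((\<lambda>y. (l * y) powr \<alpha> * inverse (Gamma (\<alpha> + 1))) \<longlongrightarrow> 0) (at_right 0)"
      using assms by (intro tendsto_mult_left_zero) simp
    then show "((\<lambda>y. (l * y) powr \<alpha> / Gamma (\<alpha> + 1)) \<longlongrightarrow> 0) (at_right 0)"
      by (simp add: divide_inverse)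
  qed
  have "(h \<longlongrightarrow> 0) (at_right 0)"
    unfolding h_def using tendsto_diff[OF tendsto_diff[OF l1[of \<alpha>] l1[of "\<alpha> + 1"]] l2] assms by simp
  moreover have "(h \<longlongrightarrow> h x) (at_right 0)"
    by (rule tendsto_eventually) (auto simp: eventually_at_right_field const intro!: exI[of _ 1])
  ultimately have "h x = 0"
    using tendsto_unique[of "at_right (0::real)" h "h x" 0] by (simp add: trivial_limit_at_right_real)
  then show ?thesis by (simp add: h_def)
qed

text \<open>
  The two exponential factors multiply to \<open>exp (- l * x)\<close>, so that only a power of \<open>y\<close> is left to
  integrate.
\<close>
lemma gamma_convolution:
  assumes "0 < l" "0 < \<alpha>"
  shows "(\<integral>\<^sup>+y. ennreal (exponential_density l (x - y)) * ennreal (gamma_density \<alpha> l y) \<partial>lborel)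
    = ennreal (gamma_density (\<alpha> + 1) l x)"
proof (cases "x > 0")
  case True
  define C where "C = l * l powr \<alpha> * exp (- l * x) / Gamma \<alpha>"
  have C: "0 \<le> C" using assms by (simp add: C_def Gamma_real_nonneg)
  have *: "((\<lambda>y. C * y powr (\<alpha> - 1)) has_integral C * (x powr \<alpha> / \<alpha>)) {0..x}"
    using has_integral_powr_from_0[of "\<alpha> - 1" x] True assms by (intro has_integral_mult_right) auto
  have "(\<integral>\<^sup>+y. ennreal (exponential_density l (x - y)) * ennreal (gamma_density \<alpha> l y) \<partial>lborel)
     = (\<integral>\<^sup>+y. ennreal (C * y powr (\<alpha> - 1)) * indicator {0..x} y \<partial>lborel)"
  proof (intro nn_integral_cong)
    fix y
    have "exponential_density l (x - y) * gamma_density \<alpha> l y = C * y powr (\<alpha> - 1) * indicator {0..x} y"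
      by (auto simp: exponential_density_def erlang_density_def gamma_density_def C_def indicator_def algebra_simps
            exp_diff exp_minus field_simps)
    then show "ennreal (exponential_density l (x - y)) * ennreal (gamma_density \<alpha> l y) = ennreal (C * y powr (\<alpha> - 1)) * indicator {0..x} y"
      using assms C by (subst ennreal_mult[symmetric])
        (auto simp: indicator_def exponential_density_nonneg gamma_density_nonneg)
  qed
  also have "\<dots> = ennreal (C * (x powr \<alpha> / \<alpha>))"
    by (rule nn_integral_has_integral_lebesgue'[OF _ *]) (use C in auto)
  also have "C * (x powr \<alpha> / \<alpha>) = gamma_density (\<alpha> + 1) l x"
    using assms True Gamma_plus1[OF pos_not_nonpos_Int, of \<alpha>]
    by (auto simp: C_def gamma_density_def powr_add field_simps)
  finally show ?thesis .
next
  case False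
  have "(\<integral>\<^sup>+y. ennreal (exponential_density l (x - y)) * ennreal (gamma_density \<alpha> l y) \<partial>lborel) = (\<integral>\<^sup>+y. 0 \<partial>(lborel::real measure))"
    using False by (intro nn_integral_cong) (auto simp: exponential_density_def erlang_density_def gamma_density_def)
  then show ?thesis using False by (simp add: gamma_density_def)
qed

lemma summable_power_pochhammer:
  assumes "0 < (w::real)"
  shows "summable (\<lambda>n. z ^ n / pochhammer w n)"
proof -
  \<comment> \<open>From index N on, consecutive terms have ratio at most 1/2.\<close>
  obtain N :: nat where N: "2 * \<bar>z\<bar> \<le> real N" using real_arch_simple by blast
  show ?thesis
  proof (rule summable_ratio_test[of "1/2" N])
    fix n assume n: "N \<le> n"
    have p: "pochhammer w n > 0" using assms by (rule pochhammer_pos)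
    have "2 * \<bar>z\<bar> \<le> w + real n" using N n assms by linarith
    then have "\<bar>z\<bar> / (w + real n) \<le> 1 / 2" using assms by (simp add: field_simps)
    then have "\<bar>z\<bar> / (w + real n) * (\<bar>z\<bar> ^ n / pochhammer w n) \<le> 1 / 2 * (\<bar>z\<bar> ^ n / pochhammer w n)"
      using p by (intro mult_right_mono) auto
    then show "norm (z ^ Suc n / pochhammer w (Suc n)) \<le> 1/2 * norm (z ^ n / pochhammer w n)"
      using p assms by (simp add: pochhammer_Suc abs_mult power_abs mult_ac)
  qed simp
qed

lemma summable_gamma_bound:
  assumes "0 < \<beta>" "0 < z"
  shows "summable (\<lambda>n. z powr (\<beta> + real n) / Gamma (\<beta> + real n + 1))"
proof -
  have "z powr (\<beta> + real n) / Gamma (\<beta> + real n + 1) = z powr \<beta> / Gamma (\<beta> + 1) * (z ^ n / pochhammer (\<beta> + 1) n)" for n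
    using pochhammer_Gamma[OF pos_not_nonpos_Int, of "\<beta> + 1" n] assms Gamma_pos_neq_0[of "\<beta> + 1"]
      Gamma_pos_neq_0[of "\<beta> + 1 + real n"] pochhammer_pos[of "\<beta> + 1" n]
    by (simp add: powr_add powr_realpow add_ac divide_simps mult.commute)
  moreover have "summable (\<lambda>n. z powr \<beta> / Gamma (\<beta> + 1) * (z ^ n / pochhammer (\<beta> + 1) n))"
    by (intro summable_mult summable_power_pochhammer) (use assms in simp)
  ultimately show ?thesis by (simp only:)
qed

section \<open>The number of completed durations\<close>

text \<open>
  The sum of the first \<open>n\<close> durations has shape \<open>\<beta> + n\<close> for \<open>n \<ge> 1\<close> and is constantly \<open>0\<close> for \<open>n = 0\<close>.
  The values at \<open>n = 0\<close> are chosen so that the derivative of \<open>count_pmf\<close> below has one form for all \<open>n\<close>.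
\<close>
definition arrival_density :: "real \<Rightarrow> real \<Rightarrow> nat \<Rightarrow> real \<Rightarrow> real" where
  "arrival_density \<beta> l n x = (if n = 0 then 0 else gamma_density (\<beta> + real n) l x)"

definition arrival_cdf :: "real \<Rightarrow> real \<Rightarrow> nat \<Rightarrow> real \<Rightarrow> real" where
  "arrival_cdf \<beta> l n x = (if n = 0 then 1 else gamma_cdf (\<beta> + real n) l x)"

text \<open>
  The probability that exactly \<open>n\<close> durations are completed at time \<open>x\<close>.
\<close>
definition count_pmf :: "real \<Rightarrow> real \<Rightarrow> nat \<Rightarrow> real \<Rightarrow> real" where
  "count_pmf \<beta> l n x = arrival_cdf \<beta> l n x - arrival_cdf \<beta> l (Suc n) x"

lemma count_pmf_deriv:
  assumes "0 < \<beta>" "0 < l" "0 < x"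
  shows "(count_pmf \<beta> l n has_real_derivative
    arrival_density \<beta> l n x - arrival_density \<beta> l (Suc n) x) (at x)"
proof -
  have *: "(arrival_cdf \<beta> l n has_real_derivative arrival_density \<beta> l n x) (at x)" for n
    using gamma_cdf_deriv[of "\<beta> + real n" l x] assms
    by (cases n) (auto simp: arrival_cdf_def[abs_def] arrival_density_def)
  show ?thesis
    unfolding count_pmf_def[abs_def] by (intro DERIV_diff *)
qed

lemma count_pmf_Suc:
  assumes "0 < \<beta>" "0 < l" "0 < x"
  shows "count_pmf \<beta> l (Suc n) x = arrival_density \<beta> l (Suc (Suc n)) x / l"
  using gamma_cdf_diff[of l "\<beta> + real (Suc n)" x] assms
  by (simp add: count_pmf_def arrival_cdf_def arrival_density_def add_ac)

lemma arrival_density_nonneg: "0 < \<beta> \<Longrightarrow> 0 \<le> arrival_density \<beta> l n x"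
  by (simp add: arrival_density_def gamma_density_nonneg)

text \<open>
  A single summable sequence that dominates the count probabilities and their derivatives on all of
  \<open>(0, t)\<close>. The end point \<open>0\<close> does no harm, because the shapes \<open>\<beta> + n\<close> with \<open>n \<ge> 1\<close> exceed \<open>1\<close> and
  the densities therefore contain only positive powers of \<open>x\<close>.
\<close>
lemma count_pmf_bounds:
  assumes "0 < \<beta>" "0 < l" "0 < t"
  obtains a :: "nat \<Rightarrow> real" where "summable a"
    "\<And>n x. 0 < x \<Longrightarrow> x < t \<Longrightarrow> \<bar>count_pmf \<beta> l n x\<bar> \<le> a n"
    "\<And>n x. 0 < x \<Longrightarrow> x < t \<Longrightarrow> \<bar>arrival_density \<beta> l n x - arrival_density \<beta> l (Suc n) x\<bar> \<le> a n"
    "\<And>n x. 0 < x \<Longrightarrow> x < t \<Longrightarrow> arrival_density \<beta> l n x \<le> a n"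
proof -
  define B where "B n = (l * t) powr (\<beta> + real n) / Gamma (\<beta> + real n + 1)" for n
  define B' where "B' n = (if n = 0 then 1 else l * B (n - 1))" for n
  define a where "a n = (1 + l + t * l) * B n + B' n" for n
  have B0: "0 \<le> B n" for n using assms by (auto simp: B_def intro!: divide_nonneg_nonneg Gamma_real_nonneg)
  have B'0: "0 \<le> B' n" for n using B0 assms by (auto simp: B'_def)
  have sB: "summable B" unfolding B_def using assms by (intro summable_gamma_bound) auto
  have sB': "summable B'"
    by (subst summable_Suc_iff[symmetric]) (use summable_mult[OF sB, of l] in \<open>simp add: B'_def\<close>)
  have arr: "arrival_density \<beta> l (Suc n) x \<le> l * B n" if "0 < x" "x < t" for n x
    using gamma_density_le[of "\<beta> + real (Suc n)" l x t] assms that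
    by (simp add: arrival_density_def B_def add_ac)
  have arr': "arrival_density \<beta> l n x \<le> B' n" if "0 < x" "x < t" for n x
    using arr[OF that, of "n - 1"] by (cases n) (auto simp: B'_def arrival_density_def)
  show ?thesis
  proof (rule that[of a])
    show "summable a" unfolding a_def by (intro summable_add summable_mult sB sB')
  next
    fix n x assume x: "0 < x" "x < t"
    have 1: "0 \<le> l * B n" "0 \<le> t * l * B n" "0 \<le> B n" "0 \<le> B' n"
      using B0 B'0 assms by auto
    have 2: "a n = B n + l * B n + t * l * B n + B' n" by (simp add: a_def algebra_simps)
    have 3: "0 \<le> arrival_density \<beta> l n x" for n using assms by (intro arrival_density_nonneg)
    show "arrival_density \<beta> l n x \<le> a n"
      using arr'[OF x, of n] 1 2 by linarith
    show "\<bar>arrival_density \<beta> l n x - arrival_density \<beta> l (Suc n) x\<bar> \<le> a n"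
      using arr'[OF x, of n] arr[OF x, of n] 3[of n] 3[of "Suc n"] 1 2 by linarith
    show "\<bar>count_pmf \<beta> l n x\<bar> \<le> a n"
    proof (cases n)
      case 0
      have "gamma_cdf (\<beta> + 1) l x \<le> x * (l * (l * x) powr \<beta> / Gamma (\<beta> + 1))"
        using gamma_cdf_le[of "\<beta> + 1" l x] assms x by simp
      also have "\<dots> \<le> t * (l * (l * t) powr \<beta> / Gamma (\<beta> + 1))"
        using assms x by (intro mult_mono divide_right_mono powr_mono2) (auto intro!: Gamma_real_nonneg divide_nonneg_nonneg)
      also have "\<dots> = t * l * B n" using 0 by (simp add: B_def)
      finally have "\<bar>count_pmf \<beta> l n x\<bar> \<le> 1 + t * l * B n"
        using 0 gamma_cdf_nonneg[of "\<beta> + 1" l x] 1 by (auto simp: count_pmf_def arrival_cdf_def)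
      then show ?thesis using 1 2 0 by (simp add: B'_def)
    next
      case (Suc m)
      have "arrival_density \<beta> l (Suc (Suc m)) x / l \<le> l * B (Suc m) / l"
        using assms by (intro divide_right_mono arr x) auto
      moreover have "0 \<le> arrival_density \<beta> l (Suc (Suc m)) x / l"
        using assms by (intro divide_nonneg_pos arrival_density_nonneg) auto
      ultimately have "\<bar>count_pmf \<beta> l n x\<bar> \<le> B n"
        using Suc assms x by (simp add: count_pmf_Suc)
      then show ?thesis using 1 2 by linarith
    qed
  qed
qed

section \<open>Differentiating the crossing series\<close>

lemma has_derivative_suminf_dominated:
  fixes f f' :: "nat \<Rightarrow> real \<Rightarrow> real"
  assumes S: "open S" "convex S" "x \<in> S"
    and d: "\<And>n y. y \<in> S \<Longrightarrow> (f n has_real_derivative f' n y) (at y)"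
    and b: "\<And>n y. y \<in> S \<Longrightarrow> \<bar>f n y\<bar> \<le> M n" "\<And>n y. y \<in> S \<Longrightarrow> \<bar>f' n y\<bar> \<le> N n"
    and M: "summable M" "summable N"
  shows "((\<lambda>y. \<Sum>n. f n y) has_real_derivative (\<Sum>n. f' n x)) (at x)"
proof (rule has_field_derivative_series'(2)[OF S(2)])
  show "uniformly_convergent_on S (\<lambda>n x. \<Sum>i<n. f' i x)"
    by (rule Weierstrass_m_test'[OF _ M(2)]) (use b in auto)
  show "x \<in> S" by fact
  show "summable (\<lambda>n. f n x)"
    by (rule summable_comparison_test'[OF M(1)]) (use b S in auto)
  show "x \<in> interior S" using S by (simp add: interior_open)
qed (auto intro: d has_field_derivative_at_within)

text \<open>
  Dominated differentiation is used twice, for the inner series and then for the outer one, whose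
  terms are dominated by \<open>a n\<close> times the sum of all \<open>c k\<close>.
\<close>
lemma product_series_deriv:
  fixes q q' w w' :: "nat \<Rightarrow> real \<Rightarrow> real" and H :: "nat \<Rightarrow> nat \<Rightarrow> real"
  assumes S: "open S" "convex S" "x \<in> S"
    and q: "\<And>n y. y \<in> S \<Longrightarrow> (q n has_real_derivative q' n y) (at y)"
    and w: "\<And>n y. y \<in> S \<Longrightarrow> (w n has_real_derivative w' n y) (at y)"
    and a: "\<And>n y. y \<in> S \<Longrightarrow> \<bar>q n y\<bar> \<le> a n" "\<And>n y. y \<in> S \<Longrightarrow> \<bar>q' n y\<bar> \<le> a n" "summable a"
    and c: "\<And>n y. y \<in> S \<Longrightarrow> \<bar>w n y\<bar> \<le> c n" "\<And>n y. y \<in> S \<Longrightarrow> \<bar>w' n y\<bar> \<le> c n" "summable c"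
    and H: "\<And>n k. \<bar>H n k\<bar> \<le> 1"
  shows "((\<lambda>y. \<Sum>n. q n y * (\<Sum>k. w k y * H n k)) has_real_derivative
     (\<Sum>n. q' n x * (\<Sum>k. w k x * H n k)) + (\<Sum>n. q n x * (\<Sum>k. w' k x * H n k))) (at x)"
proof -
  define \<phi> \<phi>' where "\<phi> n y = (\<Sum>k. w k y * H n k)" and "\<phi>' n y = (\<Sum>k. w' k y * H n k)" for n y
  define C where "C = (\<Sum>k. c k)"
  have le: "\<bar>z * H n k\<bar> \<le> \<bar>z\<bar>" for z n k
    using mult_left_mono[OF H[of n k], of "\<bar>z\<bar>"] by (simp add: abs_mult)
  have wb: "\<bar>w k y * H n k\<bar> \<le> c k" "\<bar>w' k y * H n k\<bar> \<le> c k" if "y \<in> S" for n k y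
    using order_trans[OF le c(1)[OF that]] order_trans[OF le c(2)[OF that]] by auto
  have sumb: "\<bar>\<Sum>k. f k\<bar> \<le> C" if "\<And>k. \<bar>f k\<bar> \<le> c k" for f
    unfolding C_def using that summable_rabs_comparison_test[of f c] c(3) suminf_le[of "\<lambda>k. \<bar>f k\<bar>" c]
      summable_rabs[of f]
    by (metis (no_types, lifting) order_trans summable_comparison_test' real_norm_def abs_idempotent)
  have \<phi>b: "\<bar>\<phi> n y\<bar> \<le> C" "\<bar>\<phi>' n y\<bar> \<le> C" if "y \<in> S" for n y
    using wb that by (auto simp: \<phi>_def \<phi>'_def intro!: sumb)
  have C0: "0 \<le> C" using \<phi>b(1)[OF S(3), of 0] by linarith
  have \<phi>d: "(\<phi> n has_real_derivative \<phi>' n y) (at y)" if "y \<in> S" for n y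
    unfolding \<phi>_def \<phi>'_def using wb w
    by (intro has_derivative_suminf_dominated[OF S(1,2) that _ _ _ c(3) c(3)]) (auto intro!: derivative_eq_intros)
  have qb: "\<bar>q n y * \<phi> n y\<bar> \<le> a n * C" "\<bar>q n y * \<phi>' n y\<bar> \<le> a n * C" "\<bar>q' n y * \<phi> n y\<bar> \<le> a n * C"
    if "y \<in> S" for n y
    using a \<phi>b that order_trans[OF abs_ge_zero a(1)[OF that]] by (auto simp: abs_mult intro!: mult_mono)
  have sa: "summable (\<lambda>n. a n * C)" by (intro summable_mult2 a)
  have s1: "summable (\<lambda>n. q' n x * \<phi> n x)" "summable (\<lambda>n. q n x * \<phi>' n x)"
    using qb S by (auto intro!: summable_comparison_test'[OF sa])
  have "((\<lambda>y. \<Sum>n. q n y * \<phi> n y) has_real_derivative (\<Sum>n. q' n x * \<phi> n x + q n x * \<phi>' n x)) (at x)"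
  proof (rule has_derivative_suminf_dominated[OF S _ qb(1) _ sa])
    show "((\<lambda>y. q n y * \<phi> n y) has_real_derivative q' n y * \<phi> n y + q n y * \<phi>' n y) (at y)" if "y \<in> S" for n y
      using DERIV_mult[OF q[OF that] \<phi>d[OF that]] by (simp add: mult.commute)
    show "\<bar>q' n y * \<phi> n y + q n y * \<phi>' n y\<bar> \<le> a n * C + a n * C" if "y \<in> S" for n y
      using qb[OF that, of n] by linarith
    show "summable (\<lambda>n. a n * C + a n * C)" by (intro summable_add sa)
  qed
  also have "(\<Sum>n. q' n x * \<phi> n x + q n x * \<phi>' n x) = (\<Sum>n. q' n x * \<phi> n x) + (\<Sum>n. q n x * \<phi>' n x)"
    using s1 by (intro suminf_add[symmetric])
  finally show ?thesis by (simp add: \<phi>_def \<phi>'_def)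
qed

text \<open>
  Derivatives of count probabilities are differences of consecutive densities; this moves the
  difference to the factor \<open>\<phi>\<close>. The boundary term vanishes because of \<open>g 0 = 0\<close>.
\<close>
lemma suminf_by_parts:
  fixes g \<phi> :: "nat \<Rightarrow> real"
  assumes "summable g" "\<And>n. 0 \<le> g n" "g 0 = 0" "\<And>n. \<bar>\<phi> n\<bar> \<le> C"
  shows "(\<Sum>n. (g n - g (Suc n)) * \<phi> n) = (\<Sum>n. g (Suc n) * (\<phi> (Suc n) - \<phi> n))"
proof -
  have s: "summable (\<lambda>n. g n * C)" "summable (\<lambda>n. g (Suc n) * C)"
    using assms(1) by (auto intro!: summable_mult2 simp: summable_Suc_iff)
  have b: "\<bar>g m * \<phi> n\<bar> \<le> g m * C" for m n
    using assms(2,4) by (simp add: abs_mult mult_left_mono)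
  have s1: "summable (\<lambda>n. g n * \<phi> n)" by (rule summable_comparison_test'[OF s(1)]) (use b in auto)
  have s2: "summable (\<lambda>n. g (Suc n) * \<phi> n)" by (rule summable_comparison_test'[OF s(2)]) (use b in auto)
  have s3: "summable (\<lambda>n. g (Suc n) * \<phi> (Suc n))" by (subst summable_Suc_iff[of "\<lambda>n. g n * \<phi> n"]) fact
  have "(\<Sum>n. (g n - g (Suc n)) * \<phi> n) = (\<Sum>n. g n * \<phi> n) - (\<Sum>n. g (Suc n) * \<phi> n)"
    by (simp add: left_diff_distrib suminf_diff[OF s1 s2])
  also have "(\<Sum>n. g n * \<phi> n) = (\<Sum>n. g (Suc n) * \<phi> (Suc n))"
    using suminf_split_head[OF s1] assms(3) by simp
  also have "\<dots> - (\<Sum>n. g (Suc n) * \<phi> n) = (\<Sum>n. g (Suc n) * (\<phi> (Suc n) - \<phi> n))"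
    by (simp add: right_diff_distrib suminf_diff[OF s3 s2])
  finally show ?thesis .
qed

text \<open>
  After summation by parts the coefficients \<open>H\<close> enter only through their increments in \<open>n\<close> and in \<open>k\<close>.
  For the urn these increments are products, while the \<open>H n k\<close> themselves are not.
\<close>
lemma crossing_series_deriv:
  fixes H :: "nat \<Rightarrow> nat \<Rightarrow> real"
  assumes pos: "0 < \<beta>" "0 < \<rho>" "0 < l" "0 < \<mu>" and x: "0 < x" "x < t"
    and H: "\<And>n k. \<bar>H n k\<bar> \<le> 1"
  shows "((\<lambda>y. \<Sum>n. count_pmf \<beta> l n y * (\<Sum>k. count_pmf \<rho> \<mu> k (t - y) * H n k)) has_real_derivative
      (\<Sum>n. arrival_density \<beta> l (Suc n) x * (\<Sum>k. count_pmf \<rho> \<mu> k (t - x) * (H (Suc n) k - H n k)))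
    + (\<Sum>n. count_pmf \<beta> l n x * (\<Sum>k. arrival_density \<rho> \<mu> (Suc k) (t - x) * (H n k - H n (Suc k))))) (at x)"
proof -
  have t: "0 < t" using x by linarith
  obtain a where a: "summable a"
    "\<And>n x. 0 < x \<Longrightarrow> x < t \<Longrightarrow> \<bar>count_pmf \<beta> l n x\<bar> \<le> a n"
    "\<And>n x. 0 < x \<Longrightarrow> x < t \<Longrightarrow> \<bar>arrival_density \<beta> l n x - arrival_density \<beta> l (Suc n) x\<bar> \<le> a n"
    "\<And>n x. 0 < x \<Longrightarrow> x < t \<Longrightarrow> arrival_density \<beta> l n x \<le> a n"
    using count_pmf_bounds[OF pos(1,3) t] by blast
  obtain c where c: "summable c"
    "\<And>n x. 0 < x \<Longrightarrow> x < t \<Longrightarrow> \<bar>count_pmf \<rho> \<mu> n x\<bar> \<le> c n"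
    "\<And>n x. 0 < x \<Longrightarrow> x < t \<Longrightarrow> \<bar>arrival_density \<rho> \<mu> n x - arrival_density \<rho> \<mu> (Suc n) x\<bar> \<le> c n"
    "\<And>n x. 0 < x \<Longrightarrow> x < t \<Longrightarrow> arrival_density \<rho> \<mu> n x \<le> c n"
    using count_pmf_bounds[OF pos(2,4) t] by blast
  define w' where "w' k y = - (arrival_density \<rho> \<mu> k (t - y) - arrival_density \<rho> \<mu> (Suc k) (t - y))" for k y
  define \<phi> where "\<phi> n = (\<Sum>k. count_pmf \<rho> \<mu> k (t - x) * H n k)" for n
  have deriv: "((\<lambda>y. \<Sum>n. count_pmf \<beta> l n y * (\<Sum>k. count_pmf \<rho> \<mu> k (t - y) * H n k)) has_real_derivative
     (\<Sum>n. (arrival_density \<beta> l n x - arrival_density \<beta> l (Suc n) x) * \<phi> n)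
     + (\<Sum>n. count_pmf \<beta> l n x * (\<Sum>k. w' k x * H n k))) (at x)"
    unfolding \<phi>_def
  proof (rule product_series_deriv[where S = "{0<..<t}" and a = a and c = c])
    show "((\<lambda>y. count_pmf \<rho> \<mu> n (t - y)) has_real_derivative w' n y) (at y)" if "y \<in> {0<..<t}" for n y
    proof -
      have "((\<lambda>y. count_pmf \<rho> \<mu> n (t - y)) has_real_derivative
          (arrival_density \<rho> \<mu> n (t - y) - arrival_density \<rho> \<mu> (Suc n) (t - y)) * (- 1)) (at y)"
        by (rule DERIV_chain2[of "count_pmf \<rho> \<mu> n"])
           (use that pos in \<open>auto intro!: count_pmf_deriv derivative_eq_intros\<close>)
      then show ?thesis by (simp add: w'_def)
    qed
    show "\<bar>w' n y\<bar> \<le> c n" if "y \<in> {0<..<t}" for n y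
      using c(3)[of "t - y" n] that by (auto simp: w'_def)
  qed (use pos x a c H in \<open>auto intro!: count_pmf_deriv\<close>)
  have sw: "summable (\<lambda>k. count_pmf \<rho> \<mu> k (t - x) * H n k)" and cw: "\<bar>count_pmf \<rho> \<mu> k (t - x) * H n k\<bar> \<le> c k" for n k
  proof -
    show *: "\<bar>count_pmf \<rho> \<mu> k (t - x) * H n k\<bar> \<le> c k" for k
      using mult_mono[OF c(2)[of "t - x" k] H[of n k]] x order_trans[OF abs_ge_zero c(2)[of "t-x" k]]
      by (auto simp: abs_mult)
    show "summable (\<lambda>k. count_pmf \<rho> \<mu> k (t - x) * H n k)"
      by (rule summable_comparison_test'[OF c(1)]) (use * in auto)
  qed
  have \<phi>b: "\<bar>\<phi> n\<bar> \<le> (\<Sum>k. c k)" for n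
  proof -
    have abs: "summable (\<lambda>k. \<bar>count_pmf \<rho> \<mu> k (t - x) * H n k\<bar>)"
      by (rule summable_comparison_test'[OF c(1)]) (use cw in auto)
    have "\<bar>\<phi> n\<bar> \<le> (\<Sum>k. \<bar>count_pmf \<rho> \<mu> k (t - x) * H n k\<bar>)"
      unfolding \<phi>_def by (rule summable_rabs[OF abs])
    also have "\<dots> \<le> (\<Sum>k. c k)"
      by (rule suminf_le[OF _ abs c(1)]) (rule cw)
    finally show ?thesis .
  qed
  have sarr: "summable (\<lambda>n. arrival_density \<beta> l n x)" "summable (\<lambda>n. arrival_density \<rho> \<mu> n (t - x))"
  proof -
    show "summable (\<lambda>n. arrival_density \<beta> l n x)"
      by (rule summable_comparison_test'[OF a(1)]) (use pos x a(4) in \<open>auto simp: arrival_density_nonneg\<close>)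
    show "summable (\<lambda>n. arrival_density \<rho> \<mu> n (t - x))"
      by (rule summable_comparison_test'[OF c(1)]) (use pos x c(4) in \<open>auto simp: arrival_density_nonneg\<close>)
  qed
  have parts: "(\<Sum>n. (arrival_density \<beta> l n x - arrival_density \<beta> l (Suc n) x) * \<phi> n)
      = (\<Sum>n. arrival_density \<beta> l (Suc n) x * (\<phi> (Suc n) - \<phi> n))"
    by (rule suminf_by_parts[OF sarr(1) _ _ \<phi>b]) (auto simp: arrival_density_nonneg pos, simp add: arrival_density_def)
  have diff: "\<phi> (Suc n) - \<phi> n = (\<Sum>k. count_pmf \<rho> \<mu> k (t - x) * (H (Suc n) k - H n k))" for n
    unfolding \<phi>_def by (simp add: right_diff_distrib suminf_diff[OF sw sw])
  have 1: "(\<Sum>n. (arrival_density \<beta> l n x - arrival_density \<beta> l (Suc n) x) * \<phi> n)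
      = (\<Sum>n. arrival_density \<beta> l (Suc n) x * (\<Sum>k. count_pmf \<rho> \<mu> k (t - x) * (H (Suc n) k - H n k)))"
    unfolding parts diff ..
  have 2: "(\<Sum>k. w' k x * H n k) = (\<Sum>k. arrival_density \<rho> \<mu> (Suc k) (t - x) * (H n k - H n (Suc k)))" for n
  proof -
    have "(\<Sum>k. w' k x * H n k) = (\<Sum>k. (arrival_density \<rho> \<mu> k (t - x) - arrival_density \<rho> \<mu> (Suc k) (t - x)) * - H n k)"
      by (intro suminf_cong) (simp add: w'_def algebra_simps)
    also have "\<dots> = (\<Sum>k. arrival_density \<rho> \<mu> (Suc k) (t - x) * (- H n (Suc k) - - H n k))"
      by (rule suminf_by_parts[OF sarr(2), of _ 1])
         (use H pos in \<open>auto simp: arrival_density_nonneg\<close>, simp add: arrival_density_def)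
    finally show ?thesis by simp
  qed
  show ?thesis using deriv unfolding 1 2 .
qed

section \<open>Closed form of the density\<close>

text \<open>
  Terms are nonnegative, so they may be summed in any order: the pairs \<open>(n, k)\<close> are grouped by \<open>n + k\<close>.
\<close>
lemma diagonal_sums:
  fixes f :: "nat \<Rightarrow> nat \<Rightarrow> real"
  assumes nonneg: "\<And>n k. 0 \<le> f n k" and S: "(\<lambda>m. \<Sum>i\<le>m. f i (m - i)) sums S"
  shows "summable (f n)" and "(\<lambda>n. \<Sum>k. f n k) sums S"
proof -
  let ?g = "\<lambda>(m, i). f i (m - i)"
  have 1: "((\<lambda>m. \<Sum>i\<le>m. f i (m - i)) has_sum S) UNIV"
    using S nonneg by (intro sums_nonneg_imp_has_sum sum_nonneg)
  have 2: "((\<lambda>i. ?g (m, i)) has_sum (\<Sum>i\<le>m. f i (m - i))) {..m}" for m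
    by (rule has_sum_finiteI) auto
  have "?g summable_on Sigma UNIV (\<lambda>m. {..m})"
    by (rule summable_on_SigmaI[OF 2]) (use 1 nonneg in \<open>auto simp: summable_on_def\<close>)
  with 2 1 have "(?g has_sum S) (Sigma UNIV (\<lambda>m. {..m}))"
    by (rule has_sum_SigmaI)
  moreover have "bij_betw (\<lambda>(n, k). (n + k, n)) (UNIV \<times> UNIV) (Sigma UNIV (\<lambda>m::nat. {..m}))"
    by (rule bij_betwI[where g = "\<lambda>(m, i). (i, m - i)"]) auto
  ultimately have "((\<lambda>p. ?g ((\<lambda>(n, k). (n + k, n)) p)) has_sum S) (UNIV \<times> UNIV)"
    by (subst has_sum_reindex_bij_betw) auto
  also have "(\<lambda>p. ?g ((\<lambda>(n, k). (n + k, n)) p)) = (\<lambda>(n, k). f n k)"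
    by (auto simp: fun_eq_iff)
  finally have 3: "((\<lambda>(n, k). f n k) has_sum S) (UNIV \<times> UNIV)" .
  have 4: "f n summable_on UNIV" for n
    by (rule summable_on_SigmaD1[of f UNIV "\<lambda>_. UNIV"]) (use 3 in \<open>auto simp: summable_on_def\<close>)
  then show "summable (f n)" by (rule summable_on_imp_summable)
  have 5: "(f n has_sum (\<Sum>k. f n k)) UNIV" for n
    using has_sum_infsum[OF 4[of n]] has_sum_imp_sums[of "f n" "infsum (f n) UNIV"] by (simp add: sums_iff)
  have "((\<lambda>n. \<Sum>k. f n k) has_sum S) UNIV"
    by (rule has_sum_SigmaD[OF 3]) (use 5 in auto)
  then show "(\<lambda>n. \<Sum>k. f n k) sums S" by (rule has_sum_imp_sums)
qed

text \<open>
  With first parameter \<open>1\<close> the rising factorial in the numerator cancels the factorial.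
\<close>
lemma kummer_1F1_sums: "0 < w \<Longrightarrow> (\<lambda>n. z ^ n / pochhammer w n) sums kummer_1F1 1 w z"
  unfolding kummer_1F1_def using summable_sums[OF summable_power_pochhammer[of w z]]
  by (simp add: pochhammer_fact[symmetric])

lemma kummer_1F1_tail1:
  assumes "0 < w" "z \<noteq> 0"
  shows "(\<lambda>n. z ^ n / pochhammer w (Suc n)) sums ((kummer_1F1 1 w z - 1) / z)"
proof -
  have "(\<lambda>n. z ^ Suc n / pochhammer w (Suc n)) sums (kummer_1F1 1 w z - 1)"
    using kummer_1F1_sums[OF assms(1), of z] by (subst sums_Suc_iff) simp
  from sums_divide[OF this, of z] show ?thesis using assms by (simp add: field_simps)
qed

lemma kummer_1F1_tail2:
  assumes "0 < w" "z \<noteq> 0"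
  shows "(\<lambda>n. z ^ Suc n / pochhammer w (Suc (Suc n))) sums (inverse z * (kummer_1F1 1 w z - 1 - z / w))"
proof -
  have "(\<lambda>n. z ^ Suc n / pochhammer w (Suc (Suc n))) sums ((kummer_1F1 1 w z - 1) / z - z ^ 0 / pochhammer w (Suc 0))"
    using kummer_1F1_tail1[OF assms] by (subst sums_Suc_iff[of "\<lambda>n. z ^ n / pochhammer w (Suc n)"]) simp
  then show ?thesis using assms by (simp add: field_simps)
qed

text \<open>
  The shape of the first duration is matched to the initial content \<open>\<beta>\<close> of the urn: the gamma function
  in the density cancels against the rising factorial in the urn probabilities and a plain power
  remains.
\<close>
lemma arrival_density_pochhammer:
  assumes "0 < \<beta>" "0 < l" "0 < x"
  shows "arrival_density \<beta> l (Suc n) x * pochhammer \<beta> (Suc n)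
    = l * ((l * x) powr \<beta> * exp (- (l * x)) / Gamma \<beta>) * (l * x) ^ n"
proof -
  have "Gamma (\<beta> + real (Suc n)) \<noteq> 0" using assms by (intro Gamma_pos_neq_0) auto
  moreover have "Gamma \<beta> \<noteq> 0" using assms by (intro Gamma_pos_neq_0)
  moreover have "(l * x) powr (\<beta> + real n) = (l * x) powr \<beta> * (l * x) ^ n"
    using assms by (simp add: powr_add powr_realpow)
  ultimately show ?thesis
    using assms pochhammer_Gamma[OF pos_not_nonpos_Int[OF assms(1)], of "Suc n"]
    by (simp add: arrival_density_def gamma_density_pos del: pochhammer_Suc)
qed

lemma count_pmf_pochhammer:
  assumes "0 < \<beta>" "0 < l" "0 < x"
  shows "count_pmf \<beta> l (Suc n) x * pochhammer \<beta> (Suc (Suc n))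
    = ((l * x) powr \<beta> * exp (- (l * x)) / Gamma \<beta>) * (l * x) ^ Suc n"
  using arrival_density_pochhammer[OF assms, of "Suc n"] assms
  by (simp add: count_pmf_Suc field_simps del: power_Suc)

lemma binomial_tail:
  fixes a d :: real
  shows "(\<Sum>i\<le>m. of_nat (Suc m choose i) * a ^ i * d ^ (Suc m - i)) = (a + d) ^ Suc m - a ^ Suc m"
  using binomial_ring[of a d "Suc m"] by simp

text \<open>
  The factor \<open>eta\<close>, with \<open>a\<close> and \<open>d\<close> for the up and down times multiplied by their rates.
\<close>
definition crossing_eta :: "real \<Rightarrow> real \<Rightarrow> real \<Rightarrow> real" where
  "crossing_eta w a d = inverse (a + d) * (kummer_1F1 1 w (a + d) - 1 - (a + d) / w)
     - inverse a * (kummer_1F1 1 w a - 1 - a / w)"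

text \<open>
  On the diagonal \<open>n + k = m\<close> the denominator is constant and the binomial theorem, without its top
  term, gives \<open>(a + d) ^ Suc m - a ^ Suc m\<close>. The two powers then sum to two tails of Kummer series.
\<close>
lemma crossing_eta_sums:
  assumes w: "0 < w" and a: "0 < a" and d: "0 < d"
  defines "f \<equiv> \<lambda>n k. real (n + k + 1 choose n) * a ^ n * d ^ Suc k / pochhammer w (n + k + 2)"
  shows "summable (f n)" and "(\<lambda>n. \<Sum>k. f n k) sums crossing_eta w a d"
proof -
  have nonneg: "0 \<le> f n k" for n k
    unfolding f_def using a d pochhammer_pos[OF w] by (intro divide_nonneg_pos mult_nonneg_nonneg) auto
  have "(\<Sum>i\<le>m. f i (m - i)) = (a + d) ^ Suc m / pochhammer w (Suc (Suc m)) - a ^ Suc m / pochhammer w (Suc (Suc m))" for m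
  proof -
    have "(\<Sum>i\<le>m. f i (m - i)) = (\<Sum>i\<le>m. of_nat (Suc m choose i) * a ^ i * d ^ (Suc m - i)) / pochhammer w (Suc (Suc m))"
      unfolding f_def sum_divide_distrib by (intro sum.cong) (auto simp: Suc_diff_le)
    then show ?thesis by (simp only: binomial_tail diff_divide_distrib)
  qed
  moreover have "(\<lambda>m. (a + d) ^ Suc m / pochhammer w (Suc (Suc m)) - a ^ Suc m / pochhammer w (Suc (Suc m)))
      sums crossing_eta w a d"
    unfolding crossing_eta_def using w a d by (intro sums_diff kummer_1F1_tail2) auto
  ultimately have "(\<lambda>m. \<Sum>i\<le>m. f i (m - i)) sums crossing_eta w a d" by simp
  from diagonal_sums[OF nonneg this] show "summable (f n)" and "(\<lambda>n. \<Sum>k. f n k) sums crossing_eta w a d" .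
qed

text \<open>
  Times \<open>1 / (c + v)\<close>, this is the conditional density given that the first step has the colour with
  parameters \<open>\<beta>\<close> and \<open>l\<close>, where \<open>x\<close> is the time spent in that colour until \<open>t\<close>. The law given the other
  colour is obtained by exchanging \<open>\<beta>\<close> with \<open>\<rho>\<close>, \<open>l\<close> with \<open>\<mu>\<close> and \<open>x\<close> with \<open>t - x\<close>.
\<close>
definition crossing_density :: "real \<Rightarrow> real \<Rightarrow> real \<Rightarrow> real \<Rightarrow> real \<Rightarrow> real \<Rightarrow> real" where
  "crossing_density \<beta> \<rho> l \<mu> t x =
     \<rho> * l * (l * x) powr (\<beta> - 1) * exp (- l * x) / Gamma (\<beta> + 1) * count_pmf \<rho> \<mu> 0 (t - x)
       * (kummer_1F1 1 (\<beta> + \<rho> + 1) (l * x) - 1)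
     + exp (- l * x - \<mu> * (t - x)) * ((l * x) powr (\<beta> + 1) * (\<mu> * (t - x)) powr \<rho>)
         / (Gamma (\<beta> + 1) * Gamma \<rho>)
         * crossing_eta (\<beta> + \<rho> + 1) (l * x) (\<mu> * (t - x)) * t / (x * (t - x))"

text \<open>
  The terms of the first series with \<open>k = 0\<close> contain the tail \<open>count_pmf \<rho> \<mu> 0\<close>, which is no power, and
  add up to the first summand of \<open>crossing_density\<close>. All other terms of both series are powers with
  the same double series \<open>crossing_eta\<close>. The second series has the extra factor \<open>x / (t - x)\<close>, and
  \<open>1 + x / (t - x) = t / (t - x)\<close>.
\<close>
lemma crossing_density_closed_form:
  assumes pos: "0 < \<beta>" "0 < \<rho>" "0 < l" "0 < \<mu>" and x: "0 < x" "x < t"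
  defines "c \<equiv> \<lambda>n k. pochhammer \<beta> (Suc n) * pochhammer \<rho> (Suc k) / pochhammer (\<beta> + \<rho>) (n + k + 2)"
  shows "(\<Sum>n. arrival_density \<beta> l (Suc n) x * (\<Sum>k. count_pmf \<rho> \<mu> k (t - x) * (real (n + k choose n) * c n k)))
       + (\<Sum>n. count_pmf \<beta> l n x * (\<Sum>k. arrival_density \<rho> \<mu> (Suc k) (t - x) *
            (if n = 0 then 0 else real (n + k choose Suc k) * c n k)))
     = \<beta> / (\<beta> + \<rho>) *
       crossing_density \<beta> \<rho> l \<mu> t x"
    (is "?L1 + ?L2 = ?R")
proof -
  define s a d \<delta> w where "s = t - x" and "a = l * x" and "d = \<mu> * s" and "\<delta> = \<beta> + \<rho>" and "w = \<beta> + \<rho> + 1"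
  define P Q where "P = a powr \<beta> * exp (- a) / Gamma \<beta>" and "Q = d powr \<rho> * exp (- d) / Gamma \<rho>"
  define W where "W = count_pmf \<rho> \<mu> 0 s"
  define f where "f n k = real (n + k + 1 choose n) * a ^ n * d ^ Suc k / pochhammer w (n + k + 2)" for n k
  have p: "0 < s" "0 < a" "0 < d" "0 < \<delta>" "0 < w" "w = \<delta> + 1"
    using pos x by (auto simp: s_def a_def d_def \<delta>_def w_def)
  have poch: "pochhammer \<delta> (Suc n) = \<delta> * pochhammer w n" for n
    by (simp add: pochhammer_rec p)
  have pw: "pochhammer w n \<noteq> 0" for n using pochhammer_pos[OF p(5), of n] by simp
  have f: "summable (f n)" "(\<lambda>n. \<Sum>k. f n k) sums crossing_eta w a d" for n
    using crossing_eta_sums[OF p(5,2,3)] by (simp_all add: f_def[abs_def])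
  note A = arrival_density_pochhammer[OF pos(1,3) x(1), folded a_def, folded P_def]
    count_pmf_pochhammer[OF pos(1,3) x(1), folded a_def, folded P_def]
    arrival_density_pochhammer[OF pos(2,4) p(1), folded d_def, folded Q_def]
    count_pmf_pochhammer[OF pos(2,4) p(1), folded d_def, folded Q_def]
  have t1: "arrival_density \<beta> l (Suc n) x * (\<Sum>k. count_pmf \<rho> \<mu> k s * (real (n + k choose n) * c n k))
     = l * P * \<rho> * W / \<delta> * (a ^ n / pochhammer w (Suc n)) + l * P * Q / \<delta> * (\<Sum>k. f n k)" for n
  proof -
    have Su: "arrival_density \<beta> l (Suc n) x * (count_pmf \<rho> \<mu> (Suc k) s * (real (n + Suc k choose n) * c n (Suc k)))
        = l * P * Q / \<delta> * f n k" for k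
    proof -
      have "arrival_density \<beta> l (Suc n) x * (count_pmf \<rho> \<mu> (Suc k) s * (real (n + Suc k choose n) * c n (Suc k)))
        = real (n + k + 1 choose n) * (arrival_density \<beta> l (Suc n) x * pochhammer \<beta> (Suc n)) *
           (count_pmf \<rho> \<mu> (Suc k) s * pochhammer \<rho> (Suc (Suc k))) / pochhammer \<delta> (Suc (n + k + 2))"
        by (simp add: c_def \<delta>_def[symmetric] mult_ac)
      also have "\<dots> = l * P * Q / \<delta> * f n k"
        unfolding A poch f_def by simp
      finally show ?thesis .
    qed
    have Z: "arrival_density \<beta> l (Suc n) x * (count_pmf \<rho> \<mu> 0 s * (real (n + 0 choose n) * c n 0))
        = l * P * \<rho> * W / \<delta> * (a ^ n / pochhammer w (Suc n))"
    proof -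
      have "arrival_density \<beta> l (Suc n) x * (count_pmf \<rho> \<mu> 0 s * (real (n + 0 choose n) * c n 0))
        = (arrival_density \<beta> l (Suc n) x * pochhammer \<beta> (Suc n)) * W * \<rho> / pochhammer \<delta> (Suc (Suc n))"
        by (simp add: c_def \<delta>_def[symmetric] W_def mult_ac)
      also have "\<dots> = l * P * \<rho> * W / \<delta> * (a ^ n / pochhammer w (Suc n))"
        unfolding A poch by (simp add: mult_ac)
      finally show ?thesis .
    qed
    have n0: "arrival_density \<beta> l (Suc n) x \<noteq> 0"
      using A(1)[of n] p pos by (auto simp: P_def Gamma_pos_neq_0)
    have "summable (\<lambda>k. count_pmf \<rho> \<mu> (Suc k) s * (real (n + Suc k choose n) * c n (Suc k)))"
      using summable_mult[OF f(1)[of n], of "l * P * Q / \<delta>"] n0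
      unfolding Su[symmetric] by (simp add: summable_cmult_iff del: add_Suc_right)
    then have sm: "summable (\<lambda>k. count_pmf \<rho> \<mu> k s * (real (n + k choose n) * c n k))"
      by (subst summable_Suc_iff[symmetric])
    have "arrival_density \<beta> l (Suc n) x * (\<Sum>k. count_pmf \<rho> \<mu> k s * (real (n + k choose n) * c n k))
      = (\<Sum>k. arrival_density \<beta> l (Suc n) x * (count_pmf \<rho> \<mu> k s * (real (n + k choose n) * c n k)))"
      by (rule suminf_mult[OF sm, symmetric])
    also have "\<dots> = (\<Sum>k. arrival_density \<beta> l (Suc n) x * (count_pmf \<rho> \<mu> (Suc k) s * (real (n + Suc k choose n) * c n (Suc k))))
        + arrival_density \<beta> l (Suc n) x * (count_pmf \<rho> \<mu> 0 s * (real (n + 0 choose n) * c n 0))"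
      using suminf_split_head[OF summable_mult[OF sm, of "arrival_density \<beta> l (Suc n) x"]] by linarith
    finally show ?thesis unfolding Su Z using suminf_mult[OF f(1)[of n], of "l * P * Q / \<delta>"] by simp
  qed
  have t2: "count_pmf \<beta> l (Suc n) x * (\<Sum>k. arrival_density \<rho> \<mu> (Suc k) s * (real (Suc n + k choose Suc k) * c (Suc n) k))
     = P * Q * a * \<mu> / (d * \<delta>) * (\<Sum>k. f n k)" for n
  proof -
    have Su: "count_pmf \<beta> l (Suc n) x * (arrival_density \<rho> \<mu> (Suc k) s * (real (Suc n + k choose Suc k) * c (Suc n) k))
        = P * Q * a * \<mu> / (d * \<delta>) * f n k" for k
    proof -
      have b: "(Suc n + k choose Suc k) = (n + k + 1 choose n)"
        by (subst binomial_symmetric) auto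
      have "count_pmf \<beta> l (Suc n) x * (arrival_density \<rho> \<mu> (Suc k) s * (real (Suc n + k choose Suc k) * c (Suc n) k))
        = real (n + k + 1 choose n) * (count_pmf \<beta> l (Suc n) x * pochhammer \<beta> (Suc (Suc n))) *
           (arrival_density \<rho> \<mu> (Suc k) s * pochhammer \<rho> (Suc k)) / pochhammer \<delta> (Suc (n + k + 2))"
        unfolding b by (simp add: c_def \<delta>_def[symmetric] mult_ac)
      also have "\<dots> = P * Q * a * \<mu> / (d * \<delta>) * f n k"
        unfolding A poch f_def using p by simp
      finally show ?thesis .
    qed
    have n0: "count_pmf \<beta> l (Suc n) x \<noteq> 0"
      using A(2)[of n] p pos by (auto simp: P_def Gamma_pos_neq_0)
    have sm: "summable (\<lambda>k. arrival_density \<rho> \<mu> (Suc k) s * (real (Suc n + k choose Suc k) * c (Suc n) k))"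
      using summable_mult[OF f(1)[of n], of "P * Q * a * \<mu> / (d * \<delta>)"] n0
      unfolding Su[symmetric] by (simp add: summable_cmult_iff del: add_Suc_right add_Suc)
    have "count_pmf \<beta> l (Suc n) x * (\<Sum>k. arrival_density \<rho> \<mu> (Suc k) s * (real (Suc n + k choose Suc k) * c (Suc n) k))
      = (\<Sum>k. P * Q * a * \<mu> / (d * \<delta>) * f n k)"
      unfolding Su[symmetric] by (rule suminf_mult[OF sm, symmetric])
    then show ?thesis using suminf_mult[OF f(1)[of n], of "P * Q * a * \<mu> / (d * \<delta>)"] by simp
  qed
  \<comment> \<open>Summation over n, where the double series is evaluated along its diagonals.\<close>
  have S1: "(\<lambda>n. l * P * \<rho> * W / \<delta> * (a ^ n / pochhammer w (Suc n)) + l * P * Q / \<delta> * (\<Sum>k. f n k))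
     sums (l * P * \<rho> * W / \<delta> * ((kummer_1F1 1 w a - 1) / a) + l * P * Q / \<delta> * crossing_eta w a d)"
    using p by (intro sums_add sums_mult kummer_1F1_tail1 f(2)) auto
  have L1: "?L1 = l * P * \<rho> * W / \<delta> * ((kummer_1F1 1 w a - 1) / a) + l * P * Q / \<delta> * crossing_eta w a d"
    using sums_unique[OF S1] unfolding s_def[symmetric] t1 by simp
  have S2: "(\<lambda>n. P * Q * a * \<mu> / (d * \<delta>) * (\<Sum>k. f n k)) sums (P * Q * a * \<mu> / (d * \<delta>) * crossing_eta w a d)"
    by (intro sums_mult f(2))
  let ?h = "\<lambda>n. count_pmf \<beta> l n x * (\<Sum>k. arrival_density \<rho> \<mu> (Suc k) s *
            (if n = 0 then 0 else real (n + k choose Suc k) * c n k))"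
  have "(\<lambda>n. ?h (Suc n)) sums (P * Q * a * \<mu> / (d * \<delta>) * crossing_eta w a d)"
    using S2 unfolding t2[symmetric] by (simp del: add_Suc)
  then have "?h sums (P * Q * a * \<mu> / (d * \<delta>) * crossing_eta w a d)"
    by (subst (asm) sums_Suc_iff) simp
  then have L2: "?L2 = P * Q * a * \<mu> / (d * \<delta>) * crossing_eta w a d"
    unfolding s_def[symmetric] by (rule sums_unique[symmetric])
  have G: "Gamma (\<beta> + 1) = \<beta> * Gamma \<beta>" "Gamma \<beta> \<noteq> 0" "Gamma \<rho> \<noteq> 0"
    using Gamma_plus1[OF pos_not_nonpos_Int[OF pos(1)]] Gamma_pos_neq_0[OF pos(1)] Gamma_pos_neq_0[OF pos(2)] by simp_all
  have e1: "a powr (\<beta> - 1) = a powr \<beta> / a" "a powr (\<beta> + 1) = a powr \<beta> * a" "exp (- a - d) = exp (- a) * exp (- d)"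
    using p by (simp_all add: powr_diff powr_add exp_add[symmetric])
  have R: "?R = \<beta> / \<delta> * (\<rho> * l * a powr (\<beta> - 1) * exp (- a) / Gamma (\<beta> + 1) * W * (kummer_1F1 1 w a - 1)
      + exp (- a - d) * (a powr (\<beta> + 1) * d powr \<rho>) / (Gamma (\<beta> + 1) * Gamma \<rho>) * crossing_eta w a d * t / (x * s))"
    by (simp add: crossing_density_def a_def d_def s_def \<delta>_def w_def W_def)
  have 1: "l * P * \<rho> * W / \<delta> * ((kummer_1F1 1 w a - 1) / a) = \<beta> / \<delta> * (\<rho> * l * a powr (\<beta> - 1) * exp (- a) / Gamma (\<beta> + 1) * W * (kummer_1F1 1 w a - 1))"
    unfolding e1 G P_def using p pos G by (simp add: mult_ac)
  have 2: "l * P * Q / \<delta> + P * Q * a * \<mu> / (d * \<delta>) = \<beta> / \<delta> * (exp (- a - d) * (a powr (\<beta> + 1) * d powr \<rho>) / (Gamma (\<beta> + 1) * Gamma \<rho>) * t / (x * s))"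
  proof -
    have "l * P * Q / \<delta> + P * Q * a * \<mu> / (d * \<delta>) = P * Q * a / \<delta> * (1 / x + 1 / s)"
      using p pos x by (simp add: a_def d_def field_simps)
    also have "1 / x + 1 / s = t / (x * s)" using p x by (simp add: s_def field_simps)
    finally show ?thesis unfolding e1 G P_def Q_def using p pos G by (simp add: mult_ac)
  qed
  have "?L1 + ?L2 = l * P * \<rho> * W / \<delta> * ((kummer_1F1 1 w a - 1) / a) + (l * P * Q / \<delta> + P * Q * a * \<mu> / (d * \<delta>)) * crossing_eta w a d"
    unfolding L1 L2 by (simp add: distrib_right)
  also have "\<dots> = ?R" unfolding R 1 2 by (simp add: distrib_left mult_ac)
  finally show ?thesis .
qed

section \<open>The urn\<close>

definition draw_count :: "(nat \<Rightarrow> 'a \<Rightarrow> nat) \<Rightarrow> nat \<Rightarrow> 'a \<Rightarrow> nat" where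
  "draw_count Y n \<omega> = (\<Sum>i=1..n. Y i \<omega>)"

lemma draw_count_0 [simp]: "draw_count Y 0 \<omega> = 0"
  and draw_count_Suc [simp]: "draw_count Y (Suc n) \<omega> = draw_count Y n \<omega> + Y (Suc n) \<omega>"
  by (simp_all add: draw_count_def)

lemma draw_count_pos: "Y 1 \<omega> = 1 \<Longrightarrow> draw_count Y (Suc n) \<omega> \<noteq> 0"
  by (induction n) auto

context prob_space
begin

text \<open>
  The probability that the first draw has the colour counted by \<open>Y\<close> and that, of this colour, the
  draw number \<open>n + 1\<close> comes after draw number \<open>k + 1\<close> of the other colour: the earlier one of these two
  events is decided after \<open>n + k + 1\<close> draws.
\<close>
definition low_count :: "(nat \<Rightarrow> 'a \<Rightarrow> nat) \<Rightarrow> nat \<Rightarrow> nat \<Rightarrow> real" where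
  "low_count Y n k = \<P>(\<omega> in M. Y 1 \<omega> = 1 \<and> draw_count Y (Suc (n + k)) \<omega> \<le> n)"

lemma prob_disjoint_cases:
  assumes "Measurable.pred M P" "Measurable.pred M Q"
    and "\<And>\<omega>. \<omega> \<in> space M \<Longrightarrow> R \<omega> \<longleftrightarrow> P \<omega> \<or> Q \<omega>" "\<And>\<omega>. \<omega> \<in> space M \<Longrightarrow> P \<omega> \<Longrightarrow> Q \<omega> \<Longrightarrow> False"
  shows "\<P>(\<omega> in M. R \<omega>) = \<P>(\<omega> in M. P \<omega>) + \<P>(\<omega> in M. Q \<omega>)"
proof -
  have "{\<omega>\<in>space M. R \<omega>} = {\<omega>\<in>space M. P \<omega>} \<union> {\<omega>\<in>space M. Q \<omega>}" using assms(3) by auto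
  moreover have "prob ({\<omega>\<in>space M. P \<omega>} \<union> {\<omega>\<in>space M. Q \<omega>}) = \<P>(\<omega> in M. P \<omega>) + \<P>(\<omega> in M. Q \<omega>)"
    by (rule finite_measure_Union) (use assms in \<open>auto simp: pred_def\<close>)
  ultimately show ?thesis by simp
qed

lemma prob_False: "(\<And>\<omega>. \<omega> \<in> space M \<Longrightarrow> \<not> P \<omega>) \<Longrightarrow> \<P>(\<omega> in M. P \<omega>) = 0"
  by (metis (no_types, lifting) Collect_empty_eq measure_empty)

lemma low_count_bound: "\<bar>low_count Y n k\<bar> \<le> 1"
  by (simp add: low_count_def)

text \<open>
  A Polya urn seen from one colour, with contents measured in units of the reinforcement \<open>A\<close>. The
  reinforcement rule is conditioned on the first draw and on the count alone, which makes the count a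
  Markov chain. Phrased in this way it is symmetric in the colours.
\<close>
definition polya_urn :: "(nat \<Rightarrow> 'a \<Rightarrow> nat) \<Rightarrow> real \<Rightarrow> real \<Rightarrow> bool" where
  "polya_urn Y \<beta> \<rho> \<longleftrightarrow> 0 < \<beta> \<and> 0 < \<rho> \<and>
     (\<forall>n\<ge>1. Y n \<in> measurable M (count_space UNIV)) \<and>
     (\<forall>n\<ge>1. \<forall>\<omega>\<in>space M. Y n \<omega> \<in> {0, 1}) \<and>
     \<P>(\<omega> in M. Y 1 \<omega> = 1) = \<beta> / (\<beta> + \<rho>) \<and>
     (\<forall>n\<ge>1. \<forall>j.
       \<P>(\<omega> in M. Y 1 \<omega> = 1 \<and> draw_count Y n \<omega> = j \<and> Y (Suc n) \<omega> = 1)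
        = (\<beta> + real j) / (\<beta> + \<rho> + real n) * \<P>(\<omega> in M. Y 1 \<omega> = 1 \<and> draw_count Y n \<omega> = j))"

context
  fixes Y :: "nat \<Rightarrow> 'a \<Rightarrow> nat" and \<beta> \<rho> :: real
  assumes urn: "polya_urn Y \<beta> \<rho>"
begin

lemma
  shows urn_pos: "0 < \<beta>" "0 < \<rho>"
    and urn_measurable: "n \<ge> 1 \<Longrightarrow> Y n \<in> measurable M (count_space UNIV)"
    and urn_01: "n \<ge> 1 \<Longrightarrow> \<omega> \<in> space M \<Longrightarrow> Y n \<omega> = 0 \<or> Y n \<omega> = 1"
    and urn_first: "\<P>(\<omega> in M. Y 1 \<omega> = 1) = \<beta> / (\<beta> + \<rho>)"
    and urn_next: "n \<ge> 1 \<Longrightarrow>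
       \<P>(\<omega> in M. Y 1 \<omega> = 1 \<and> draw_count Y n \<omega> = j \<and> Y (Suc n) \<omega> = 1)
        = (\<beta> + real j) / (\<beta> + \<rho> + real n) * \<P>(\<omega> in M. Y 1 \<omega> = 1 \<and> draw_count Y n \<omega> = j)"
  using urn by (auto simp: polya_urn_def)

lemma urn_sum_measurable [measurable]: "draw_count Y n \<in> measurable M (count_space UNIV)"
  unfolding draw_count_def[abs_def] by (intro measurable_sum_nat urn_measurable) auto

lemma urn_measurable' [measurable]:
  "Y (Suc n) \<in> measurable M (count_space UNIV)" "Y 1 \<in> measurable M (count_space UNIV)"
  by (intro urn_measurable; simp)+

lemma urn_draw_cases: "\<omega> \<in> space M \<Longrightarrow> Y (Suc n) \<omega> = 0 \<or> Y (Suc n) \<omega> = 1"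
  by (rule urn_01) auto

lemma urn_preds:
  "Measurable.pred M (\<lambda>\<omega>. Y 1 \<omega> = j)" "Measurable.pred M (\<lambda>\<omega>. Y (Suc n) \<omega> = j)"
  "Measurable.pred M (\<lambda>\<omega>. draw_count Y n \<omega> = j)" "Measurable.pred M (\<lambda>\<omega>. draw_count Y n \<omega> \<le> j)"
  by measurable

lemma urn_next_0:
  assumes "n \<ge> 1"
  shows "\<P>(\<omega> in M. Y 1 \<omega> = 1 \<and> draw_count Y n \<omega> = j \<and> Y (Suc n) \<omega> = 0)
        = (\<rho> + real n - real j) / (\<beta> + \<rho> + real n) * \<P>(\<omega> in M. Y 1 \<omega> = 1 \<and> draw_count Y n \<omega> = j)"
proof -
  have 0: "\<beta> + \<rho> + real n \<noteq> 0" using urn_pos by linarith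
  have "\<P>(\<omega> in M. Y 1 \<omega> = 1 \<and> draw_count Y n \<omega> = j)
    = \<P>(\<omega> in M. Y 1 \<omega> = 1 \<and> draw_count Y n \<omega> = j \<and> Y (Suc n) \<omega> = 1)
      + \<P>(\<omega> in M. Y 1 \<omega> = 1 \<and> draw_count Y n \<omega> = j \<and> Y (Suc n) \<omega> = 0)"
    by (rule prob_disjoint_cases, (intro pred_intros_logic urn_preds)+) (auto dest!: urn_draw_cases[of _ "n"])
  then show ?thesis unfolding urn_next[OF assms] using 0 by (simp add: field_simps)
qed

text \<open>
  The last draw is of the colour or not. Both cases carry the same rising factorials, with binomial
  coefficients that add up by Pascal's rule.
\<close>
lemma urn_count:
  "\<P>(\<omega> in M. Y 1 \<omega> = 1 \<and> draw_count Y (Suc N) \<omega> = Suc j)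
    = real (N choose j) * pochhammer \<beta> (Suc j) * pochhammer \<rho> (N - j) / pochhammer (\<beta> + \<rho>) (Suc N)"
proof (induction N arbitrary: j)
  case 0
  show ?case
  proof (cases j)
    case 0
    then show ?thesis using urn_first by simp
  next
    case (Suc i)
    then show ?thesis by (subst prob_False) auto
  qed
next
  case (Suc N)
  let ?R = "\<lambda>N j. \<P>(\<omega> in M. Y 1 \<omega> = 1 \<and> draw_count Y (Suc N) \<omega> = j)"
  have p: "pochhammer (\<beta> + \<rho>) (Suc N) \<noteq> 0" "\<beta> + \<rho> + real (Suc N) \<noteq> 0"
    using urn_pos pochhammer_pos[of "\<beta> + \<rho>" "Suc N"] by (auto simp del: pochhammer_Suc)
  have "?R (Suc N) (Suc j) = \<P>(\<omega> in M. Y 1 \<omega> = 1 \<and> draw_count Y (Suc N) \<omega> = j \<and> Y (Suc (Suc N)) \<omega> = 1)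
     + \<P>(\<omega> in M. Y 1 \<omega> = 1 \<and> draw_count Y (Suc N) \<omega> = Suc j \<and> Y (Suc (Suc N)) \<omega> = 0)"
    by (rule prob_disjoint_cases, (intro pred_intros_logic urn_preds)+) (auto dest!: urn_draw_cases[of _ "Suc N"])
  also have "\<dots> = (\<beta> + real j) / (\<beta> + \<rho> + real (Suc N)) * ?R N j
     + (\<rho> + real (Suc N) - real (Suc j)) / (\<beta> + \<rho> + real (Suc N)) * ?R N (Suc j)"
    by (subst urn_next, simp, subst urn_next_0) auto
  also have "\<dots> = real (Suc N choose j) * pochhammer \<beta> (Suc j) * pochhammer \<rho> (Suc N - j) / pochhammer (\<beta> + \<rho>) (Suc (Suc N))"
  proof (cases j)
    case 0
    have "?R N 0 = 0" by (intro prob_False) (use draw_count_pos[of Y] in auto)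
    then show ?thesis using p unfolding 0 Suc.IH
      by (simp add: pochhammer_Suc[of \<rho>] pochhammer_Suc[of "\<beta> + \<rho>" "Suc N"] add_ac mult_ac)
  next
    case (Suc i)
    note IH = Suc.IH
    show ?thesis
    proof (cases "i < N")
      case True
      define m where "m = N - Suc i"
      have m: "N - i = Suc m" "Suc N - Suc i = Suc m" "N - Suc i = m"
        and rm: "\<rho> + real (Suc N) - real (Suc (Suc i)) = \<rho> + real m"
        using True by (auto simp: m_def of_nat_diff)
      have poch: "pochhammer \<beta> (Suc (Suc i)) = pochhammer \<beta> (Suc i) * (\<beta> + real (Suc i))"
        "pochhammer \<rho> (Suc m) = pochhammer \<rho> m * (\<rho> + real m)"
        "pochhammer (\<beta> + \<rho>) (Suc (Suc N)) = pochhammer (\<beta> + \<rho>) (Suc N) * (\<beta> + \<rho> + real (Suc N))"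
        by (simp_all only: pochhammer_Suc)
      have b: "real (Suc N choose Suc i) = real (N choose i) + real (N choose Suc i)" by simp
      \<comment> \<open>Both summands have the factors of the result in common, up to the two binomial coefficients.\<close>
      have alg: "bi / q * (C1 * B * (R * e) / D') + e / q * (C2 * (B * bi) * R / D') = (C1 + C2) * (B * bi) * (R * e) / (D' * q)"
        if "q \<noteq> 0" for bi q C1 C2 B R e D' :: real
        using that by (simp add: divide_simps) (simp add: algebra_simps)
      show ?thesis unfolding Suc IH b m rm poch by (rule alg[OF p(2)])
    next
      case False
      then have "N choose Suc i = 0" by simp
      then have c: "real (N choose Suc i) = 0" by simp
      show ?thesis
      proof (cases "i = N")
        case True
        have poch: "pochhammer \<beta> (Suc (Suc N)) = pochhammer \<beta> (Suc N) * (\<beta> + real (Suc N))"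
          "pochhammer (\<beta> + \<rho>) (Suc (Suc N)) = pochhammer (\<beta> + \<rho>) (Suc N) * (\<beta> + \<rho> + real (Suc N))"
          by (simp_all only: pochhammer_Suc)
        show ?thesis unfolding Suc IH c unfolding True poch using p by (simp add: mult_ac)
      next
        case False
        then have d: "real (N choose i) = 0" using \<open>\<not> i < N\<close> by simp
        have b: "real (Suc N choose Suc i) = real (N choose i) + real (N choose Suc i)" by simp
        show ?thesis unfolding Suc IH b c d by simp
      qed
    qed
  qed
  finally show ?case .
qed

text \<open>
  Passing from \<open>n\<close> to \<open>n + 1\<close> allows one more draw in total and one more of the colour. Gained are
  exactly the sequences that have count \<open>n + 1\<close> before the additional draw, and whose additional draw
  is of the other colour.
\<close>
lemma low_count_diff1:
  "low_count Y (Suc n) k - low_count Y n k = real (n + k choose n) *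
     (pochhammer \<beta> (Suc n) * pochhammer \<rho> (Suc k) / pochhammer (\<beta> + \<rho>) (n + k + 2))"
proof -
  have "low_count Y (Suc n) k = low_count Y n k
    + \<P>(\<omega> in M. Y 1 \<omega> = 1 \<and> draw_count Y (Suc (n + k)) \<omega> = Suc n \<and> Y (Suc (Suc (n + k))) \<omega> = 0)"
    unfolding low_count_def
    by (rule prob_disjoint_cases, (intro pred_intros_logic urn_preds)+) (auto dest!: urn_draw_cases[of _ "Suc (n + k)"])
  then have "low_count Y (Suc n) k - low_count Y n k = (\<rho> + real (Suc (n + k)) - real (Suc n)) / (\<beta> + \<rho> + real (Suc (n + k))) *
      (real (n + k choose n) * pochhammer \<beta> (Suc n) * pochhammer \<rho> (n + k - n) / pochhammer (\<beta> + \<rho>) (Suc (n + k)))"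
    unfolding urn_count[symmetric] by (subst urn_next_0[symmetric]) linarith+
  also have "\<rho> + real (Suc (n + k)) - real (Suc n) = \<rho> + real k" by simp
  also have "n + k - n = k" by simp
  finally show ?thesis
    unfolding pochhammer_Suc[of \<rho> k] add_2_eq_Suc' pochhammer_Suc[of "\<beta> + \<rho>" "Suc (n + k)"] by (simp only: mult_ac times_divide_eq_left times_divide_eq_right divide_divide_eq_left)
qed

text \<open>
  One more draw with the same bound on the count: lost are the sequences that have count \<open>n\<close>
  before the additional draw, and whose additional draw is of the colour. For \<open>n = 0\<close> there are none, because the first draw is of the colour.
\<close>
lemma low_count_diff2:
  "low_count Y n k - low_count Y n (Suc k) = (if n = 0 then 0 else real (n + k choose Suc k) *
     (pochhammer \<beta> (Suc n) * pochhammer \<rho> (Suc k) / pochhammer (\<beta> + \<rho>) (n + k + 2)))"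
proof -
  have "low_count Y n k = low_count Y n (Suc k)
    + \<P>(\<omega> in M. Y 1 \<omega> = 1 \<and> draw_count Y (Suc (n + k)) \<omega> = n \<and> Y (Suc (Suc (n + k))) \<omega> = 1)"
    unfolding low_count_def
    by (rule prob_disjoint_cases, (intro pred_intros_logic urn_preds)+) (auto dest!: urn_draw_cases[of _ "Suc (n + k)"])
  then have 1: "low_count Y n k - low_count Y n (Suc k) = (\<beta> + real n) / (\<beta> + \<rho> + real (Suc (n + k))) *
      \<P>(\<omega> in M. Y 1 \<omega> = 1 \<and> draw_count Y (Suc (n + k)) \<omega> = n)"
    by (subst urn_next[symmetric]) linarith+
  show ?thesis
  proof (cases n)
    case 0
    have "\<P>(\<omega> in M. Y 1 \<omega> = 1 \<and> draw_count Y (Suc (n + k)) \<omega> = n) = 0"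
      unfolding 0 by (intro prob_False) (use draw_count_pos[of Y] in auto)
    then show ?thesis using 1 0 by simp
  next
    case (Suc i)
    have c: "(n + k choose Suc k) = (n + k choose i)"
      by (subst binomial_symmetric) (auto simp: Suc)
    have m: "n + k - i = Suc k" using Suc by simp
    have n0: "n \<noteq> 0" using Suc by simp
    have "low_count Y n k - low_count Y n (Suc k) = (\<beta> + real n) / (\<beta> + \<rho> + real (Suc (n + k))) *
      (real (n + k choose i) * pochhammer \<beta> n * pochhammer \<rho> (n + k - i) / pochhammer (\<beta> + \<rho>) (Suc (n + k)))"
      using 1 urn_count[of "n + k" i] unfolding Suc by simp
    then show ?thesis
      unfolding c m pochhammer_Suc[of \<beta> n] add_2_eq_Suc' pochhammer_Suc[of "\<beta> + \<rho>" "Suc (n + k)"] if_not_P[OF n0]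
      by (simp only: mult_ac times_divide_eq_left times_divide_eq_right divide_divide_eq_left)
  qed
qed

lemma urn_crossing_deriv:
  assumes lm: "0 < l" "0 < \<mu>" and x: "0 < x" "x < t"
  shows "((\<lambda>y. \<Sum>n. count_pmf \<beta> l n y * (\<Sum>k. count_pmf \<rho> \<mu> k (t - y) * low_count Y n k)) has_real_derivative
      \<beta> / (\<beta> + \<rho>) *
       crossing_density \<beta> \<rho> l \<mu> t x) (at x)"
  using crossing_series_deriv[where H = "low_count Y", OF urn_pos lm x low_count_bound]
  unfolding low_count_diff1 low_count_diff2 crossing_density_closed_form[OF urn_pos lm x] .

end

end

text \<open>
  The conditional probability is integrated over an event of the history on which it is constant.
\<close>
lemma (in polya_telegraph) next_up_prob:
  assumes n: "n \<ge> 1"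
  shows "\<P>(\<omega> in M. X 1 \<omega> = y \<and> draw_count X n \<omega> = j \<and> X (Suc n) \<omega> = 1)
     = (b + A * real j) / (b + r + A * real n) * \<P>(\<omega> in M. X 1 \<omega> = y \<and> draw_count X n \<omega> = j)"
proof -
  define F where "F = urn_history M X n"
  define E where "E = {\<omega>\<in>space M. X 1 \<omega> = y \<and> draw_count X n \<omega> = j}"
  define B where "B = {\<omega>\<in>space M. X (n + 1) \<omega> = 1}"
  have h: "(\<lambda>\<omega>. \<lambda>k\<in>{1..n}. X k \<omega>) \<in> measurable M (PiM {1..n} (\<lambda>_. count_space UNIV))"
    by (intro measurable_restrict X_rv) auto
  have sp: "space F = space M" by (simp add: F_def urn_history_def)
  have sets: "sets F = {(\<lambda>\<omega>. \<lambda>k\<in>{1..n}. X k \<omega>) -` C \<inter> space M | C. C \<in> sets (PiM {1..n} (\<lambda>_. count_space UNIV))}"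
    unfolding F_def urn_history_def by (rule sets_vimage_algebra2) (use measurable_space[OF h] in auto)
  have sub: "subalgebra M F"
    unfolding subalgebra_def sp sets using measurable_sets[OF h] by auto
  interpret F: finite_measure_subalgebra M F
    by unfold_locales (rule sub)
  have E: "E \<in> sets F"
  proof -
    let ?C = "{f \<in> space (PiM {1..n} (\<lambda>_. count_space UNIV)). f 1 = y \<and> (\<Sum>i=1..n. f i) = j}"
    have m1: "(\<lambda>f. f i) \<in> measurable (PiM {1..n} (\<lambda>_. count_space (UNIV :: nat set))) (count_space UNIV)"
      if "i \<in> {1..n}" for i
      by (rule measurable_component_singleton[OF that])
    have m2: "(\<lambda>f. \<Sum>i=1..n. f i) \<in> measurable (PiM {1..n} (\<lambda>_. count_space (UNIV :: nat set))) (count_space UNIV)"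
      by (intro measurable_sum_nat m1)
    have "Measurable.pred (PiM {1..n} (\<lambda>_. count_space (UNIV :: nat set))) (\<lambda>f. f 1 = y \<and> (\<Sum>i=1..n. f i) = j)"
      by (intro pred_intros_logic pred_count_space_const1 m1 m2) (use n in auto)
    then have "?C \<in> sets (PiM {1..n} (\<lambda>_. count_space (UNIV :: nat set)))"
      by (simp add: pred_def)
    moreover have "E = (\<lambda>\<omega>. \<lambda>k\<in>{1..n}. X k \<omega>) -` ?C \<inter> space M"
      using n measurable_space[OF h] by (auto simp: E_def draw_count_def)
    ultimately show ?thesis unfolding sets by blast
  qed
  have EM: "E \<in> sets M" using E sub by (auto simp: subalgebra_def)
  have BM: "B \<in> sets M"
    unfolding B_def using X_rv[of "n + 1"] by measurable
  have "(\<integral>\<omega>\<in>E. indicator B \<omega> \<partial>M) = (\<integral>\<omega>\<in>E. real_cond_exp M F (indicator B) \<omega> \<partial>M)"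
    by (rule F.real_cond_exp_intA) (use E BM in \<open>auto simp: less_top[symmetric]\<close>)
  also have "\<dots> = (\<integral>\<omega>\<in>E. (b + A * real j) / (b + r + A * real n) \<partial>M)"
    unfolding set_lebesgue_integral_def
  proof (rule integral_cong_AE)
    show "AE \<omega> in M. indicat_real E \<omega> *\<^sub>R real_cond_exp M F (indicator B) \<omega> = indicat_real E \<omega> *\<^sub>R ((b + A * real j) / (b + r + A * real n))"
      using X_next[OF n] unfolding F_def[symmetric] B_def[symmetric]
      by eventually_elim (auto simp: E_def indicator_def draw_count_def simp flip: of_nat_sum)
  qed (use EM in auto)
  also have "(\<integral>\<omega>\<in>E. indicator B \<omega> \<partial>M) = prob (E \<inter> B)"
    using EM BM by (simp add: set_lebesgue_integral_def indicator_inter_arith[symmetric])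
  also have "(\<integral>\<omega>\<in>E. (b + A * real j) / (b + r + A * real n) \<partial>M) = (b + A * real j) / (b + r + A * real n) * prob E"
    using EM by (simp add: set_lebesgue_integral_def)
  also have "E \<inter> B = {\<omega>\<in>space M. X 1 \<omega> = y \<and> draw_count X n \<omega> = j \<and> X (Suc n) \<omega> = 1}"
    by (auto simp: E_def B_def)
  finally show ?thesis
    unfolding E_def .
qed

lemma (in polya_telegraph) urn_ones: "polya_urn X (b / A) (r / A)"
  unfolding polya_urn_def
proof (intro conjI allI ballI impI)
  show "\<P>(\<omega> in M. X 1 \<omega> = 1) = b / A / (b / A + r / A)"
    using X_first pos by (simp add: field_simps)
  fix n j :: nat assume n: "n \<ge> 1"
  have "(b + A * real j) / (b + r + A * real n) = (b / A + real j) / (b / A + r / A + real n)"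
    using pos by (simp add: divide_simps) (simp add: algebra_simps)?
  then show "\<P>(\<omega> in M. X 1 \<omega> = 1 \<and> draw_count X n \<omega> = j \<and> X (Suc n) \<omega> = 1)
        = (b / A + real j) / (b / A + r / A + real n) * \<P>(\<omega> in M. X 1 \<omega> = 1 \<and> draw_count X n \<omega> = j)"
    using next_up_prob[OF n, of 1 j] by simp
qed (use pos X_rv X_01 in auto)

lemma (in polya_telegraph) sum_zeros:
  "\<omega> \<in> space M \<Longrightarrow> draw_count (\<lambda>n \<omega>. 1 - X n \<omega>) n \<omega> = n - draw_count X n \<omega> \<and> draw_count X n \<omega> \<le> n"
proof (induction n)
  case (Suc n)
  then show ?case using X_01[of "Suc n" \<omega>] by auto
qed simp

lemma (in polya_telegraph) urn_zeros: "polya_urn (\<lambda>n \<omega>. 1 - X n \<omega>) (r / A) (b / A)"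
  unfolding polya_urn_def
proof (intro conjI allI ballI impI)
  have "{\<omega>\<in>space M. 1 - X 1 \<omega> = 1} = space M - {\<omega>\<in>space M. X 1 \<omega> = 1}"
  proof (rule set_eqI)
    fix \<omega>
    show "\<omega> \<in> {\<omega>\<in>space M. 1 - X 1 \<omega> = 1} \<longleftrightarrow> \<omega> \<in> space M - {\<omega>\<in>space M. X 1 \<omega> = 1}"
      using X_01[of 1 \<omega>] by auto
  qed
  moreover have "{\<omega>\<in>space M. X 1 \<omega> = 1} \<in> events" using X_rv[of 1] by measurable
  ultimately have "\<P>(\<omega> in M. 1 - X 1 \<omega> = 1) = 1 - b / (b + r)"
    using X_first by (simp add: prob_compl)
  then show "\<P>(\<omega> in M. 1 - X 1 \<omega> = 1) = r / A / (r / A + b / A)"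
    using pos by (simp add: field_simps)
  fix n j :: nat assume n: "n \<ge> 1"
  have meas: "draw_count X m \<in> measurable M (count_space UNIV)"
       "X 1 \<in> measurable M (count_space UNIV)" "X (Suc m) \<in> measurable M (count_space UNIV)" for m
    unfolding draw_count_def[abs_def] by (intro measurable_sum_nat X_rv, auto)+
  show "\<P>(\<omega> in M. 1 - X 1 \<omega> = 1 \<and> draw_count (\<lambda>n \<omega>. 1 - X n \<omega>) n \<omega> = j \<and> 1 - X (Suc n) \<omega> = 1)
        = (r / A + real j) / (r / A + b / A + real n) * \<P>(\<omega> in M. 1 - X 1 \<omega> = 1 \<and> draw_count (\<lambda>n \<omega>. 1 - X n \<omega>) n \<omega> = j)"
  proof (cases "j \<le> n")
    case True
    let ?E = "{\<omega>\<in>space M. X 1 \<omega> = 0 \<and> draw_count X n \<omega> = n - j}"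
    have 1: "{\<omega>\<in>space M. 1 - X 1 \<omega> = 1 \<and> draw_count (\<lambda>n \<omega>. 1 - X n \<omega>) n \<omega> = j} = ?E"
    proof (rule set_eqI)
      fix \<omega>
      show "\<omega> \<in> {\<omega>\<in>space M. 1 - X 1 \<omega> = 1 \<and> draw_count (\<lambda>n \<omega>. 1 - X n \<omega>) n \<omega> = j} \<longleftrightarrow> \<omega> \<in> ?E"
        using X_01[of 1 \<omega>] sum_zeros[of \<omega> n] True by auto
    qed
    have 2: "{\<omega>\<in>space M. 1 - X 1 \<omega> = 1 \<and> draw_count (\<lambda>n \<omega>. 1 - X n \<omega>) n \<omega> = j \<and> 1 - X (Suc n) \<omega> = 1}
      = ?E - {\<omega>\<in>space M. X 1 \<omega> = 0 \<and> draw_count X n \<omega> = n - j \<and> X (Suc n) \<omega> = 1}"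
      (is "?L = ?R")
    proof (rule set_eqI)
      fix \<omega>
      show "\<omega> \<in> ?L \<longleftrightarrow> \<omega> \<in> ?R"
        using X_01[of 1 \<omega>] X_01[of "Suc n" \<omega>] sum_zeros[of \<omega> n] True by auto
    qed
    have 3: "prob \<dots> = prob ?E - (b + A * real (n - j)) / (b + r + A * real n) * prob ?E"
      unfolding next_up_prob[OF n, symmetric]
    proof (rule finite_measure_Diff)
      have p: "Measurable.pred M (\<lambda>\<omega>. X 1 \<omega> = i)" "Measurable.pred M (\<lambda>\<omega>. X (Suc m) \<omega> = i)"
        "Measurable.pred M (\<lambda>\<omega>. draw_count X m \<omega> = i)" for i m
        by (intro pred_count_space_const1 meas)+
      have "Measurable.pred M (\<lambda>\<omega>. X 1 \<omega> = 0 \<and> draw_count X n \<omega> = n - j)"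
        by (intro pred_intros_logic p)
      then show "?E \<in> events" by (simp add: pred_def)
      have "Measurable.pred M (\<lambda>\<omega>. X 1 \<omega> = 0 \<and> draw_count X n \<omega> = n - j \<and> X (Suc n) \<omega> = 1)"
        by (intro pred_intros_logic p)
      then show "{\<omega>\<in>space M. X 1 \<omega> = 0 \<and> draw_count X n \<omega> = n - j \<and> X (Suc n) \<omega> = 1} \<in> events"
        by (simp add: pred_def)
    qed auto
    have eq: "1 - (b + A * real (n - j)) / (b + r + A * real n) = (r / A + real j) / (r / A + b / A + real n)"
    proof -
      have "A * (r / A + real j) = r + A * real j" "A * (r / A + b / A + real n) = b + r + A * real n"
        using pos by (auto simp: algebra_simps)
      then have "(r / A + real j) / (r / A + b / A + real n) = (r + A * real j) / (b + r + A * real n)"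
        using pos by (metis mult_divide_mult_cancel_left less_irrefl)
      moreover have "b + r + A * real n > 0" using pos by (simp add: add_pos_nonneg)
      ultimately show ?thesis using True by (simp add: field_simps of_nat_diff)
    qed
    show ?thesis unfolding 2 3 1 eq[symmetric] by (simp only: left_diff_distrib mult_1_left)
  next
    case False
    then have "draw_count (\<lambda>n \<omega>. 1 - X n \<omega>) n \<omega> \<noteq> j" if "\<omega> \<in> space M" for \<omega>
      using sum_zeros[OF that, of n] by linarith
    then have "{\<omega>\<in>space M. 1 - X 1 \<omega> = 1 \<and> draw_count (\<lambda>n \<omega>. 1 - X n \<omega>) n \<omega> = j \<and> 1 - X (Suc n) \<omega> = 1} = {}"
       "{\<omega>\<in>space M. 1 - X 1 \<omega> = 1 \<and> draw_count (\<lambda>n \<omega>. 1 - X n \<omega>) n \<omega> = j} = {}"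
      by auto
    then show ?thesis by (simp only: measure_empty)
  qed
next
  show "(\<lambda>\<omega>. 1 - X n \<omega>) \<in> measurable M (count_space UNIV)" if "n \<ge> 1" for n
    using measurable_compose[OF X_rv[OF that], of "\<lambda>k. 1 - k" "count_space UNIV"] by simp
  show "1 - X n \<omega> \<in> {0, 1}" if "n \<ge> 1" "\<omega> \<in> space M" for n \<omega>
    using X_01[OF that] by auto
qed (use pos in auto)

section \<open>Sums of durations\<close>

definition partial_sum :: "(nat \<Rightarrow> 'a \<Rightarrow> real) \<Rightarrow> nat \<Rightarrow> 'a \<Rightarrow> real" where
  "partial_sum V n \<omega> = (\<Sum>k=1..n. V k \<omega>)"

lemma partial_sum_0 [simp]: "partial_sum V 0 \<omega> = 0"
  and partial_sum_Suc [simp]: "partial_sum V (Suc n) \<omega> = partial_sum V n \<omega> + V (Suc n) \<omega>"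
  by (simp_all add: partial_sum_def)

lemma partial_sum_mono:
  assumes "\<And>k. k \<ge> 1 \<Longrightarrow> 0 \<le> V k \<omega>" "m \<le> n"
  shows "partial_sum V m \<omega> \<le> partial_sum V n \<omega>"
  using assms(2) by (induction rule: dec_induct) (use assms(1)[of "Suc _"] in \<open>auto intro: order_trans\<close>)

lemma (in prob_space) AE_neq_distributed:
  assumes "distributed M lborel V (\<lambda>x. ennreal (f x))"
  shows "AE \<omega> in M. V \<omega> \<noteq> s"
proof (rule AE_distrD[where f = V and P = "\<lambda>x. x \<noteq> s"])
  show "V \<in> measurable M lborel" by (rule distributed_measurable[OF assms])
  show "AE x in distr M lborel V. x \<noteq> s"
    unfolding distributed_distr_eq_density[OF assms]
    by (subst AE_density[OF distributed_borel_measurable[OF assms]])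
       (use AE_lborel_singleton[of s] in \<open>auto elim: eventually_mono\<close>)
qed

lemma (in prob_space) AE_pos_gamma:
  assumes "distributed M lborel V (gamma_density \<alpha> l)"
  shows "AE \<omega> in M. 0 < V \<omega>"
proof (rule AE_distrD[where f = V and P = "\<lambda>x. 0 < x"])
  show "V \<in> measurable M lborel" by (rule distributed_measurable[OF assms])
  show "AE x in distr M lborel V. 0 < x"
    unfolding distributed_distr_eq_density[OF assms]
    by (subst AE_density[OF distributed_borel_measurable[OF assms]])
       (auto simp: gamma_density_def)
qed

text \<open>
  The properties of the up durations (or of the down durations) that determine their count
  probabilities. The parameter \<open>\<beta>\<close> is one less than the shape of the first duration.
\<close>
definition (in prob_space) renewal :: "(nat \<Rightarrow> 'a \<Rightarrow> real) \<Rightarrow> real \<Rightarrow> real \<Rightarrow> bool" where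
  "renewal V \<beta> l \<longleftrightarrow> 0 < \<beta> \<and> 0 < l \<and> (\<forall>k\<ge>1. \<forall>\<omega>\<in>space M. 0 \<le> V k \<omega>) \<and>
     (\<forall>n\<ge>1. distributed M lborel (partial_sum V n) (gamma_density (\<beta> + real n) l)) \<and>
     (\<forall>k\<ge>1. V k \<in> borel_measurable M)"

text \<open>
  The map \<open>e\<close> picks one of the two sequences out of the joint family of durations.
\<close>
lemma (in prob_space) renewalI:
  fixes V :: "'i \<Rightarrow> 'a \<Rightarrow> real" and e :: "nat \<Rightarrow> 'i"
  assumes indep: "indep_vars (\<lambda>_. borel) V (e ` {1..})" and e: "inj e"
    and pos: "0 < \<beta>" "0 < l"
    and nonneg: "\<And>k \<omega>. k \<ge> 1 \<Longrightarrow> \<omega> \<in> space M \<Longrightarrow> 0 \<le> V (e k) \<omega>"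
    and first: "distributed M lborel (V (e 1)) (gamma_density (\<beta> + 1) l)"
    and others: "\<And>k. k \<ge> 2 \<Longrightarrow> distributed M lborel (V (e k)) (exponential_density l)"
  shows "renewal (\<lambda>k. V (e k)) \<beta> l"
proof -
  have sum: "distributed M lborel (partial_sum (\<lambda>k. V (e k)) (Suc n)) (gamma_density (\<beta> + real (Suc n)) l)" for n
  proof (induction n)
    case 0
    have "partial_sum (\<lambda>k. V (e k)) (Suc 0) = V (e 1)" by (simp add: fun_eq_iff)
    then show ?case using first by simp
  next
    case (Suc n)
    have eq: "(\<Sum>i\<in>e ` {1..Suc n}. V i \<omega>) = partial_sum (\<lambda>k. V (e k)) (Suc n) \<omega>" for \<omega>
      unfolding partial_sum_def by (rule sum.reindex_cong[of e]) (auto intro: inj_on_subset[OF e])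
    have "indep_var borel (V (e (Suc (Suc n)))) borel (\<lambda>\<omega>. \<Sum>i\<in>e ` {1..Suc n}. V i \<omega>)"
      by (intro indep_vars_sum indep_vars_subset[OF indep]) (use e in \<open>auto simp: inj_eq\<close>)
    then have "indep_var borel (V (e (Suc (Suc n)))) borel (partial_sum (\<lambda>k. V (e k)) (Suc n))"
      unfolding eq[abs_def] .
    from distributed_convolution[OF this others Suc.IH]
    have "distributed M lborel (\<lambda>\<omega>. V (e (Suc (Suc n))) \<omega> + partial_sum (\<lambda>k. V (e k)) (Suc n) \<omega>)
       (\<lambda>x. \<integral>\<^sup>+y. ennreal (exponential_density l (x - y)) * ennreal (gamma_density (\<beta> + real (Suc n)) l y) \<partial>lborel)"
      by simp
    moreover have "(\<lambda>\<omega>. V (e (Suc (Suc n))) \<omega> + partial_sum (\<lambda>k. V (e k)) (Suc n) \<omega>) = partial_sum (\<lambda>k. V (e k)) (Suc (Suc n))"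
      by (simp add: fun_eq_iff)
    moreover have r: "\<beta> + real (Suc (Suc n)) = \<beta> + real (Suc n) + 1" by simp
    have "0 < \<beta> + real (Suc n)" using pos by simp
    note gamma_convolution[OF pos(2) this]
    ultimately show ?case unfolding r by (simp only:)
  qed
  have "distributed M lborel (partial_sum (\<lambda>k. V (e k)) n) (gamma_density (\<beta> + real n) l)" if "n \<ge> 1" for n
    using sum[of "n - 1"] that by simp
  moreover have "V (e k) \<in> borel_measurable M" if "k \<ge> 1" for k
    using indep that unfolding indep_vars_def by auto
  ultimately show ?thesis using pos nonneg by (auto simp: renewal_def)
qed

context prob_space
begin

context
  fixes V :: "nat \<Rightarrow> 'a \<Rightarrow> real" and \<beta> l :: real
  assumes ren: "renewal V \<beta> l"
begin

lemma renewal_nonneg: "k \<ge> 1 \<Longrightarrow> \<omega> \<in> space M \<Longrightarrow> 0 \<le> V k \<omega>"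
  and renewal_pos: "0 < \<beta>" "0 < l"
  and renewal_sum: "n \<ge> 1 \<Longrightarrow> distributed M lborel (partial_sum V n) (gamma_density (\<beta> + real n) l)"
  using ren by (auto simp: renewal_def)

lemma renewal_sum_measurable: "partial_sum V n \<in> borel_measurable M"
  unfolding partial_sum_def[abs_def] by (intro borel_measurable_sum) (use ren in \<open>auto simp: renewal_def\<close>)

lemma renewal_cdf:
  assumes "0 < x" shows "\<P>(\<omega> in M. partial_sum V n \<omega> \<le> x) = arrival_cdf \<beta> l n x"
  using prob_le_gamma[OF renewal_sum[of n], of x] assms
  by (cases "n = 0") (auto simp: arrival_cdf_def prob_space)

lemma renewal_count:
  assumes "0 < x"
  shows "\<P>(\<omega> in M. partial_sum V n \<omega> \<le> x \<and> x < partial_sum V (Suc n) \<omega>) = count_pmf \<beta> l n x"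
proof -
  have sets: "{\<omega>\<in>space M. partial_sum V n \<omega> \<le> x} \<in> events" for n
    using measurable_sets[OF renewal_sum_measurable, of "{..x}" n] by (simp add: vimage_def Int_def conj_commute)
  have "{\<omega>\<in>space M. partial_sum V n \<omega> \<le> x \<and> x < partial_sum V (Suc n) \<omega>}
     = {\<omega>\<in>space M. partial_sum V n \<omega> \<le> x} - {\<omega>\<in>space M. partial_sum V (Suc n) \<omega> \<le> x}"
    by auto
  also have "prob \<dots> = prob {\<omega>\<in>space M. partial_sum V n \<omega> \<le> x} - prob {\<omega>\<in>space M. partial_sum V (Suc n) \<omega> \<le> x}"
  proof (rule finite_measure_Diff[OF sets sets])
    show "{\<omega>\<in>space M. partial_sum V (Suc n) \<omega> \<le> x} \<subseteq> {\<omega>\<in>space M. partial_sum V n \<omega> \<le> x}"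
    proof safe
      fix \<omega> assume "\<omega> \<in> space M" "partial_sum V (Suc n) \<omega> \<le> x"
      then show "partial_sum V n \<omega> \<le> x" using renewal_nonneg[of "Suc n" \<omega>] by simp
    qed
  qed
  finally show ?thesis unfolding renewal_cdf[OF assms] count_pmf_def .
qed

lemma renewal_neq: "n \<ge> 1 \<Longrightarrow> AE \<omega> in M. partial_sum V n \<omega> \<noteq> s"
  by (rule AE_neq_distributed[OF renewal_sum])

lemma renewal_first_pos: "AE \<omega> in M. 0 < V 1 \<omega>"
proof -
  have "partial_sum V 1 = V 1" by (simp add: partial_sum_def fun_eq_iff)
  then show ?thesis using AE_pos_gamma[OF renewal_sum[of 1]] by simp
qed

text \<open>
  The event that all partial sums stay below \<open>x\<close> is contained in the event that the \<open>n\<close>-th one does,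
  whose probability tends to \<open>0\<close>.
\<close>
lemma renewal_unbounded:
  assumes x: "0 < x" shows "AE \<omega> in M. \<exists>n. x < partial_sum V n \<omega>"
proof -
  have sets: "{\<omega>\<in>space M. partial_sum V n \<omega> \<le> x} \<in> events" for n
    using measurable_sets[OF renewal_sum_measurable, of "{..x}" n] by (simp add: vimage_def Int_def conj_commute)
  define N where "N = (\<Inter>n. {\<omega>\<in>space M. partial_sum V n \<omega> \<le> x})"
  have N: "N \<in> events" unfolding N_def using sets by auto
  have "prob N \<le> x * l * ((l * x) powr (\<beta> + real n) / Gamma (\<beta> + real n + 1))" for n
  proof -
    have "prob N \<le> prob {\<omega>\<in>space M. partial_sum V (Suc n) \<omega> \<le> x}"
      by (rule finite_measure_mono) (use sets in \<open>auto simp: N_def simp del: partial_sum_Suc\<close>)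
    also have "\<dots> = gamma_cdf (\<beta> + real n + 1) l x"
      using renewal_cdf[OF x, of "Suc n"] by (simp add: arrival_cdf_def add_ac)
    also have "\<dots> \<le> x * (l * (l * x) powr (\<beta> + real n + 1 - 1) / Gamma (\<beta> + real n + 1))"
      using renewal_pos x by (intro gamma_cdf_le) auto
    finally show ?thesis by (simp add: mult_ac)
  qed
  moreover have "(\<lambda>n. x * l * ((l * x) powr (\<beta> + real n) / Gamma (\<beta> + real n + 1))) \<longlonglongrightarrow> 0"
    using renewal_pos x by (intro tendsto_mult_right_zero summable_LIMSEQ_zero summable_gamma_bound) auto
  ultimately have "prob N \<le> 0" by (intro LIMSEQ_le_const) auto
  then have "prob N = 0" using measure_nonneg[of M N] by linarith
  then have "N \<in> null_sets M" using N by (simp add: emeasure_eq_measure null_sets_def)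
  then have "AE \<omega> in M. \<omega> \<notin> N" by (rule AE_not_in)
  with AE_space show ?thesis
    by eventually_elim (force simp: N_def not_le)
qed

end

lemma prob_partition:
  assumes "E \<in> events" "\<And>n::nat. Q n \<in> events" "disjoint_family Q" "AE \<omega> in M. \<exists>n. \<omega> \<in> Q n"
  shows "prob E = (\<Sum>n. prob (E \<inter> Q n))"
proof -
  have "prob E = prob (\<Union>n. E \<inter> Q n)"
    by (rule finite_measure_eq_AE) (use assms in \<open>auto elim: eventually_mono\<close>)
  also have "\<dots> = (\<Sum>n. prob (E \<inter> Q n))"
    by (rule sums_unique, rule finite_measure_UNION)
       (use assms in \<open>auto intro: disjoint_family_on_bisimulation[of Q] simp: disjoint_family_on_def\<close>)
  finally show ?thesis .
qed

end

section \<open>The path of the particle\<close>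

text \<open>
  The left side is the time before \<open>t\<close> spent in the intervals selected by \<open>P\<close>. Intervals that begin
  after \<open>t\<close> do not contribute, the others contribute at most their length.
\<close>
lemma clipped_sum_le:
  fixes T :: "nat \<Rightarrow> real"
  assumes "mono T" "m \<le> n" "t \<le> T m"
  shows "(\<Sum>i<n. if P i then min t (T (Suc i)) - min t (T i) else 0) \<le> (\<Sum>i<m. if P i then T (Suc i) - T i else 0)"
proof -
  have "(\<Sum>i<n. if P i then min t (T (Suc i)) - min t (T i) else 0)
     = (\<Sum>i<m. if P i then min t (T (Suc i)) - min t (T i) else 0)"
  proof (rule sum.mono_neutral_right)
    show "\<forall>i\<in>{..<n} - {..<m}. (if P i then min t (T (Suc i)) - min t (T i) else 0) = 0"
    proof
      fix i assume "i \<in> {..<n} - {..<m}"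
      then have "T m \<le> T i" "T m \<le> T (Suc i)" using assms(1) by (auto intro: monoD)
      then show "(if P i then min t (T (Suc i)) - min t (T i) else 0) = 0" using assms(3) by (auto simp: min_def)
    qed
  qed (use assms in auto)
  also have "\<dots> \<le> (\<Sum>i<m. if P i then T (Suc i) - T i else 0)"
  proof (rule sum_mono)
    fix i
    have "T i \<le> T (Suc i)" by (rule monoD[OF assms(1)]) simp
    then show "(if P i then min t (T (Suc i)) - min t (T i) else 0) \<le> (if P i then T (Suc i) - T i else 0)"
      by (auto simp: min_def)
  qed
  finally show ?thesis .
qed

text \<open>
  Here the first \<open>m\<close> intervals are over at time \<open>t\<close> and contribute their full length.
\<close>
lemma clipped_sum_ge:
  fixes T :: "nat \<Rightarrow> real"
  assumes "mono T" "m \<le> n" "T m \<le> t"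
  shows "(\<Sum>i<m. if P i then T (Suc i) - T i else 0) \<le> (\<Sum>i<n. if P i then min t (T (Suc i)) - min t (T i) else 0)"
proof -
  have "(\<Sum>i<m. if P i then T (Suc i) - T i else 0) = (\<Sum>i<m. if P i then min t (T (Suc i)) - min t (T i) else 0)"
  proof (rule sum.cong[OF refl])
    fix i assume "i \<in> {..<m}"
    then have "T i \<le> T m" "T (Suc i) \<le> T m" using assms(1) by (auto intro: monoD)
    then show "(if P i then T (Suc i) - T i else 0) = (if P i then min t (T (Suc i)) - min t (T i) else 0)"
      using assms(3) by (auto simp: min_def)
  qed
  also have "\<dots> \<le> (\<Sum>i<n. if P i then min t (T (Suc i)) - min t (T i) else 0)"
  proof (rule sum_mono2)
    fix i
    have "T i \<le> T (Suc i)" by (rule monoD[OF assms(1)]) simp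
    then show "0 \<le> (if P i then min t (T (Suc i)) - min t (T i) else 0)"
      by (auto simp: min_def)
  qed (use assms(2) in auto)
  finally show ?thesis .
qed

lemma set_integral_step_function:
  fixes T :: "nat \<Rightarrow> real" and z :: "nat \<Rightarrow> real" and f :: "real \<Rightarrow> real"
  assumes T: "mono T" "T 0 = 0" "t < T n" and t: "0 \<le> t"
    and f: "\<And>i s. T i \<le> s \<Longrightarrow> s < T (Suc i) \<Longrightarrow> f s = z i"
  shows "(LINT s:{0..t}|lborel. f s) = (\<Sum>i<n. z i * (min t (T (Suc i)) - min t (T i)))"
proof -
  have step: "indicator {0..t} s * f s = (\<Sum>i<n. z i * indicator ({0..t} \<inter> {T i..<T (Suc i)}) s)" for s
  proof (cases "s \<in> {0..t}")
    case True
    \<comment> \<open>The interval that contains s.\<close>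
    define j where "j = (LEAST j. s < T (Suc j))"
    have n: "n > 0" using T t by (cases n) auto
    have ex: "s < T (Suc (n - 1))" using True T n by simp
    have j1: "s < T (Suc j)" unfolding j_def by (rule LeastI[of _ "n - 1"]) (rule ex)
    have jn: "j \<le> n - 1" unfolding j_def by (rule Least_le) (rule ex)
    have j2: "T j \<le> s"
    proof (cases j)
      case 0 then show ?thesis using True T by simp
    next
      case (Suc k)
      then show ?thesis using not_less_Least[of k "\<lambda>j. s < T (Suc j)"] by (auto simp: j_def not_less)
    qed
    have uniq: "i = j" if "T i \<le> s" "s < T (Suc i)" for i
    proof (rule ccontr)
      assume "i \<noteq> j"
      then consider "Suc i \<le> j" | "Suc j \<le> i" by linarith
      then show False
        using that j1 j2 monoD[OF T(1), of "Suc i" j] monoD[OF T(1), of "Suc j" i] by cases auto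
    qed
    have "(\<Sum>i<n. z i * indicator ({0..t} \<inter> {T i..<T (Suc i)}) s) = (\<Sum>i<n. if i = j then z j else 0)"
    proof (rule sum.cong[OF refl])
      fix i
      show "z i * indicator ({0..t} \<inter> {T i..<T (Suc i)}) s = (if i = j then z j else 0)"
        using True uniq[of i] j1 j2 by (cases "i = j") (auto simp: indicator_def)
    qed
    also have "\<dots> = z j" using jn n by simp
    also have "z j = f s" using f[OF j2 j1] by simp
    finally show ?thesis using True by simp
  next
    case False
    then have "indicator ({0..t} \<inter> {T i..<T (Suc i)}) s = (0 :: real)" for i by (auto simp: indicator_def)
    with False show ?thesis by simp
  qed
  have len: "measure lborel ({0..t} \<inter> {T i..<T (Suc i)}) = min t (T (Suc i)) - min t (T i)" 
    and fin: "emeasure lborel ({0..t} \<inter> {T i..<T (Suc i)}) < \<infinity>" for i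
  proof -
    have i: "0 \<le> T i" "T i \<le> T (Suc i)" using monoD[OF T(1), of 0 i] monoD[OF T(1), of i "Suc i"] T(2) by auto
    consider "t < T i" | "T i \<le> t" "t < T (Suc i)" | "T (Suc i) \<le> t" by linarith
    then have "measure lborel ({0..t} \<inter> {T i..<T (Suc i)}) = min t (T (Suc i)) - min t (T i) \<and>
      emeasure lborel ({0..t} \<inter> {T i..<T (Suc i)}) < \<infinity>"
    proof cases
      case 1
      then have e: "{0..t} \<inter> {T i..<T (Suc i)} = {}" by auto
      show ?thesis unfolding e using 1 i by (simp add: min_def)
    next
      case 2
      then have e: "{0..t} \<inter> {T i..<T (Suc i)} = {T i..t}" using i by auto
      show ?thesis unfolding e using 2 i by (simp add: min_def)
    next
      case 3
      then have e: "{0..t} \<inter> {T i..<T (Suc i)} = {T i..<T (Suc i)}" using i by auto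
      show ?thesis unfolding e using 3 i by (simp add: min_def)
    qed
    then show "measure lborel ({0..t} \<inter> {T i..<T (Suc i)}) = min t (T (Suc i)) - min t (T i)"
      "emeasure lborel ({0..t} \<inter> {T i..<T (Suc i)}) < \<infinity>" by auto
  qed
  have "(LINT s:{0..t}|lborel. f s) = (\<integral>s. (\<Sum>i<n. z i * indicator ({0..t} \<inter> {T i..<T (Suc i)}) s) \<partial>lborel)"
    unfolding set_lebesgue_integral_def real_scaleR_def step ..
  also have "\<dots> = (\<Sum>i<n. \<integral>s. z i * indicator ({0..t} \<inter> {T i..<T (Suc i)}) s \<partial>lborel)"
    by (rule Bochner_Integration.integral_sum) (use fin in \<open>auto intro!: integrable_mult_right integrable_real_indicator\<close>)
  also have "\<dots> = (\<Sum>i<n. z i * measure lborel ({0..t} \<inter> {T i..<T (Suc i)}))"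
    by (intro sum.cong refl) simp
  finally show ?thesis unfolding len .
qed

context polya_telegraph
begin

lemma X_cases: "\<omega> \<in> space M \<Longrightarrow> X (Suc n) \<omega> = 0 \<or> X (Suc n) \<omega> = 1"
  using X_01[of "Suc n" \<omega>] by simp

lemma draw_count_le: "\<omega> \<in> space M \<Longrightarrow> draw_count X n \<omega> \<le> n"
  using sum_zeros by blast

lemma ups_eq: "ups X n \<omega> = draw_count X (Suc n) \<omega>"
  by (simp add: ups_def draw_count_def)

lemma epoch_Suc_up:
  "X (Suc n) \<omega> = 1 \<Longrightarrow> epoch X U D (Suc n) \<omega> = epoch X U D n \<omega> + U (Suc (draw_count X n \<omega>)) \<omega>"
  by (simp add: ups_eq)

lemma epoch_Suc_down:
  assumes "\<omega> \<in> space M" "X (Suc n) \<omega> = 0"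
  shows "epoch X U D (Suc n) \<omega> = epoch X U D n \<omega> + D (Suc (n - draw_count X n \<omega>)) \<omega>"
  using assms draw_count_le[of \<omega> n] by (simp add: ups_eq Suc_diff_le)

lemma epoch_eq:
  assumes "\<omega> \<in> space M"
  shows "epoch X U D n \<omega> = partial_sum U (draw_count X n \<omega>) \<omega> + partial_sum D (n - draw_count X n \<omega>) \<omega>"
proof (induction n)
  case (Suc n)
  show ?case
    using X_cases[OF assms, of n]
  proof
    assume "X (Suc n) \<omega> = 0"
    then show ?thesis
      using epoch_Suc_down[OF assms] Suc draw_count_le[OF assms, of n] by (simp add: Suc_diff_le del: epoch.simps)
  next
    assume "X (Suc n) \<omega> = 1"
    then show ?thesis
      using epoch_Suc_up[of n \<omega>] Suc by (simp del: epoch.simps)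
  qed
qed simp

lemma up_time_eq:
  assumes "\<omega> \<in> space M"
  shows "(\<Sum>i<n. if X (Suc i) \<omega> = 1 then epoch X U D (Suc i) \<omega> - epoch X U D i \<omega> else 0)
    = partial_sum U (draw_count X n \<omega>) \<omega>"
proof (induction n)
  case (Suc n)
  then show ?case
    using X_cases[OF assms, of n] epoch_Suc_up[of n \<omega>] by (auto simp del: epoch.simps)
qed simp

lemma down_time_eq:
  assumes "\<omega> \<in> space M"
  shows "(\<Sum>i<n. if X (Suc i) \<omega> \<noteq> 1 then epoch X U D (Suc i) \<omega> - epoch X U D i \<omega> else 0)
    = partial_sum D (n - draw_count X n \<omega>) \<omega>"
proof (induction n)
  case (Suc n)
  then show ?case
    using X_cases[OF assms, of n] epoch_Suc_down[OF assms, of n] draw_count_le[OF assms, of n]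
    by (auto simp: Suc_diff_le simp del: epoch.simps)
qed simp

lemma epoch_mono:
  assumes "\<omega> \<in> space M" shows "mono (\<lambda>n. epoch X U D n \<omega>)"
proof (rule incseq_SucI)
  fix n
  show "epoch X U D n \<omega> \<le> epoch X U D (Suc n) \<omega>"
    using X_cases[OF assms, of n] epoch_Suc_up[of n \<omega>] epoch_Suc_down[OF assms, of n]
      durations_nonneg[OF _ assms, of "Suc (draw_count X n \<omega>)"] durations_nonneg[OF _ assms, of "Suc (n - draw_count X n \<omega>)"]
    by (auto simp del: epoch.simps)
qed

lemma epoch_count_eq:
  assumes "\<omega> \<in> space M" "epoch X U D i \<omega> \<le> s" "s < epoch X U D (Suc i) \<omega>"
  shows "epoch_count X U D s \<omega> = i"
proof (cases "i = 0")
  case True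
  then have "epoch X U D 1 \<omega> > s" using assms(3) unfolding One_nat_def by blast
  then show ?thesis using True unfolding epoch_count_def by (simp only: if_True)
next
  case False
  note mono = monoD[OF epoch_mono[OF assms(1)]]
  have "epoch X U D 1 \<omega> \<le> s" using mono[of 1 i] False assms(2) by linarith
  moreover have "{j. j \<ge> 1 \<and> epoch X U D j \<omega> \<le> s} = {1..i}"
  proof safe
    fix j assume j: "1 \<le> j" "epoch X U D j \<omega> \<le> s"
    then have "\<not> Suc i \<le> j" using mono[of "Suc i" j] assms(3) by linarith
    then show "j \<in> {1..i}" using j by simp
  next
    fix j assume j: "j \<in> {1..i}"
    then show "1 \<le> j" by simp
    show "epoch X U D j \<omega> \<le> s" using mono[of j i] j assms(2) by simp
  qed
  moreover have "Max {1..i} = i" by (rule Max_eqI) (use False in auto)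
  ultimately show ?thesis by (simp add: epoch_count_def del: epoch.simps)
qed

lemma position_eq:
  assumes "\<omega> \<in> space M" "0 \<le> t" "t < epoch X U D n \<omega>"
  shows "position c v X U D t \<omega> = (\<Sum>i<n. step_velocity c v X i \<omega> *
     (min t (epoch X U D (Suc i) \<omega>) - min t (epoch X U D i \<omega>)))"
  unfolding position_def
  by (rule set_integral_step_function[OF epoch_mono[OF assms(1)] _ assms(3,2)])
     (use epoch_count_eq[OF assms(1)] in \<open>auto simp: velocity_def simp del: epoch.simps(2)\<close>)

text \<open>
  The position at time \<open>t\<close> is \<open>(c + v) * W - v * t\<close> where \<open>W\<close> is the time spent upwards, so the question
  is whether \<open>W \<le> \<tau>\<close>. Look at the particle after \<open>N + K + 1\<close> steps. If at most \<open>N\<close> of them were up, the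
  up time so far is at most \<open>\<tau>\<close> and at least \<open>K + 1\<close> steps were down, so that the down time exceeds
  \<open>t - \<tau>\<close>. Both times only grow, so either inequality decides that \<open>W \<le> \<tau>\<close>, according to whether \<open>t\<close>
  is before or after this moment. The other case is the mirror image, except that the down time must
  not be exactly \<open>t - \<tau>\<close>.
\<close>
lemma position_le_iff:
  assumes \<omega>: "\<omega> \<in> space M" and \<tau>: "0 < \<tau>" "\<tau> < t"
    and N: "partial_sum U N \<omega> \<le> \<tau>" "\<tau> < partial_sum U (Suc N) \<omega>"
    and K: "partial_sum D K \<omega> \<le> t - \<tau>" "t - \<tau> < partial_sum D (Suc K) \<omega>"
    and neq: "\<And>m. m \<ge> 1 \<Longrightarrow> partial_sum D m \<omega> \<noteq> t - \<tau>"
    and unb: "\<exists>n. t < partial_sum U n \<omega>" "\<exists>n. t < partial_sum D n \<omega>"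
  shows "position c v X U D t \<omega> \<le> (c + v) * \<tau> - v * t \<longleftrightarrow> draw_count X (Suc (N + K)) \<omega> \<le> N"
proof -
  let ?T = "\<lambda>n. epoch X U D n \<omega>"
  note mono = epoch_mono[OF \<omega>]
  have Upos: "partial_sum U m \<omega> \<le> partial_sum U n \<omega>" "partial_sum D m \<omega> \<le> partial_sum D n \<omega>" if "m \<le> n" for m n
    using durations_nonneg[OF _ \<omega>] that by (auto intro: partial_sum_mono)
  have U0: "0 \<le> partial_sum U n \<omega>" "0 \<le> partial_sum D n \<omega>" for n
    using Upos[of 0 n] by auto
  obtain J where J: "t < partial_sum U J \<omega>" using unb by blast
  obtain L where L: "t < partial_sum D L \<omega>" using unb by blast
  \<comment> \<open>Among J + L steps there are at least J up steps or more than L down steps, so time t is over.\<close>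
  define m where "m = Suc (N + K)"
  define n where "n = max m (J + L)"
  have mn: "m \<le> n" by (simp add: n_def)
  have "t < ?T (J + L)"
  proof (cases "J \<le> draw_count X (J + L) \<omega>")
    case True
    then show ?thesis
      using J Upos(1)[OF True] U0(2)[of "J + L - draw_count X (J + L) \<omega>"] unfolding epoch_eq[OF \<omega>] by linarith
  next
    case False
    then have "L \<le> J + L - draw_count X (J + L) \<omega>" by simp
    from Upos(2)[OF this] show ?thesis
      using L U0(1)[of "draw_count X (J + L) \<omega>"] unfolding epoch_eq[OF \<omega>] by linarith
  qed
  also have "\<dots> \<le> ?T n" by (rule monoD[OF mono]) (simp add: n_def)
  finally have Tn: "t < ?T n" .
  define W where "W = (\<Sum>i<n. if X (Suc i) \<omega> = 1 then min t (?T (Suc i)) - min t (?T i) else 0)"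
  define W' where "W' = (\<Sum>i<n. if X (Suc i) \<omega> \<noteq> 1 then min t (?T (Suc i)) - min t (?T i) else 0)"
  have "W + W' = (\<Sum>i<n. min t (?T (Suc i)) - min t (?T i))"
    unfolding W_def W'_def sum.distrib[symmetric] by (intro sum.cong) auto
  also have "\<dots> = min t (?T n) - min t (?T 0)"
    by (rule sum_lessThan_telescope)
  finally have WW: "W + W' = t" using Tn \<tau> by simp
  have "position c v X U D t \<omega> = (\<Sum>i<n. step_velocity c v X i \<omega> * (min t (?T (Suc i)) - min t (?T i)))"
    using \<tau> by (intro position_eq[OF \<omega> _ Tn]) simp
  also have "\<dots> = c * W - v * W'"
    unfolding W_def W'_def sum_distrib_left sum_subtractf[symmetric]
    by (intro sum.cong) (auto simp: step_velocity_def)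
  also have "\<dots> = (c + v) * W - v * t" unfolding WW[symmetric] by (simp add: algebra_simps)
  finally have pos_le: "position c v X U D t \<omega> \<le> (c + v) * \<tau> - v * t \<longleftrightarrow> W \<le> \<tau>"
    using pos by simp
  define j where "j = draw_count X m \<omega>"
  have jm: "j \<le> m" using draw_count_le[OF \<omega>] by (simp add: j_def)
  have Tm: "?T m = partial_sum U j \<omega> + partial_sum D (m - j) \<omega>"
    unfolding j_def by (rule epoch_eq[OF \<omega>])
  have le: "W \<le> partial_sum U j \<omega>" "W' \<le> partial_sum D (m - j) \<omega>" if "t \<le> ?T m"
    using clipped_sum_le[OF mono mn that, of "\<lambda>i. X (Suc i) \<omega> = 1"]
      clipped_sum_le[OF mono mn that, of "\<lambda>i. X (Suc i) \<omega> \<noteq> 1"]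
    unfolding up_time_eq[OF \<omega>] down_time_eq[OF \<omega>] by (simp_all only: W_def W'_def j_def)
  have ge: "partial_sum U j \<omega> \<le> W" "partial_sum D (m - j) \<omega> \<le> W'" if "?T m \<le> t"
    using clipped_sum_ge[OF mono mn that, of "\<lambda>i. X (Suc i) \<omega> = 1"]
      clipped_sum_ge[OF mono mn that, of "\<lambda>i. X (Suc i) \<omega> \<noteq> 1"]
    unfolding up_time_eq[OF \<omega>] down_time_eq[OF \<omega>] by (simp_all only: W_def W'_def j_def)
  have "W \<le> \<tau> \<longleftrightarrow> j \<le> N"
  proof (cases "j \<le> N")
    case True
    then have "Suc K \<le> m - j" by (simp add: m_def)
    then have "partial_sum U j \<omega> \<le> \<tau>" "t - \<tau> < partial_sum D (m - j) \<omega>"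
      using Upos(1)[OF True] Upos(2)[of "Suc K" "m - j"] N K by linarith+
    then have "W \<le> \<tau>" using le ge WW by linarith
    then show ?thesis using True by simp
  next
    case False
    then have 1: "Suc N \<le> j" "m - j \<le> K" by (auto simp: m_def)
    have 2: "partial_sum D (m - j) \<omega> < t - \<tau>"
    proof (cases "m - j = 0")
      case True
      then show ?thesis using \<tau> by simp
    next
      case False
      then have "partial_sum D (m - j) \<omega> \<noteq> t - \<tau>" by (intro neq) simp
      then show ?thesis using Upos(2)[OF 1(2)] K(1) by linarith
    qed
    have "\<tau> < partial_sum U j \<omega>" using Upos(1)[OF 1(1)] N(2) by linarith
    then have "\<not> W \<le> \<tau>" using 2 le ge WW by linarith
    then show ?thesis using False by simp
  qed
  then show ?thesis using pos_le by (simp add: j_def m_def)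
qed

lemma U_measurable: "k \<ge> 1 \<Longrightarrow> U k \<in> borel_measurable M"
  and D_measurable: "k \<ge> 1 \<Longrightarrow> D k \<in> borel_measurable M"
proof -
  have rv: "case_sum U D i \<in> borel_measurable M" if "i \<in> {1..} <+> {1..}" for i
    using durations_indep that unfolding indep_vars_def by auto
  show "U k \<in> borel_measurable M" if "k \<ge> 1" using rv[of "Inl k"] that by auto
  show "D k \<in> borel_measurable M" if "k \<ge> 1" using rv[of "Inr k"] that by auto
qed

lemma draw_count_measurable: "draw_count X n \<in> measurable M (count_space UNIV)"
  unfolding draw_count_def[abs_def] by (intro measurable_sum_nat X_rv) auto

lemma epoch_measurable: "epoch X U D n \<in> borel_measurable M"
proof -
  have 1: "partial_sum U k \<in> borel_measurable M" "partial_sum D k \<in> borel_measurable M" for k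
    unfolding partial_sum_def[abs_def] by (intro borel_measurable_sum; simp add: U_measurable D_measurable)+
  have 2: "(\<lambda>\<omega>. partial_sum U (draw_count X n \<omega>) \<omega>) \<in> borel_measurable M"
    by (rule measurable_compose_countable[OF 1(1) draw_count_measurable])
  have 3: "(\<lambda>\<omega>. n - draw_count X n \<omega>) \<in> measurable M (count_space UNIV)"
    using measurable_compose[OF draw_count_measurable, of "\<lambda>k. n - k" "count_space UNIV" n] by simp
  have 4: "(\<lambda>\<omega>. partial_sum D (n - draw_count X n \<omega>) \<omega>) \<in> borel_measurable M"
    by (rule measurable_compose_countable[OF 1(2) 3])
  show ?thesis
    using borel_measurable_add[OF 2 4] by (rule measurable_cong[THEN iffD1, rotated]) (simp add: epoch_eq)
qed

text \<open>
  This includes the paths with infinitely many epochs before \<open>s\<close>, since \<open>Max\<close> of an infinite set is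
  one fixed number.
\<close>
lemma velocity_joint_measurable:
  "(\<lambda>(\<omega>, s). velocity c v X U D s \<omega>) \<in> borel_measurable (M \<Otimes>\<^sub>M lborel)"
proof -
  let ?P = "M \<Otimes>\<^sub>M (lborel :: real measure)"
  have e: "(\<lambda>p. epoch X U D i (fst p)) \<in> borel_measurable ?P" for i
    by (rule measurable_compose[OF measurable_fst epoch_measurable])
  have s: "(\<lambda>p. snd p) \<in> borel_measurable ?P"
    using measurable_snd[of M "lborel :: real measure"] by simp
  have le: "Measurable.pred ?P (\<lambda>p. i \<ge> 1 \<and> epoch X U D i (fst p) \<le> snd p)" for i
  proof (cases "i \<ge> 1")
    case True
    then show ?thesis using borel_measurable_le[OF e[of i] s] by (simp only: pred_def simp_thms)
  next
    case False
    then show ?thesis by (simp only: pred_def simp_thms) simp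
  qed
  have M: "(\<lambda>p. Max {i. i \<ge> 1 \<and> epoch X U D i (fst p) \<le> snd p}) \<in> measurable ?P (count_space UNIV)"
    by (rule measurable_Max_nat[OF le])
  have c: "(\<lambda>p. epoch_count X U D (snd p) (fst p)) \<in> measurable ?P (count_space UNIV)"
    unfolding epoch_count_def
    by (rule measurable_If[OF _ M borel_measurable_less[OF s e]]) simp
  have sv: "(\<lambda>p. step_velocity c v X n (fst p)) \<in> borel_measurable ?P" for n
  proof -
    have "(\<lambda>\<omega>. step_velocity c v X n \<omega>) \<in> borel_measurable M"
      unfolding step_velocity_def
      using measurable_compose[OF X_rv[of "n + 1"], of "\<lambda>k. if k = 1 then c else - v" borel] by simp
    then show ?thesis by (rule measurable_compose[OF measurable_fst])
  qed
  show ?thesis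
    unfolding velocity_def case_prod_beta' by (rule measurable_compose_countable[OF sv c])
qed

lemma velocity_measurable: "velocity c v X U D s \<in> borel_measurable M"
  using measurable_compose[OF measurable_Pair2'[of s lborel M] velocity_joint_measurable] by simp

lemma position_measurable: "position c v X U D t \<in> borel_measurable M"
proof -
  have "(\<lambda>p. indicator {0..t} (snd p) *\<^sub>R (case p of (\<omega>, s) \<Rightarrow> velocity c v X U D s \<omega>)) \<in> borel_measurable (M \<Otimes>\<^sub>M lborel)"
  proof (rule borel_measurable_scaleR[OF _ velocity_joint_measurable])
    show "(\<lambda>p. indicator {0..t} (snd p) :: real) \<in> borel_measurable (M \<Otimes>\<^sub>M lborel)"
      by (rule measurable_compose[OF measurable_snd]) simp
  qed
  then have "(\<lambda>(\<omega>, s). indicator {0..t} s *\<^sub>R velocity c v X U D s \<omega>) \<in> borel_measurable (M \<Otimes>\<^sub>M lborel)"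
    by (simp only: case_prod_beta')
  then show ?thesis
    unfolding position_def[abs_def] set_lebesgue_integral_def
    by (intro lborel.borel_measurable_lebesgue_integral)
qed

end

section \<open>The crossing probabilities\<close>

context prob_space
begin

text \<open>
  Exactly \<open>n\<close> of the durations are completed at time \<open>x\<close>.
\<close>
definition window :: "(nat \<Rightarrow> 'a \<Rightarrow> real) \<Rightarrow> real \<Rightarrow> nat \<Rightarrow> 'a set" where
  "window V x n = {\<omega>\<in>space M. partial_sum V n \<omega> \<le> x \<and> x < partial_sum V (Suc n) \<omega>}"

lemma window_props:
  assumes ren: "renewal V \<beta> l" and x: "0 < x"
  shows "window V x n \<in> events" and "disjoint_family (window V x)"
    and "AE \<omega> in M. \<exists>n. \<omega> \<in> window V x n" and "prob (window V x n) = count_pmf \<beta> l n x"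
proof -
  have m: "partial_sum V k \<in> borel_measurable M" for k by (rule renewal_sum_measurable[OF ren])
  have "window V x n = {\<omega>\<in>space M. partial_sum V n \<omega> \<le> x} \<inter> {\<omega>\<in>space M. x < partial_sum V (Suc n) \<omega>}"
    by (auto simp: window_def)
  then show "window V x n \<in> events"
    using borel_measurable_le[OF m[of n], of "\<lambda>_. x"] borel_measurable_less[OF _ m[of "Suc n"], of "\<lambda>_. x"]
    by (simp del: partial_sum_Suc)
  show "prob (window V x n) = count_pmf \<beta> l n x"
    unfolding window_def by (rule renewal_count[OF ren x])
  have "window V x i \<inter> window V x j = {}" if "i < j" for i j
  proof -
    have "partial_sum V (Suc i) \<omega> \<le> partial_sum V j \<omega>" if "\<omega> \<in> space M" for \<omega>
      using renewal_nonneg[OF ren _ that] \<open>i < j\<close> by (intro partial_sum_mono) auto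
    then show ?thesis by (force simp: window_def simp del: partial_sum_Suc)
  qed
  then show "disjoint_family (window V x)"
    unfolding disjoint_family_on_def by (metis Int_commute linorder_neqE_nat)
  show "AE \<omega> in M. \<exists>n. \<omega> \<in> window V x n"
    using renewal_unbounded[OF ren x] AE_space
  proof eventually_elim
    fix \<omega> assume ex: "\<exists>n. x < partial_sum V n \<omega>" and \<omega>: "\<omega> \<in> space M"
    define k where "k = (LEAST n. x < partial_sum V n \<omega>)"
    have k: "x < partial_sum V k \<omega>" unfolding k_def using ex by (rule LeastI_ex)
    then have "k \<noteq> 0" using x by (cases k) auto
    then obtain n where n: "k = Suc n" by (cases k) auto
    have "\<not> x < partial_sum V n \<omega>"
      using not_less_Least[of n "\<lambda>n. x < partial_sum V n \<omega>"] n by (simp add: k_def)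
    then have "\<omega> \<in> window V x n" using k \<omega> unfolding window_def n by simp
    then show "\<exists>n. \<omega> \<in> window V x n" by blast
  qed
qed

end

lemma partial_sum_window_sets:
  fixes e :: "nat \<Rightarrow> 'i"
  assumes "e ` {1..} \<subseteq> J"
  shows "{f\<in>space (PiM J (\<lambda>_. borel :: real measure)).
     partial_sum (\<lambda>k f. f (e k)) n f \<le> x \<and> x < partial_sum (\<lambda>k f. f (e k)) (Suc n) f}
     \<in> sets (PiM J (\<lambda>_. borel))"
proof -
  have m: "partial_sum (\<lambda>k f. f (e k)) n \<in> borel_measurable (PiM J (\<lambda>_. borel :: real measure))" for n
    unfolding partial_sum_def[abs_def]
    by (intro borel_measurable_sum measurable_component_singleton) (use assms in auto)
  have "{f\<in>space (PiM J (\<lambda>_. borel :: real measure)).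
     partial_sum (\<lambda>k f. f (e k)) n f \<le> x \<and> x < partial_sum (\<lambda>k f. f (e k)) (Suc n) f}
    = {f\<in>space (PiM J (\<lambda>_. borel)). partial_sum (\<lambda>k f. f (e k)) n f \<le> x} \<inter>
      {f\<in>space (PiM J (\<lambda>_. borel)). x < partial_sum (\<lambda>k f. f (e k)) (Suc n) f}"
    by blast
  then show ?thesis
    using borel_measurable_le[OF m[of n], of "\<lambda>_. x"] borel_measurable_less[OF _ m[of "Suc n"], of "\<lambda>_. x"]
    by (simp del: partial_sum_Suc)
qed

lemma partial_sum_restrict:
  assumes "e ` {1..} \<subseteq> J"
  shows "partial_sum (\<lambda>k f. f (e k)) n (\<lambda>i\<in>J. V i \<omega>) = partial_sum (\<lambda>k. V (e k)) n \<omega>"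
  unfolding partial_sum_def by (rule sum.cong) (use assms in auto)

context polya_telegraph
begin

text \<open>
  The up durations and the down durations are two disjoint blocks of one independent family, and
  together they are independent of the urn.
\<close>
lemma windows_indep:
  "prob (window U x n \<inter> window D y k) = prob (window U x n) * prob (window D y k)"
  and windows_sets: "window U x n \<inter> window D y k \<in> sets (vimage_algebra (space M)
     (\<lambda>\<omega>. \<lambda>i\<in>{1..} <+> {1..}. case_sum U D i \<omega>) (PiM ({1..} <+> {1..}) (\<lambda>_. borel)))"
proof -
  define C :: "(nat \<Rightarrow> nat + nat) \<Rightarrow> (nat + nat) set \<Rightarrow> nat \<Rightarrow> real \<Rightarrow> (nat + nat \<Rightarrow> real) set"
    where "C e J n x = {f\<in>space (PiM J (\<lambda>_. borel)).
     partial_sum (\<lambda>k f. f (e k)) n f \<le> x \<and> x < partial_sum (\<lambda>k f. f (e k)) (Suc n) f}" for e J n x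
  have C: "C e J n x \<in> sets (PiM J (\<lambda>_. borel))" if "e ` {1..} \<subseteq> J" for e J n x
    unfolding C_def by (rule partial_sum_window_sets[OF that])
  have w: "window (\<lambda>k. case_sum U D (e k)) x n = (\<lambda>\<omega>. \<lambda>i\<in>J. case_sum U D i \<omega>) -` C e J n x \<inter> space M"
    if "e ` {1..} \<subseteq> J" for e J n x
    unfolding window_def C_def using partial_sum_restrict[OF that, where V = "case_sum U D"]
    by (auto simp: space_PiM simp del: partial_sum_Suc)
  have U: "window U x n = window (\<lambda>k. case_sum U D (Inl k)) x n" and D: "window D y k = window (\<lambda>k. case_sum U D (Inr k)) y k"
    by simp_all
  let ?I = "{1..} <+> {1..} :: (nat + nat) set"
  have I: "Inl ` {1..} \<subseteq> ?I" "Inr ` {1..} \<subseteq> ?I" by auto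
  have "window U x n \<inter> window D y k = (\<lambda>\<omega>. \<lambda>i\<in>?I. case_sum U D i \<omega>) -` (C Inl ?I n x \<inter> C Inr ?I k y) \<inter> space M"
    unfolding U D w[OF I(1)] w[OF I(2)] by blast
  with in_vimage_algebra[OF sets.Int[OF C[OF I(1), of n x] C[OF I(2), of k y]], of "\<lambda>\<omega>. \<lambda>i\<in>?I. case_sum U D i \<omega>" "space M"]
  show "window U x n \<inter> window D y k \<in> sets (vimage_algebra (space M)
     (\<lambda>\<omega>. \<lambda>i\<in>{1..} <+> {1..}. case_sum U D i \<omega>) (PiM ({1..} <+> {1..}) (\<lambda>_. borel)))"
    by (simp only:)
  have ind: "indep_var (PiM (Inl ` {1..}) (\<lambda>_. borel)) (\<lambda>\<omega>. \<lambda>i\<in>Inl ` {1..}. case_sum U D i \<omega>)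
      (PiM (Inr ` {1..}) (\<lambda>_. borel)) (\<lambda>\<omega>. \<lambda>i\<in>Inr ` {1..}. case_sum U D i \<omega>)"
    by (rule indep_var_restrict[OF durations_indep]) auto
  have "window U x n \<inter> window D y k =
    (\<lambda>\<omega>. (\<lambda>i\<in>Inl ` {1..}. case_sum U D i \<omega>, \<lambda>i\<in>Inr ` {1..}. case_sum U D i \<omega>)) -`
      (C Inl (Inl ` {1..}) n x \<times> C Inr (Inr ` {1..}) k y) \<inter> space M"
    unfolding U D w[OF order.refl] by blast
  then show "prob (window U x n \<inter> window D y k) = prob (window U x n) * prob (window D y k)"
    using indep_varD[OF ind C[OF order.refl] C[OF order.refl], of n x k y]
    unfolding U D w[OF order.refl] by simp
qed

lemma draws_sets:
  "{\<omega>\<in>space M. X 1 \<omega> = y \<and> P (draw_count X n \<omega>)} \<in> sets (vimage_algebra (space M)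
     (\<lambda>\<omega>. \<lambda>n\<in>{1..}. X n \<omega>) (PiM {1..} (\<lambda>_. count_space UNIV)))"
proof -
  let ?P = "PiM {1..} (\<lambda>_::nat. count_space (UNIV :: nat set))"
  let ?C = "{f\<in>space ?P. f 1 = y \<and> P (\<Sum>i=1..n. f i)}"
  have m1: "(\<lambda>f. f i) \<in> measurable ?P (count_space UNIV)" if "i \<in> {1..}" for i
    by (rule measurable_component_singleton[OF that])
  have m2: "(\<lambda>f. \<Sum>i=1..n. f i) \<in> measurable ?P (count_space UNIV)"
    by (intro measurable_sum_nat m1) auto
  have "{f\<in>space ?P. f 1 = y} = (\<lambda>f. f 1) -` {y} \<inter> space ?P" by auto
  then have s1: "{f\<in>space ?P. f 1 = y} \<in> sets ?P" using measurable_sets[OF m1[of 1], of "{y}"] by simp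
  have "{f\<in>space ?P. P (\<Sum>i=1..n. f i)} = (\<lambda>f. \<Sum>i=1..n. f i) -` {j. P j} \<inter> space ?P" by auto
  then have s2: "{f\<in>space ?P. P (\<Sum>i=1..n. f i)} \<in> sets ?P" using measurable_sets[OF m2, of "{j. P j}"] by simp
  have "?C = {f\<in>space ?P. f 1 = y} \<inter> {f\<in>space ?P. P (\<Sum>i=1..n. f i)}" by blast
  then have C: "?C \<in> sets ?P" using s1 s2 by (simp only: sets.Int)
  have r: "(\<lambda>n\<in>{1..}. X n \<omega>) \<in> space ?P" for \<omega> by (simp add: space_PiM)
  have "(\<Sum>i=1..n. (\<lambda>n\<in>{1..}. X n \<omega>) i) = draw_count X n \<omega>" for \<omega>
    unfolding draw_count_def by (rule sum.cong) auto
  then have "{\<omega>\<in>space M. X 1 \<omega> = y \<and> P (draw_count X n \<omega>)} = (\<lambda>\<omega>. \<lambda>n\<in>{1..}. X n \<omega>) -` ?C \<inter> space M"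
    using r by auto
  with in_vimage_algebra[OF C, of "\<lambda>\<omega>. \<lambda>n\<in>{1..}. X n \<omega>" "space M"] show ?thesis
    by (simp only:)
qed

lemma draws_events: "{\<omega>\<in>space M. X 1 \<omega> = y \<and> P (draw_count X n \<omega>)} \<in> events"
  using indep_setD_ev2[OF durations_indep_X] draws_sets by blast

lemma prob_windows_draws:
  assumes "renewal U \<beta> l" "renewal D \<rho> \<mu>" "0 < x" "0 < y"
  shows "prob (window U x n \<inter> window D y k \<inter> {\<omega>\<in>space M. X 1 \<omega> = z \<and> P (draw_count X m \<omega>)})
    = count_pmf \<beta> l n x * count_pmf \<rho> \<mu> k y * \<P>(\<omega> in M. X 1 \<omega> = z \<and> P (draw_count X m \<omega>))"
  using indep_setD[OF durations_indep_X windows_sets draws_sets] windows_indep[of x n y k]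
    window_props(4)[OF assms(1,3)] window_props(4)[OF assms(2,4)] by simp

lemma AE_regular:
  assumes ren: "renewal U \<beta> l" "renewal D \<rho> \<mu>" and t: "0 < t"
  shows "AE \<omega> in M. (\<forall>m\<ge>1. partial_sum D m \<omega> \<noteq> s) \<and> (\<exists>n. t < partial_sum U n \<omega>) \<and> (\<exists>n. t < partial_sum D n \<omega>)"
proof -
  have "AE \<omega> in M. \<forall>m\<ge>1. partial_sum D m \<omega> \<noteq> s"
    unfolding AE_all_countable using renewal_neq[OF ren(2)] by auto
  then show ?thesis
    using renewal_unbounded[OF ren(1) t] renewal_unbounded[OF ren(2) t] by eventually_elim blast
qed

lemma position_event:
  "{\<omega>\<in>space M. position c v X U D t \<omega> \<le> x} \<in> events"
  using borel_measurable_le[OF position_measurable, of "\<lambda>_. x"] by simp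

lemma X1_event: "{\<omega>\<in>space M. X 1 \<omega> = y} \<in> events"
  using draws_events[of y "\<lambda>_. True"] by simp

context
  fixes \<beta> l \<rho> \<mu> t \<tau> :: real
  assumes ren: "renewal U \<beta> l" "renewal D \<rho> \<mu>" and \<tau>: "0 < \<tau>" "\<tau> < t"
begin

lemma position_windows_AE:
  "AE \<omega> in M. \<omega> \<in> window U \<tau> n \<inter> window D (t - \<tau>) k \<longrightarrow>
     (position c v X U D t \<omega> \<le> (c + v) * \<tau> - v * t \<longleftrightarrow> draw_count X (Suc (n + k)) \<omega> \<le> n)"
proof -
  have "0 < t" using \<tau> by simp
  from AE_regular[OF ren this, of "t - \<tau>"] show ?thesis
  proof eventually_elim
    fix \<omega>
    assume reg: "(\<forall>m\<ge>1. partial_sum D m \<omega> \<noteq> t - \<tau>) \<and> (\<exists>n. t < partial_sum U n \<omega>) \<and> (\<exists>n. t < partial_sum D n \<omega>)"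
    show "\<omega> \<in> window U \<tau> n \<inter> window D (t - \<tau>) k \<longrightarrow>
       (position c v X U D t \<omega> \<le> (c + v) * \<tau> - v * t \<longleftrightarrow> draw_count X (Suc (n + k)) \<omega> \<le> n)"
    proof
      assume "\<omega> \<in> window U \<tau> n \<inter> window D (t - \<tau>) k"
      then show "position c v X U D t \<omega> \<le> (c + v) * \<tau> - v * t \<longleftrightarrow> draw_count X (Suc (n + k)) \<omega> \<le> n"
        using reg \<tau> unfolding window_def by (intro position_le_iff) blast+
    qed
  qed
qed

text \<open>
  On a pair of windows the position event coincides with an event of the urn. The predicate \<open>R\<close> is the
  identity when up steps are counted and the negation when down steps are counted.
\<close>
lemma prob_position_windows:
  assumes R: "\<And>b. R b \<longleftrightarrow> (if s then b else \<not> b)"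
  shows "prob ({\<omega>\<in>space M. R (position c v X U D t \<omega> \<le> (c + v) * \<tau> - v * t) \<and> X 1 \<omega> = y} \<inter> (window U \<tau> n \<inter> window D (t - \<tau>) k))
    = count_pmf \<beta> l n \<tau> * count_pmf \<rho> \<mu> k (t - \<tau>) * \<P>(\<omega> in M. X 1 \<omega> = y \<and> R (draw_count X (Suc (n + k)) \<omega> \<le> n))"
    (is "prob (?E \<inter> ?W) = _")
  and position_R_event: "{\<omega>\<in>space M. R (position c v X U D t \<omega> \<le> (c + v) * \<tau> - v * t) \<and> X 1 \<omega> = y} \<in> events"
proof -
  have s: "0 < t - \<tau>" using \<tau> by simp
  let ?P = "{\<omega>\<in>space M. position c v X U D t \<omega> \<le> (c + v) * \<tau> - v * t}"
  have E: "?E = (if s then ?P else space M - ?P) \<inter> {\<omega>\<in>space M. X 1 \<omega> = y}"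
    using R by auto
  show ev: "?E \<in> events"
    unfolding E using position_event X1_event by auto
  have W: "?W \<in> events"
    using window_props(1)[OF ren(1) \<tau>(1)] window_props(1)[OF ren(2) s] by auto
  let ?F = "{\<omega>\<in>space M. X 1 \<omega> = y \<and> R (draw_count X (Suc (n + k)) \<omega> \<le> n)}"
  have "prob (?E \<inter> ?W) = prob (?W \<inter> ?F)"
  proof (rule finite_measure_eq_AE)
    show "AE \<omega> in M. \<omega> \<in> ?E \<inter> ?W \<longleftrightarrow> \<omega> \<in> ?W \<inter> ?F"
      using position_windows_AE[of n k] AE_space by eventually_elim (use R in auto)
    show "?E \<inter> ?W \<in> events" using ev W by auto
    show "?W \<inter> ?F \<in> events" using W draws_events[of y "\<lambda>j. R (j \<le> n)" "Suc (n + k)"] by auto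
  qed
  also have "\<dots> = count_pmf \<beta> l n \<tau> * count_pmf \<rho> \<mu> k (t - \<tau>) * prob ?F"
    by (rule prob_windows_draws[OF ren \<tau>(1) s, where P = "\<lambda>j. R (j \<le> n)"])
  finally show "prob (?E \<inter> ?W) = count_pmf \<beta> l n \<tau> * count_pmf \<rho> \<mu> k (t - \<tau>) * prob ?F" .
qed

lemma summable_count_pmf_mult:
  assumes "renewal V \<beta>' l'" "0 < x" "\<And>k. \<bar>L k\<bar> \<le> 1"
  shows "summable (\<lambda>k. count_pmf \<beta>' l' k x * L k)"
proof -
  obtain a where a: "summable a" "\<And>n y. 0 < y \<Longrightarrow> y < x + 1 \<Longrightarrow> \<bar>count_pmf \<beta>' l' n y\<bar> \<le> a n"
    using count_pmf_bounds[of \<beta>' l' "x + 1"] renewal_pos[OF assms(1)] assms(2)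
    by (metis add_pos_pos zero_less_one)
  show ?thesis
  proof (rule summable_comparison_test'[OF a(1)])
    fix k
    have "\<bar>count_pmf \<beta>' l' k x\<bar> * \<bar>L k\<bar> \<le> a k * 1"
      using a(2)[of x k] assms(2,3) order_trans[OF abs_ge_zero a(2)[of x k]] by (intro mult_mono) auto
    then show "norm (count_pmf \<beta>' l' k x * L k) \<le> a k" by (simp add: abs_mult)
  qed
qed

lemma prob_position_le_up:
  "\<P>(\<omega> in M. position c v X U D t \<omega> \<le> (c + v) * \<tau> - v * t \<and> X 1 \<omega> = 1)
   = (\<Sum>n. count_pmf \<beta> l n \<tau> * (\<Sum>k. count_pmf \<rho> \<mu> k (t - \<tau>) * low_count X n k))"
proof -
  have s: "0 < t - \<tau>" using \<tau> by simp
  let ?E = "{\<omega>\<in>space M. position c v X U D t \<omega> \<le> (c + v) * \<tau> - v * t \<and> X 1 \<omega> = 1}"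
  have E: "?E \<in> events" by (rule position_R_event[of "\<lambda>b. b" True]) simp
  have R: "prob (?E \<inter> (window U \<tau> n \<inter> window D (t - \<tau>) k)) = count_pmf \<beta> l n \<tau> * count_pmf \<rho> \<mu> k (t - \<tau>) * low_count X n k" for n k
    unfolding low_count_def by (rule prob_position_windows[of "\<lambda>b. b" True]) simp
  note wU = window_props[OF ren(1) \<tau>(1)] and wD = window_props[OF ren(2) s]
  have "prob ?E = (\<Sum>n. prob (?E \<inter> window U \<tau> n))"
    by (rule prob_partition[OF E wU(1,2,3)])
  also have "\<dots> = (\<Sum>n. \<Sum>k. prob (?E \<inter> window U \<tau> n \<inter> window D (t - \<tau>) k))"
    by (intro suminf_cong prob_partition[OF _ wD(1,2,3)]) (intro sets.Int E wU(1))
  also have "\<dots> = (\<Sum>n. \<Sum>k. count_pmf \<beta> l n \<tau> * (count_pmf \<rho> \<mu> k (t - \<tau>) * low_count X n k))"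
    unfolding Int_assoc R mult.assoc ..
  also have "\<dots> = (\<Sum>n. count_pmf \<beta> l n \<tau> * (\<Sum>k. count_pmf \<rho> \<mu> k (t - \<tau>) * low_count X n k))"
    by (intro suminf_cong suminf_mult summable_count_pmf_mult[OF ren(2) s low_count_bound])
  finally show ?thesis .
qed

text \<open>
  With down steps in the role of the counted colour: among \<open>n + k + 1\<close> draws more than \<open>n\<close> are ones if
  and only if at most \<open>k\<close> are zeros. This is the same series as in \<open>prob_position_le_up\<close> with all
  parameters exchanged, so that the analysis of that series serves both conditional laws.
\<close>
lemma prob_position_gt_down:
  "\<P>(\<omega> in M. \<not> position c v X U D t \<omega> \<le> (c + v) * \<tau> - v * t \<and> X 1 \<omega> = 0)
   = (\<Sum>k. count_pmf \<rho> \<mu> k (t - \<tau>) * (\<Sum>n. count_pmf \<beta> l n \<tau> * low_count (\<lambda>n \<omega>. 1 - X n \<omega>) k n))"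
proof -
  have s: "0 < t - \<tau>" using \<tau> by simp
  let ?E = "{\<omega>\<in>space M. \<not> position c v X U D t \<omega> \<le> (c + v) * \<tau> - v * t \<and> X 1 \<omega> = 0}"
  have E: "?E \<in> events" by (rule position_R_event[of "\<lambda>b. \<not> b" False]) simp
  note wU = window_props[OF ren(1) \<tau>(1)] and wD = window_props[OF ren(2) s]
  have low: "low_count (\<lambda>n \<omega>. 1 - X n \<omega>) k n = \<P>(\<omega> in M. X 1 \<omega> = 0 \<and> \<not> draw_count X (Suc (n + k)) \<omega> \<le> n)" for k n
  proof -
    have "1 - X 1 \<omega> = 1 \<and> draw_count (\<lambda>n \<omega>. 1 - X n \<omega>) (Suc (k + n)) \<omega> \<le> k \<longleftrightarrow>
      X 1 \<omega> = 0 \<and> \<not> draw_count X (Suc (n + k)) \<omega> \<le> n" if "\<omega> \<in> space M" for \<omega>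
      using sum_zeros[OF that, of "Suc (k + n)"] X_cases[OF that, of 0] by (auto simp: add.commute simp del: draw_count_Suc)
    then have "{\<omega>\<in>space M. 1 - X 1 \<omega> = 1 \<and> draw_count (\<lambda>n \<omega>. 1 - X n \<omega>) (Suc (k + n)) \<omega> \<le> k}
       = {\<omega>\<in>space M. X 1 \<omega> = 0 \<and> \<not> draw_count X (Suc (n + k)) \<omega> \<le> n}" by blast
    then show ?thesis by (simp only: low_count_def)
  qed
  have R: "prob (?E \<inter> (window U \<tau> n \<inter> window D (t - \<tau>) k)) = count_pmf \<beta> l n \<tau> * count_pmf \<rho> \<mu> k (t - \<tau>) * low_count (\<lambda>n \<omega>. 1 - X n \<omega>) k n" for n k
    unfolding low by (rule prob_position_windows[of "\<lambda>b. \<not> b" False]) simp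
  have swap: "?E \<inter> window D (t - \<tau>) k \<inter> window U \<tau> n = ?E \<inter> (window U \<tau> n \<inter> window D (t - \<tau>) k)" for n k
    by blast
  have "prob ?E = (\<Sum>k. prob (?E \<inter> window D (t - \<tau>) k))"
    by (rule prob_partition[OF E wD(1,2,3)])
  also have "\<dots> = (\<Sum>k. \<Sum>n. prob (?E \<inter> window D (t - \<tau>) k \<inter> window U \<tau> n))"
    by (intro suminf_cong prob_partition[OF _ wU(1,2,3)]) (intro sets.Int E wD(1))
  also have "\<dots> = (\<Sum>k. \<Sum>n. count_pmf \<rho> \<mu> k (t - \<tau>) * (count_pmf \<beta> l n \<tau> * low_count (\<lambda>n \<omega>. 1 - X n \<omega>) k n))"
    unfolding swap R by (simp only: mult_ac)
  also have "\<dots> = (\<Sum>k. count_pmf \<rho> \<mu> k (t - \<tau>) * (\<Sum>n. count_pmf \<beta> l n \<tau> * low_count (\<lambda>n \<omega>. 1 - X n \<omega>) k n))"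
    by (intro suminf_cong suminf_mult summable_count_pmf_mult[OF ren(1) \<tau>(1) low_count_bound])
  finally show ?thesis .
qed

end

end

section \<open>Conditional densities\<close>

context polya_telegraph
begin

lemma prob_first_zero: "\<P>(\<omega> in M. X 1 \<omega> = 0) = r / (b + r)"
proof -
  have "{\<omega>\<in>space M. X 1 \<omega> = 0} = space M - {\<omega>\<in>space M. X 1 \<omega> = 1}"
  proof (rule set_eqI)
    fix \<omega>
    show "\<omega> \<in> {\<omega>\<in>space M. X 1 \<omega> = 0} \<longleftrightarrow> \<omega> \<in> space M - {\<omega>\<in>space M. X 1 \<omega> = 1}"
      using X_cases[of \<omega> 0] by auto
  qed
  then have "\<P>(\<omega> in M. X 1 \<omega> = 0) = 1 - b / (b + r)"
    using prob_compl[OF X1_event[of 1]] X_first by (simp only:)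
  also have "\<dots> = r / (b + r)" using pos by (simp add: field_simps)
  finally show ?thesis .
qed

lemma time_split:
  assumes "- v * t < x" "x < c * t"
  shows "0 < (v * t + x) / (c + v)" "(v * t + x) / (c + v) < t" "(c + v) * ((v * t + x) / (c + v)) - v * t = x"
  using assms pos by (simp_all add: field_simps)

lemma time_split_deriv: "((\<lambda>x. (v * t + x) / (c + v)) has_real_derivative 1 / (c + v)) (at x)"
  using pos by (auto intro!: derivative_eq_intros)

context
  fixes l \<mu> :: real
  assumes ren: "renewal U (b / A) l" "renewal D (r / A) \<mu>"
begin

text \<open>
  The first duration is almost surely positive, so no epoch but the initial one has passed at time \<open>0\<close>.
\<close>
lemma AE_velocity_0: "AE \<omega> in M. velocity c v X U D 0 \<omega> = step_velocity c v X 0 \<omega>"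
  using renewal_first_pos[OF ren(1)] renewal_first_pos[OF ren(2)] AE_space
proof eventually_elim
  fix \<omega> assume "0 < U 1 \<omega>" "0 < D 1 \<omega>" and \<omega>: "\<omega> \<in> space M"
  then have "0 < epoch X U D (Suc 0) \<omega>"
    using X_cases[OF \<omega>, of 0] epoch_Suc_up[of 0 \<omega>] epoch_Suc_down[OF \<omega>, of 0] by auto
  then have "epoch_count X U D 0 \<omega> = 0" by (intro epoch_count_eq[OF \<omega>]) auto
  then show "velocity c v X U D 0 \<omega> = step_velocity c v X 0 \<omega>" by (simp add: velocity_def)
qed

lemma prob_given_velocity_0:
  assumes y: "\<And>\<omega>. \<omega> \<in> space M \<Longrightarrow> step_velocity c v X 0 \<omega> = y \<longleftrightarrow> X 1 \<omega> = z"
  shows "position_cdf_given M c v X U D y t x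
    = \<P>(\<omega> in M. position c v X U D t \<omega> \<le> x \<and> X 1 \<omega> = z) / \<P>(\<omega> in M. X 1 \<omega> = z)"
proof -
  have V: "{\<omega>\<in>space M. velocity c v X U D 0 \<omega> = y} \<in> events"
    using measurable_sets[OF velocity_measurable, of "{y}" 0] by (simp add: vimage_def Int_def conj_commute)
  let ?P = "{\<omega>\<in>space M. position c v X U D t \<omega> \<le> x}"
  have I: "{\<omega>\<in>space M. position c v X U D t \<omega> \<le> x \<and> velocity c v X U D 0 \<omega> = y} = ?P \<inter> {\<omega>\<in>space M. velocity c v X U D 0 \<omega> = y}"
    "{\<omega>\<in>space M. position c v X U D t \<omega> \<le> x \<and> X 1 \<omega> = z} = ?P \<inter> {\<omega>\<in>space M. X 1 \<omega> = z}" by blast+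
  have ae: "AE \<omega> in M. velocity c v X U D 0 \<omega> = y \<longleftrightarrow> X 1 \<omega> = z"
    using AE_velocity_0 AE_space by eventually_elim (simp add: y)
  have "\<P>(\<omega> in M. velocity c v X U D 0 \<omega> = y) = \<P>(\<omega> in M. X 1 \<omega> = z)"
    by (rule finite_measure_eq_AE[OF _ V X1_event]) (use ae in \<open>auto elim: eventually_mono\<close>)
  moreover have "\<P>(\<omega> in M. position c v X U D t \<omega> \<le> x \<and> velocity c v X U D 0 \<omega> = y)
     = \<P>(\<omega> in M. position c v X U D t \<omega> \<le> x \<and> X 1 \<omega> = z)"
    unfolding I
    by (rule finite_measure_eq_AE[OF _ sets.Int[OF position_event V] sets.Int[OF position_event X1_event]])
       (use ae in \<open>auto elim: eventually_mono\<close>)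
  ultimately show ?thesis by (simp only: position_cdf_given_def cond_prob_def)
qed

lemma cdf_given_up:
  "position_cdf_given M c v X U D c t x = \<P>(\<omega> in M. position c v X U D t \<omega> \<le> x \<and> X 1 \<omega> = 1) / (b / (b + r))"
proof -
  have "- v \<noteq> c" using pos by linarith
  then have "step_velocity c v X 0 \<omega> = c \<longleftrightarrow> X 1 \<omega> = 1" for \<omega>
    by (simp add: step_velocity_def)
  from prob_given_velocity_0[OF this] show ?thesis by (simp only: X_first)
qed

lemma cdf_given_down:
  "position_cdf_given M c v X U D (- v) t x = \<P>(\<omega> in M. position c v X U D t \<omega> \<le> x \<and> X 1 \<omega> = 0) / (r / (b + r))"
proof -
  have "- v \<noteq> c" using pos by linarith
  then have "step_velocity c v X 0 \<omega> = - v \<longleftrightarrow> X 1 \<omega> = 0" if "\<omega> \<in> space M" for \<omega>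
    using X_cases[OF that, of 0] by (auto simp: step_velocity_def)
  from prob_given_velocity_0[OF this] show ?thesis by (simp only: prob_first_zero)
qed

lemma cdf_split:
  "position_cdf M c v X U D t x = b / (b + r) * position_cdf_given M c v X U D c t x
     + r / (b + r) * position_cdf_given M c v X U D (- v) t x"
proof -
  let ?P = "{\<omega>\<in>space M. position c v X U D t \<omega> \<le> x}"
  have I: "{\<omega>\<in>space M. position c v X U D t \<omega> \<le> x \<and> X 1 \<omega> = z} = ?P \<inter> {\<omega>\<in>space M. X 1 \<omega> = z}" for z by blast
  have e: "(?P \<inter> {\<omega>\<in>space M. X 1 \<omega> = 1}) \<union> (?P \<inter> {\<omega>\<in>space M. X 1 \<omega> = 0}) = ?P"
    using X_cases[of _ 0] unfolding One_nat_def by blast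
  have "prob ((?P \<inter> {\<omega>\<in>space M. X 1 \<omega> = 1}) \<union> (?P \<inter> {\<omega>\<in>space M. X 1 \<omega> = 0}))
      = prob (?P \<inter> {\<omega>\<in>space M. X 1 \<omega> = 1}) + prob (?P \<inter> {\<omega>\<in>space M. X 1 \<omega> = 0})"
    by (rule finite_measure_Union[OF sets.Int[OF position_event X1_event] sets.Int[OF position_event X1_event]]) auto
  then have *: "prob ?P = \<P>(\<omega> in M. position c v X U D t \<omega> \<le> x \<and> X 1 \<omega> = 1) + \<P>(\<omega> in M. position c v X U D t \<omega> \<le> x \<and> X 1 \<omega> = 0)"
    unfolding e I .
  have q: "q * (p / q) = p" if "0 < q" for p q :: real using that by simp
  have "0 < b / (b + r)" "0 < r / (b + r)" using pos by (simp_all add: add_pos_pos)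
  then show ?thesis
    unfolding cdf_given_up cdf_given_down position_cdf_def * by (simp only: q)
qed

lemma cdf_given_up_deriv:
  assumes x: "- v * t < x" "x < c * t"
  defines "\<tau> \<equiv> (v * t + x) / (c + v)"
  shows "(position_cdf_given M c v X U D c t has_real_derivative
    crossing_density (b / A) (r / A) l \<mu> t \<tau> / (c + v)) (at x)"
proof -
  let ?G = "\<lambda>y. \<Sum>n. count_pmf (b / A) l n y * (\<Sum>k. count_pmf (r / A) \<mu> k (t - y) * low_count X n k)"
  have q: "b / A / (b / A + r / A) = b / (b + r)" using pos by (simp add: field_simps)
  have "(?G has_real_derivative b / (b + r) * crossing_density (b / A) (r / A) l \<mu> t \<tau>) (at \<tau>)"
    unfolding q[symmetric]
    by (rule urn_crossing_deriv[OF urn_ones renewal_pos(2)[OF ren(1)] renewal_pos(2)[OF ren(2)]])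
       (use time_split[OF x] in \<open>simp_all only: \<tau>_def\<close>)
  from DERIV_chain2[OF this[unfolded \<tau>_def] time_split_deriv]
  have "((\<lambda>y. ?G ((v * t + y) / (c + v)) / (b / (b + r))) has_real_derivative
    b / (b + r) * crossing_density (b / A) (r / A) l \<mu> t \<tau> * (1 / (c + v)) / (b / (b + r))) (at x)"
    unfolding \<tau>_def by (rule DERIV_cdivide)
  also have "b / (b + r) * crossing_density (b / A) (r / A) l \<mu> t \<tau> * (1 / (c + v)) / (b / (b + r))
    = crossing_density (b / A) (r / A) l \<mu> t \<tau> / (c + v)"
    using pos by simp
  finally show ?thesis
  proof (rule has_field_derivative_transform_within_open[where S = "{- v * t<..<c * t}"])
    fix y assume "y \<in> {- v * t<..<c * t}"
    then have y: "- v * t < y" "y < c * t" by auto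
    show "?G ((v * t + y) / (c + v)) / (b / (b + r)) = position_cdf_given M c v X U D c t y"
      unfolding cdf_given_up
      using prob_position_le_up[OF ren time_split(1,2)[OF y]] unfolding time_split(3)[OF y] by (simp only:)
  qed (use x in auto)
qed

text \<open>
  Here the series describes the complementary event \<open>x < position\<close> as a function of the down time
  \<open>t - \<tau>\<close>. The two changes of sign cancel.
\<close>
lemma cdf_given_down_deriv:
  assumes x: "- v * t < x" "x < c * t"
  defines "\<tau> \<equiv> (v * t + x) / (c + v)"
  shows "(position_cdf_given M c v X U D (- v) t has_real_derivative
    crossing_density (r / A) (b / A) \<mu> l t (t - \<tau>) / (c + v)) (at x)"
proof -
  let ?G = "\<lambda>y. \<Sum>k. count_pmf (r / A) \<mu> k y * (\<Sum>n. count_pmf (b / A) l n (t - y) * low_count (\<lambda>n \<omega>. 1 - X n \<omega>) k n)"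
  have q: "r / A / (r / A + b / A) = r / (b + r)" using pos by (simp add: field_simps)
  have "(?G has_real_derivative r / (b + r) * crossing_density (r / A) (b / A) \<mu> l t (t - \<tau>)) (at (t - \<tau>))"
    unfolding q[symmetric]
    by (rule urn_crossing_deriv[OF urn_zeros renewal_pos(2)[OF ren(2)] renewal_pos(2)[OF ren(1)]])
       (use time_split[OF x] in \<open>auto simp: \<tau>_def\<close>)
  moreover have "((\<lambda>x. t - (v * t + x) / (c + v)) has_real_derivative 0 - 1 / (c + v)) (at x)"
    by (intro DERIV_diff DERIV_const time_split_deriv)
  ultimately have "((\<lambda>y. ?G (t - (v * t + y) / (c + v))) has_real_derivative
    r / (b + r) * crossing_density (r / A) (b / A) \<mu> l t (t - \<tau>) * (0 - 1 / (c + v))) (at x)"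
    unfolding \<tau>_def by (rule DERIV_chain2)
  from DERIV_cdivide[OF DERIV_diff[OF DERIV_const[of "r / (b + r)"] this], of "r / (b + r)"]
  have "((\<lambda>y. (r / (b + r) - ?G (t - (v * t + y) / (c + v))) / (r / (b + r))) has_real_derivative
    (0 - r / (b + r) * crossing_density (r / A) (b / A) \<mu> l t (t - \<tau>) * (0 - 1 / (c + v))) / (r / (b + r))) (at x)" .
  also have "(0 - r / (b + r) * crossing_density (r / A) (b / A) \<mu> l t (t - \<tau>) * (0 - 1 / (c + v))) / (r / (b + r))
    = crossing_density (r / A) (b / A) \<mu> l t (t - \<tau>) / (c + v)"
    using pos by simp
  finally show ?thesis
  proof (rule has_field_derivative_transform_within_open[where S = "{- v * t<..<c * t}"])
    fix y assume "y \<in> {- v * t<..<c * t}"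
    then have y: "- v * t < y" "y < c * t" by auto
    let ?s = "(v * t + y) / (c + v)"
    have low: "\<P>(\<omega> in M. \<not> position c v X U D t \<omega> \<le> y \<and> X 1 \<omega> = 0) = ?G (t - ?s)"
      using prob_position_gt_down[OF ren time_split(1,2)[OF y]] unfolding time_split(3)[OF y] by simp
    let ?Z = "{\<omega>\<in>space M. X 1 \<omega> = 0}" and ?P = "{\<omega>\<in>space M. position c v X U D t \<omega> \<le> y}"
    have "{\<omega>\<in>space M. position c v X U D t \<omega> \<le> y \<and> X 1 \<omega> = 0} = ?Z \<inter> ?P"
      "{\<omega>\<in>space M. \<not> position c v X U D t \<omega> \<le> y \<and> X 1 \<omega> = 0} = ?Z - ?P" by blast+
    then have "\<P>(\<omega> in M. position c v X U D t \<omega> \<le> y \<and> X 1 \<omega> = 0) = r / (b + r) - ?G (t - ?s)"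
      using finite_measure_Diff'[OF X1_event position_event, of 0 t y] low prob_first_zero by simp
    then show "(r / (b + r) - ?G (t - ?s)) / (r / (b + r)) = position_cdf_given M c v X U D (- v) t y"
      unfolding cdf_given_down by (simp only:)
  qed (use x in auto)
qed

end

end

lemma (in prob_space) renewal_tail:
  assumes "renewal V \<beta> l" "0 < x" shows "count_pmf \<beta> l 0 x = tail M (V 1) x"
  using renewal_count[OF assms, of 0] assms(2) by (simp add: tail_def)

lemma crossing_density_up:
  assumes pos: "0 < A" "0 < b" "0 < r" and W: "count_pmf (r / A) \<mu> 0 (t - \<tau>) = W"
  shows "crossing_density (b / A) (r / A) l \<mu> t \<tau> / (c + v)
    = r * l * (l * \<tau>) powr (b / A - 1) * exp (- l * \<tau>) / ((c + v) * A * Gamma ((b + A) / A))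
          * W * (kummer_1F1 1 ((b + A + r) / A) (l * \<tau>) - 1)
        + xi b r A c v l \<mu> \<tau> t * eta b r A l \<mu> \<tau> t * t / (\<tau> * (t - \<tau>))"
proof -
  have w: "b / A + r / A + 1 = (b + A + r) / A" "b / A + 1 = (b + A) / A" using pos by (simp_all add: field_simps)
  have "eta b r A l \<mu> \<tau> t = crossing_eta ((b + A + r) / A) (l * \<tau>) (\<mu> * (t - \<tau>))"
    by (simp add: eta_def crossing_eta_def mult_ac)
  then show ?thesis
    unfolding crossing_density_def w W xi_def add_divide_distrib[of _ _ "c + v"] by (simp add: mult_ac)
qed

text \<open>
  The formulas with and without a tilde are exchanged by the symmetry between up and down.
\<close>
lemma xi_eta_swap:
  "xi_tilde b r A c v l \<mu> \<tau> t = xi r b A c v \<mu> l (t - \<tau>) t"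
  "eta_tilde b r A l \<mu> \<tau> t = eta r b A \<mu> l (t - \<tau>) t"
proof -
  have s: "t - (t - \<tau>) = \<tau>" and S: "r + A + b = b + A + r"
    and e: "- \<mu> * (t - \<tau>) - l * \<tau> = - l * \<tau> - \<mu> * (t - \<tau>)"
    and d: "\<mu> * (t - \<tau>) + l * \<tau> = l * \<tau> + \<mu> * (t - \<tau>)"
    by simp_all
  show "xi_tilde b r A c v l \<mu> \<tau> t = xi r b A c v \<mu> l (t - \<tau>) t"
    unfolding xi_def xi_tilde_def s e by (simp only: mult_ac)
  show "eta_tilde b r A l \<mu> \<tau> t = eta r b A \<mu> l (t - \<tau>) t"
    unfolding eta_def eta_tilde_def s S d ..
qed

theorem corollary5p1:
  fixes M :: "'a measure"
    and b r A c v l \<mu> :: real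
    and X :: "nat \<Rightarrow> 'a \<Rightarrow> nat"
    and U D :: "nat \<Rightarrow> 'a \<Rightarrow> real"
  assumes "polya_telegraph M b r A c v X U D"
    and "l > 0" and "\<mu> > 0"
    and "distributed M lborel (U 1) (gamma_density (b / A + 1) l)"
    and "distributed M lborel (D 1) (gamma_density (r / A + 1) \<mu>)"
    and "\<And>k. k \<ge> 2 \<Longrightarrow> distributed M lborel (U k) (exponential_density l)"
    and "\<And>k. k \<ge> 2 \<Longrightarrow> distributed M lborel (D k) (exponential_density \<mu>)"
  shows "\<forall>t>0. \<forall>x. - v * t < x \<and> x < c * t \<longrightarrow>
    (let \<tau> = (v * t + x) / (c + v);
         p = position_density M c v X U D;
         p_given = position_density_given M c v X U D
     in
      position_cdf M c v X U D t differentiable (at x) \<and>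
      position_cdf_given M c v X U D c t differentiable (at x) \<and>
      position_cdf_given M c v X U D (- v) t differentiable (at x) \<and>
      p x t = b / (b + r) * p_given x t c + r / (b + r) * p_given x t (- v) \<and>
      p_given x t c =
        r * l * (l * \<tau>) powr (b / A - 1) * exp (- l * \<tau>) / ((c + v) * A * Gamma ((b + A) / A))
          * tail M (D 1) (t - \<tau>) * (kummer_1F1 1 ((b + A + r) / A) (l * \<tau>) - 1)
        + xi b r A c v l \<mu> \<tau> t * eta b r A l \<mu> \<tau> t * t / (\<tau> * (t - \<tau>)) \<and>
      p_given x t (- v) =
        b * \<mu> * (\<mu> * (t - \<tau>)) powr (r / A - 1) * exp (- \<mu> * (t - \<tau>)) / ((c + v) * A * Gamma ((r + A) / A))
          * tail M (U 1) \<tau> * (kummer_1F1 1 ((b + A + r) / A) (\<mu> * (t - \<tau>)) - 1)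
        + xi_tilde b r A c v l \<mu> \<tau> t * eta_tilde b r A l \<mu> \<tau> t * t / (\<tau> * (t - \<tau>)))"
proof -
  interpret polya_telegraph M b r A c v X U D by fact
  have U: "renewal U (b / A) l"
  proof -
    have "renewal (\<lambda>k. case_sum U D (Inl k)) (b / A) l"
    proof (rule renewalI)
      show "indep_vars (\<lambda>_. borel) (case_sum U D) (Inl ` {1..})"
        by (rule indep_vars_subset[OF durations_indep]) auto
      show "0 < b / A" using pos by simp
      show "0 \<le> case_sum U D (Inl k) \<omega>" if "k \<ge> 1" "\<omega> \<in> space M" for k \<omega>
        using durations_nonneg[OF that] by simp
    qed (simp_all only: sum.case assms inj_Inl)
    then show ?thesis by (simp only: sum.case)
  qed
  have D: "renewal D (r / A) \<mu>"
  proof -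
    have "renewal (\<lambda>k. case_sum U D (Inr k)) (r / A) \<mu>"
    proof (rule renewalI)
      show "indep_vars (\<lambda>_. borel) (case_sum U D) (Inr ` {1..})"
        by (rule indep_vars_subset[OF durations_indep]) auto
      show "0 < r / A" using pos by simp
      show "0 \<le> case_sum U D (Inr k) \<omega>" if "k \<ge> 1" "\<omega> \<in> space M" for k \<omega>
        using durations_nonneg[OF that] by simp
    qed (simp_all only: sum.case assms inj_Inr)
    then show ?thesis by (simp only: sum.case)
  qed
  show ?thesis
  proof (intro allI impI)
    fix t x :: real assume "0 < t" and "- v * t < x \<and> x < c * t"
    then have x: "- v * t < x" "x < c * t" by auto
    define \<tau> where "\<tau> = (v * t + x) / (c + v)"
    have \<tau>: "0 < \<tau>" "0 < t - \<tau>" using time_split[OF x] by (auto simp: \<tau>_def)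
    note up = cdf_given_up_deriv[OF U D x, folded \<tau>_def] and down = cdf_given_down_deriv[OF U D x, folded \<tau>_def]
    have "((\<lambda>x. b / (b + r) * position_cdf_given M c v X U D c t x + r / (b + r) * position_cdf_given M c v X U D (- v) t x)
       has_real_derivative b / (b + r) * (crossing_density (b / A) (r / A) l \<mu> t \<tau> / (c + v))
         + r / (b + r) * (crossing_density (r / A) (b / A) \<mu> l t (t - \<tau>) / (c + v))) (at x)"
      by (intro DERIV_add DERIV_cmult up down)
    then have total: "(position_cdf M c v X U D t has_real_derivative b / (b + r) * (crossing_density (b / A) (r / A) l \<mu> t \<tau> / (c + v))
         + r / (b + r) * (crossing_density (r / A) (b / A) \<mu> l t (t - \<tau>) / (c + v))) (at x)"
      unfolding cdf_split[OF U D, symmetric] .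
    have p_up: "position_density_given M c v X U D x t c = crossing_density (b / A) (r / A) l \<mu> t \<tau> / (c + v)"
      unfolding position_density_given_def by (rule DERIV_imp_deriv[OF up])
    have p_down: "position_density_given M c v X U D x t (- v) = crossing_density (r / A) (b / A) \<mu> l t (t - \<tau>) / (c + v)"
      unfolding position_density_given_def by (rule DERIV_imp_deriv[OF down])
    have p: "position_density M c v X U D x t = b / (b + r) * position_density_given M c v X U D x t c
        + r / (b + r) * position_density_given M c v X U D x t (- v)"
      unfolding p_up p_down position_density_def by (rule DERIV_imp_deriv[OF total])
    have W: "count_pmf (b / A) l 0 (t - (t - \<tau>)) = tail M (U 1) \<tau>"
      using renewal_tail[OF U \<tau>(1)] by simp
    have q: "r + A + b = b + A + r" "t - (t - \<tau>) = \<tau>" "(t - \<tau>) * \<tau> = \<tau> * (t - \<tau>)" by simp_all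
    note up_eq = p_up[unfolded crossing_density_up[OF pos(3,1,2) renewal_tail[OF D \<tau>(2)]]]
    note down_eq = p_down[unfolded crossing_density_up[OF pos(3,2,1) W], unfolded xi_eta_swap[symmetric] q]
    show "let \<tau> = (v * t + x) / (c + v);
         p = position_density M c v X U D;
         p_given = position_density_given M c v X U D
     in
      position_cdf M c v X U D t differentiable (at x) \<and>
      position_cdf_given M c v X U D c t differentiable (at x) \<and>
      position_cdf_given M c v X U D (- v) t differentiable (at x) \<and>
      p x t = b / (b + r) * p_given x t c + r / (b + r) * p_given x t (- v) \<and>
      p_given x t c =
        r * l * (l * \<tau>) powr (b / A - 1) * exp (- l * \<tau>) / ((c + v) * A * Gamma ((b + A) / A))
          * tail M (D 1) (t - \<tau>) * (kummer_1F1 1 ((b + A + r) / A) (l * \<tau>) - 1)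
        + xi b r A c v l \<mu> \<tau> t * eta b r A l \<mu> \<tau> t * t / (\<tau> * (t - \<tau>)) \<and>
      p_given x t (- v) =
        b * \<mu> * (\<mu> * (t - \<tau>)) powr (r / A - 1) * exp (- \<mu> * (t - \<tau>)) / ((c + v) * A * Gamma ((r + A) / A))
          * tail M (U 1) \<tau> * (kummer_1F1 1 ((b + A + r) / A) (\<mu> * (t - \<tau>)) - 1)
        + xi_tilde b r A c v l \<mu> \<tau> t * eta_tilde b r A l \<mu> \<tau> t * t / (\<tau> * (t - \<tau>))"
      unfolding Let_def \<tau>_def[symmetric]
    proof (intro conjI)
      show "position_cdf M c v X U D t differentiable (at x)"
        "position_cdf_given M c v X U D c t differentiable (at x)"
        "position_cdf_given M c v X U D (- v) t differentiable (at x)"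
        using total up down real_differentiable_def by blast+
    qed (rule p up_eq down_eq)+
  qed
qed

end
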